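(* Let $E$ be a finite layer set, $\mathcal K$ a compact color set, $q\ge1$, and $J=(J^e)_{e\in E}$ with $J^e\in C(\mathcal K)^{q\times\dots\times q}$ ($r$-arrays). Then there is a constant $c>0$ such that for every $\varepsilon>0$ (small), every $E$-layered $(\mathcal K,r)$-graphon $W=(W^e)_{e\in E}$ and every integer $k\ge c\,\varepsilon^{-4}\log(\varepsilon^{-1})$, $$\mathbb P\Big(\big|\mathcal E(W,J)-\hat{\mathcal E}(\mathbb G(k,W),J)\big|>\varepsilon\,|E|\,\|J\|_\infty\|W\|_\infty\Big)<\varepsilon.$$
   Context: Fix an integer $r\ge1$. $s([r],r)$ denotes the set of nonempty subsets of $[r]$. A $(\mathcal K,r)$-graphon is a measurable $W:[0,1]^{s([r],r)}\to\mathcal K$; an $E$-layered one is a tuple $W=(W^e)_{e\in E}$ of them. $C(\mathcal K)$ is the space of continuous real functions on $\mathcal K$; $\|J\|_\infty=\max_{e,z}\|J^e_z\|_\infty$, and $\|W\|_\infty$ denotes the supremum of the magnitudes of the values of the $W^e$ (the colors being regarded as numbers/elements of a normed space). A $q$-fractional partition of $[0,1]$ is a tuple $\phi=(\phi_1,\dots,\phi_q)$ of measurable $\phi_i:[0,1]\to[0,1]$ with $\sum_i\phi_i(x)=1$ for all $x$. Define $\mathcal E_\phi(W,J)=\sum_{e\in E}\sum_{z\in[q]^r}\int_{[0,1]^{s([r],r)}}J^e_{z_1,\dots,z_r}(W^e(x))\prod_{j=1}^r\phi_{z_j}(x_{\{j\}})\,dx$ and $\mathcal E(W,J)=\sup_\phi\mathcal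 E_\phi(W,J)$ over all $q$-fractional partitions. For a tuple $G=(G^e)_{e\in E}$ of arrays $G^e:[k]^r\to\mathcal K$ and $x=(x_{n,m})_{n\in[k],m\in[q]}$ with $x_{n,m}\in[0,1]$, $\sum_m x_{n,m}=1$, set $\mathcal E_x(G,J)=\sum_{e\in E}k^{-r}\sum_{z\in[q]^r}\sum_{(n_1,\dots,n_r)\in[k]^r}J^e_{z_1,\dots,z_r}(G^e_{n_1,\dots,n_r})\prod_{j=1}^rx_{n_j,z_j}$, and $\hat{\mathcal E}(G,J)=\max_x\mathcal E_x(G,J)$ over integer partitions ($x_{n,m}\in\{0,1\}$). The random sample $\mathbb G(k,W)=(\mathbb G(k,W^e))_{e\in E}$: take i.i.d. uniform $[0,1]$ variables $U_T$ indexed by nonempty $T\subseteq[k]$ with $|T|\le r$ (the same for all layers), and set $\mathbb G(k,W^e)_{i_1,\dots,i_r}=W^e\big((U_{\{i_j:j\in A\}})_{A\in s([r],r)}\big)$ for $(i_1,\dots,i_r)\in[k]^r$.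
   Formalization: Proved for graphons with ‖W‖∞ ≥ δ, where δ>0 is arbitrary but fixed, and c (and the smallness of ε) may depend on δ; without a lower bound the claim fails, e.g. for max-cut J (constant in the color), W ≡ t with t → 0 and k odd. *)

theory Defs
  imports "HOL-Probability.Probability"
begin

definition subsets_upto :: "nat \<Rightarrow> nat \<Rightarrow> nat set set" where
  "subsets_upto n m = {T. T \<subseteq> {1..n} \<and> T \<noteq> {} \<and> card T \<le> m}"

(* The uniform probability measure on [0,1]^s([n],m): the law of the independent
   uniform variables U_T.  For n = m = r it is Lebesgue measure on the domain of a graphon. *)
definition unif :: "nat \<Rightarrow> nat \<Rightarrow> (nat set \<Rightarrow> real) measure" where
  "unif n m = PiM (subsets_upto n m) (\<lambda>_. restrict_space lborel {0..1})"

(* [n]^r, as extensional functions. *)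
definition tuples :: "nat \<Rightarrow> nat \<Rightarrow> (nat \<Rightarrow> nat) set" where
  "tuples n r = {1..r} \<rightarrow>\<^sub>E {1..n}"

(* W is evaluated on diagonals when sampling, a null set, so measurability is Borel
   measurability and W is a genuine function, not a class modulo null sets. *)
definition layered_graphon ::
  "'e set \<Rightarrow> 'a::topological_space set \<Rightarrow> nat \<Rightarrow> ('e \<Rightarrow> (nat set \<Rightarrow> real) \<Rightarrow> 'a) \<Rightarrow> bool" where
  "layered_graphon E K r W \<longleftrightarrow> (\<forall>e\<in>E. W e \<in> measurable (unif r r) (restrict_space borel K))"

definition coupling_norm ::
  "'e set \<Rightarrow> 'a set \<Rightarrow> nat \<Rightarrow> nat \<Rightarrow> ('e \<Rightarrow> (nat \<Rightarrow> nat) \<Rightarrow> 'a \<Rightarrow> real) \<Rightarrow> real" where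
  "coupling_norm E K q r J = Max ((\<lambda>(e, z). SUP a\<in>K. \<bar>J e z a\<bar>) ` (E \<times> tuples q r))"

definition graphon_norm ::
  "'e set \<Rightarrow> nat \<Rightarrow> ('e \<Rightarrow> (nat set \<Rightarrow> real) \<Rightarrow> 'a::real_normed_vector) \<Rightarrow> real" where
  "graphon_norm E r W = (SUP (e, x)\<in>E \<times> space (unif r r). norm (W e x))"

definition fractional_partition :: "nat \<Rightarrow> (nat \<Rightarrow> real \<Rightarrow> real) \<Rightarrow> bool" where
  "fractional_partition q \<phi> \<longleftrightarrow>
     (\<forall>m\<in>{1..q}. \<phi> m \<in> borel_measurable (restrict_space lborel {0..1}) \<and>
                 (\<forall>t\<in>{0..1}. \<phi> m t \<in> {0..1})) \<and>
     (\<forall>t\<in>{0..1}. (\<Sum>m\<in>{1..q}. \<phi> m t) = 1)"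

definition energy_at ::
  "'e set \<Rightarrow> nat \<Rightarrow> nat \<Rightarrow> ('e \<Rightarrow> (nat set \<Rightarrow> real) \<Rightarrow> 'a) \<Rightarrow>
   ('e \<Rightarrow> (nat \<Rightarrow> nat) \<Rightarrow> 'a \<Rightarrow> real) \<Rightarrow> (nat \<Rightarrow> real \<Rightarrow> real) \<Rightarrow> real" where
  "energy_at E q r W J \<phi> =
     (\<Sum>e\<in>E. \<Sum>z\<in>tuples q r.
        \<integral>x. J e z (W e x) * (\<Prod>j\<in>{1..r}. \<phi> (z j) (x {j})) \<partial>unif r r)"

definition energy ::
  "'e set \<Rightarrow> nat \<Rightarrow> nat \<Rightarrow> ('e \<Rightarrow> (nat set \<Rightarrow> real) \<Rightarrow> 'a) \<Rightarrow>
   ('e \<Rightarrow> (nat \<Rightarrow> nat) \<Rightarrow> 'a \<Rightarrow> real) \<Rightarrow> real" where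
  "energy E q r W J = (SUP \<phi>\<in>{\<phi>. fractional_partition q \<phi>}. energy_at E q r W J \<phi>)"

definition array_energy_at ::
  "'e set \<Rightarrow> nat \<Rightarrow> nat \<Rightarrow> nat \<Rightarrow> ('e \<Rightarrow> (nat \<Rightarrow> nat) \<Rightarrow> 'a) \<Rightarrow>
   ('e \<Rightarrow> (nat \<Rightarrow> nat) \<Rightarrow> 'a \<Rightarrow> real) \<Rightarrow> (nat \<Rightarrow> nat \<Rightarrow> real) \<Rightarrow> real" where
  "array_energy_at E q r k G J x =
     (\<Sum>e\<in>E. 1 / real k ^ r *
        (\<Sum>z\<in>tuples q r. \<Sum>n\<in>tuples k r. J e z (G e n) * (\<Prod>j\<in>{1..r}. x (n j) (z j))))"

(* Extensional, so that this is a finite set and Max below is a maximum. *)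
definition integer_partitions :: "nat \<Rightarrow> nat \<Rightarrow> (nat \<Rightarrow> nat \<Rightarrow> real) set" where
  "integer_partitions k q =
     {x \<in> {1..k} \<rightarrow>\<^sub>E ({1..q} \<rightarrow>\<^sub>E {0, 1}). \<forall>n\<in>{1..k}. (\<Sum>m\<in>{1..q}. x n m) = 1}"

definition array_energy ::
  "'e set \<Rightarrow> nat \<Rightarrow> nat \<Rightarrow> nat \<Rightarrow> ('e \<Rightarrow> (nat \<Rightarrow> nat) \<Rightarrow> 'a) \<Rightarrow>
   ('e \<Rightarrow> (nat \<Rightarrow> nat) \<Rightarrow> 'a \<Rightarrow> real) \<Rightarrow> real" where
  "array_energy E q r k G J = Max (array_energy_at E q r k G J ` integer_partitions k q)"

(* The array G(k,W) as a function of the outcome u = (U_T) drawn from unif k r;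
   all layers are evaluated at the same outcome. *)
definition sample ::
  "nat \<Rightarrow> ('e \<Rightarrow> (nat set \<Rightarrow> real) \<Rightarrow> 'a) \<Rightarrow> (nat set \<Rightarrow> real) \<Rightarrow> 'e \<Rightarrow> (nat \<Rightarrow> nat) \<Rightarrow> 'a" where
  "sample r W u e i = W e (\<lambda>A\<in>subsets_upto r r. u (i ` A))"

end

theory Submission
  imports Defs
begin

text \<open>
  Suppose the sampled energy exceeds the energy of the graphon by \<open>\<epsilon>\<close> with probability at least
  \<open>\<theta>\<close>. Condition on this symmetric event and let \<open>a\<close> be a uniformly chosen label array of too
  large energy; the pair of sample and labels is exchangeable, with density at most \<open>1 / \<theta>\<close>, so
  the mean energy of \<open>a\<close> is essentially the mean of the contribution of the first \<open>r\<close> vertices.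
  Predict the label of a vertex from a set \<open>S\<close> of other vertices, their labels and the variables
  involving them. The least logarithmic loss lies in \<open>[0, ln q]\<close> and decreases as \<open>S\<close> grows, so for
  some \<open>S\<close> of size \<open>O(1 / \<epsilon>\<^sup>2)\<close> another \<open>r - 1\<close> vertices hardly help; then the labels of the first
  \<open>r\<close> vertices may be replaced, one after the other, by their predictions. For fixed labels and
  variables on \<open>S\<close> the predictions average to a fractional partition. As the labels on \<open>S\<close> take
  only \<open>q ^ card S\<close> values, a union bound over exponential moments of the average over about
  \<open>k / r\<close> disjoint blocks of vertices shows that the mean energy cannot exceed the energy of the
  graphon by \<open>\<epsilon>\<close>. For the lower tail, conditioning in the same way on the sampled energy being too
  small, draw the labels independently according to a nearly optimal fractional partition; here \<open>S\<close>
  is empty.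
\<close>

section \<open>Resampling coordinates of a product space\<close>

text \<open>A union bound over all \<open>q ^ k\<close> label arrays fails: it costs
  \<open>k * ln q\<close> in the exponent, while about \<open>k / r\<close> independent blocks with
  deviation \<epsilon> earn only an order of \<open>\<epsilon>\<^sup>2 * k\<close>. The labels have
  to be compressed before concentration is applied. Conditioning turns the maximum over labels into
  a mean, at the price of \<open>ln (1 / \<theta>)\<close>, and exchangeability then allows the
  vertices to be placed freely. The exponent 4: replacing a label costs the square root of the loss
  that could still be gained, so this gain \<open>d\<close> must be of order
  \<open>\<epsilon>\<^sup>2\<close>, and the predicting set may reach a size of order
  \<open>1 / d\<close>. The union bound charges \<open>card S * ln q + ln (1 / \<theta>)\<close>
  against \<open>\<gamma> * M\<close> with \<open>\<gamma>\<close> of order \<epsilon>, and the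
  quotient must again be of order \<epsilon>. This makes the number \<open>M\<close> of blocks of
  order \<open>1 / \<epsilon> ^ 4\<close>, up to the logarithm that enters through \<theta> =
  \<epsilon> / 3.\<close>

locale finite_power_space = prob_space M for M :: "'b measure" +
  fixes I :: "'i set"
  assumes finite_I: "finite I"
begin

abbreviation P :: "('i \<Rightarrow> 'b) measure" where "P \<equiv> PiM I (\<lambda>_. M)"

text \<open>The restriction to \<open>I\<close> keeps the result extensional, hence a point of
  \<open>P\<close>. Conditioning on the coordinates in \<open>A\<close> becomes fixing
  \<open>w\<close> and integrating over \<open>v\<close>.\<close>

definition splice :: "'i set \<Rightarrow> ('i \<Rightarrow> 'b) \<Rightarrow> ('i \<Rightarrow> 'b) \<Rightarrow> 'i \<Rightarrow> 'b" where
  "splice A w v = (\<lambda>i\<in>I. if i \<in> A then w i else v i)"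

definition depends_on :: "(('i \<Rightarrow> 'b) \<Rightarrow> 'c) \<Rightarrow> 'i set \<Rightarrow> bool" where
  "depends_on f A \<longleftrightarrow>
     (\<forall>u\<in>space P. \<forall>v\<in>space P. (\<forall>i\<in>I \<inter> A. u i = v i) \<longrightarrow> f u = f v)"

lemma depends_onD:
  "depends_on f A \<Longrightarrow> u \<in> space P \<Longrightarrow> v \<in> space P \<Longrightarrow>
    (\<And>i. i \<in> I \<Longrightarrow> i \<in> A \<Longrightarrow> u i = v i) \<Longrightarrow> f u = f v"
  unfolding depends_on_def by blast

sublocale P: prob_space P
  by (intro prob_space_PiM) (rule prob_space_axioms)

lemma integrable_bounded:
  fixes f :: "_ \<Rightarrow> real"
  assumes "f \<in> borel_measurable P" "\<And>u. u \<in> space P \<Longrightarrow> \<bar>f u\<bar> \<le> B"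
  shows "integrable P f"
  using assms by (intro P.integrable_const_bound[of _ B]) auto

lemma measurable_splice [measurable]:
  "(\<lambda>(w, v). splice A w v) \<in> measurable (P \<Otimes>\<^sub>M P) P"
  unfolding splice_def case_prod_beta by (intro measurable_restrict) measurable

lemma splice_space: "w \<in> space P \<Longrightarrow> v \<in> space P \<Longrightarrow> splice A w v \<in> space P"
  by (auto simp: splice_def space_PiM)

text \<open>Every coordinate is read from exactly one of two independent points, so on a box the
  measure factors coordinatewise, the side that is not read contributing total mass 1.\<close>

lemma distr_splice: "distr (P \<Otimes>\<^sub>M P) P (\<lambda>(w, v). splice A w v) = P"
proof -
  interpret product_sigma_finite "\<lambda>_::'i. M" ..
  interpret PP: pair_prob_space P P ..
  show ?thesis
  proof (rule PiM_eqI[OF finite_I])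
    fix X assume X: "\<And>i. i \<in> I \<Longrightarrow> X i \<in> sets M"
    let ?Y = "\<lambda>i. if i \<in> A then X i else space M"
    let ?Z = "\<lambda>i. if i \<in> A then space M else X i"
    have sp: "\<And>i x. i \<in> I \<Longrightarrow> x \<in> X i \<Longrightarrow> x \<in> space M"
      using X sets.sets_into_space by blast
    have pre: "(\<lambda>(w, v). splice A w v) -` Pi\<^sub>E I X \<inter> space (P \<Otimes>\<^sub>M P) = Pi\<^sub>E I ?Y \<times> Pi\<^sub>E I ?Z"
    proof (intro equalityI subsetI)
      fix z assume "z \<in> (\<lambda>(w, v). splice A w v) -` Pi\<^sub>E I X \<inter> space (P \<Otimes>\<^sub>M P)"
      then obtain w v where z: "z = (w, v)" and m: "splice A w v \<in> Pi\<^sub>E I X"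
        and w: "w \<in> Pi\<^sub>E I (\<lambda>_. space M)" and v: "v \<in> Pi\<^sub>E I (\<lambda>_. space M)"
        by (cases z) (auto simp: space_pair_measure space_PiM)
      have *: "(if i \<in> A then w i else v i) \<in> X i" if "i \<in> I" for i
        using PiE_mem[OF m that] that by (simp add: splice_def)
      have "w \<in> Pi\<^sub>E I ?Y" "v \<in> Pi\<^sub>E I ?Z"
        using * w v by (force simp: PiE_iff)+
      then show "z \<in> Pi\<^sub>E I ?Y \<times> Pi\<^sub>E I ?Z" by (simp add: z)
    next
      fix z assume "z \<in> Pi\<^sub>E I ?Y \<times> Pi\<^sub>E I ?Z"
      then obtain w v where z: "z = (w, v)" and wv: "w \<in> Pi\<^sub>E I ?Y" "v \<in> Pi\<^sub>E I ?Z"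
        by (cases z) auto
      have "w \<in> space P" "v \<in> space P"
        using wv sp by (fastforce simp: space_PiM PiE_iff split: if_splits)+
      moreover have "splice A w v \<in> Pi\<^sub>E I X"
        unfolding splice_def
      proof (rule restrict_PiE_iff[THEN iffD2], rule ballI)
        fix i assume "i \<in> I"
        then show "(if i \<in> A then w i else v i) \<in> X i"
          using PiE_mem[OF wv(1), of i] PiE_mem[OF wv(2), of i] by (cases "i \<in> A") auto
      qed
      ultimately show "z \<in> (\<lambda>(w, v). splice A w v) -` Pi\<^sub>E I X \<inter> space (P \<Otimes>\<^sub>M P)"
        by (simp add: z space_pair_measure)
    qed
    have sY: "\<And>i. i \<in> I \<Longrightarrow> ?Y i \<in> sets M" and sZ: "\<And>i. i \<in> I \<Longrightarrow> ?Z i \<in> sets M"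
      using X by auto
    have "emeasure (distr (P \<Otimes>\<^sub>M P) P (\<lambda>(w, v). splice A w v)) (Pi\<^sub>E I X)
        = emeasure (P \<Otimes>\<^sub>M P) (Pi\<^sub>E I ?Y \<times> Pi\<^sub>E I ?Z)"
      using X finite_I by (subst emeasure_distr) (auto simp: pre intro!: sets_PiM_I_finite)
    also have "\<dots> = emeasure P (Pi\<^sub>E I ?Y) * emeasure P (Pi\<^sub>E I ?Z)"
      using sY sZ finite_I by (intro P.emeasure_pair_measure_Times sets_PiM_I_finite) auto
    also have "\<dots> = (\<Prod>i\<in>I. emeasure M (?Y i)) * (\<Prod>i\<in>I. emeasure M (?Z i))"
      using sY sZ finite_I by (subst (1 2) emeasure_PiM) auto
    also have "\<dots> = (\<Prod>i\<in>I. emeasure M (X i))"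
      unfolding prod.distrib[symmetric]
      by (intro prod.cong) (auto simp: emeasure_space_1)
    finally show "emeasure (distr (P \<Otimes>\<^sub>M P) P (\<lambda>(w, v). splice A w v)) (Pi\<^sub>E I X)
        = (\<Prod>i\<in>I. emeasure M (X i))" .
  qed simp
qed

lemma measurable_splice_right [measurable]: "w \<in> space P \<Longrightarrow> splice A w \<in> measurable P P"
  using measurable_compose[OF measurable_Pair1'[of w P P] measurable_splice] by simp

text \<open>The tower property: the inner integral is a version of the conditional expectation given
  the coordinates in \<open>A\<close>.\<close>

lemma integral_splice:
  fixes f :: "_ \<Rightarrow> real"
  assumes [measurable]: "f \<in> borel_measurable P"
    and B: "\<And>u. u \<in> space P \<Longrightarrow> \<bar>f u\<bar> \<le> B"
  shows "(\<integral>u. f u \<partial>P) = (\<integral>w. (\<integral>v. f (splice A w v) \<partial>P) \<partial>P)"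
    and "(\<lambda>w. \<integral>v. f (splice A w v) \<partial>P) \<in> borel_measurable P"
proof -
  interpret PP: pair_prob_space P P ..
  have m: "(\<lambda>z. f (splice A (fst z) (snd z))) \<in> borel_measurable (P \<Otimes>\<^sub>M P)"
    using measurable_compose[OF measurable_splice assms(1)] by (simp add: case_prod_beta)
  have "(\<integral>u. f u \<partial>P) = (\<integral>u. f u \<partial>(distr (P \<Otimes>\<^sub>M P) P (\<lambda>(w, v). splice A w v)))"
    by (simp only: distr_splice)
  also have "\<dots> = (\<integral>z. f (splice A (fst z) (snd z)) \<partial>(P \<Otimes>\<^sub>M P))"
    by (subst integral_distr) (auto simp: case_prod_beta)
  also have "\<dots> = (\<integral>w. (\<integral>v. f (splice A w v) \<partial>P) \<partial>P)"
  proof (subst PP.integral_fst'[symmetric])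
    show "integrable (P \<Otimes>\<^sub>M P) (\<lambda>z. f (splice A (fst z) (snd z)))"
      using m B by (intro PP.integrable_const_bound[of _ B])
        (auto simp: space_pair_measure splice_space)
  qed simp
  finally show "(\<integral>u. f u \<partial>P) = (\<integral>w. (\<integral>v. f (splice A w v) \<partial>P) \<partial>P)" .
  show "(\<lambda>w. \<integral>v. f (splice A w v) \<partial>P) \<in> borel_measurable P"
    using m by (intro P.borel_measurable_lebesgue_integral) (simp add: case_prod_beta)
qed

text \<open>After splicing, \<open>f\<close> sees only \<open>w\<close> and \<open>g\<close> only
  \<open>v\<close>, so the independence of functions of disjoint coordinates becomes an iterated
  integral of a product.\<close>

lemma integral_mult_disjoint:
  fixes f g :: "_ \<Rightarrow> real"
  assumes [measurable]: "f \<in> borel_measurable P" "g \<in> borel_measurable P"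
    and B: "\<And>u. u \<in> space P \<Longrightarrow> \<bar>f u\<bar> \<le> B" "\<And>u. u \<in> space P \<Longrightarrow> \<bar>g u\<bar> \<le> C"
    and dep: "depends_on f A" "depends_on g (- A)"
  shows "(\<integral>u. f u * g u \<partial>P) = (\<integral>u. f u \<partial>P) * (\<integral>u. g u \<partial>P)"
proof -
  have f: "f (splice A w v) = f w" and g: "g (splice A w v) = g v"
    if "w \<in> space P" "v \<in> space P" for w v
    using that splice_space[OF that]
    by (auto intro!: depends_onD[OF dep(1)] depends_onD[OF dep(2)] simp: splice_def)
  have "(\<integral>u. f u * g u \<partial>P) = (\<integral>w. (\<integral>v. f (splice A w v) * g (splice A w v) \<partial>P) \<partial>P)"
  proof (rule integral_splice(1))
    show "\<bar>f u * g u\<bar> \<le> \<bar>B\<bar> * \<bar>C\<bar>" if "u \<in> space P" for u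
      using B[OF that] unfolding abs_mult by (intro mult_mono) auto
  qed simp
  also have "\<dots> = (\<integral>w. (\<integral>v. f w * g v \<partial>P) \<partial>P)"
    by (intro Bochner_Integration.integral_cong) (auto simp: f g)
  finally show ?thesis by simp
qed

lemma depends_on_mono: "depends_on f A \<Longrightarrow> A \<subseteq> B \<Longrightarrow> depends_on f B"
  unfolding depends_on_def by blast

lemma integral_prod_disjoint:
  fixes f :: "'j \<Rightarrow> _ \<Rightarrow> real"
  assumes "finite L" and m: "\<And>j. j \<in> L \<Longrightarrow> f j \<in> borel_measurable P"
    and B: "\<And>j u. j \<in> L \<Longrightarrow> u \<in> space P \<Longrightarrow> \<bar>f j u\<bar> \<le> B"
    and dep: "\<And>j. j \<in> L \<Longrightarrow> depends_on (f j) (K j)" and dis: "disjoint_family_on K L"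
  shows "(\<integral>u. (\<Prod>j\<in>L. f j u) \<partial>P) = (\<Prod>j\<in>L. \<integral>u. f j u \<partial>P)"
  using assms
proof (induction L rule: finite_induct)
  case empty
  show ?case by (simp add: P.prob_space)
next
  case (insert j L)
  have "(\<integral>u. f j u * (\<Prod>i\<in>L. f i u) \<partial>P) = (\<integral>u. f j u \<partial>P) * (\<integral>u. (\<Prod>i\<in>L. f i u) \<partial>P)"
  proof (rule integral_mult_disjoint[where A = "K j" and B = B and C = "\<bar>B\<bar> ^ card L"])
    show "\<bar>\<Prod>i\<in>L. f i u\<bar> \<le> \<bar>B\<bar> ^ card L" if "u \<in> space P" for u
    proof -
      have "\<bar>f i u\<bar> \<le> \<bar>B\<bar>" if "i \<in> L" for i
        using insert.prems(2)[of i u] that \<open>u \<in> space P\<close> by auto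
      then have "(\<Prod>i\<in>L. \<bar>f i u\<bar>) \<le> (\<Prod>i\<in>L. \<bar>B\<bar>)"
        by (intro prod_mono) auto
      then show ?thesis by (simp add: abs_prod)
    qed
    have d: "depends_on (f i) (- K j)" if i: "i \<in> L" for i
    proof (rule depends_on_mono)
      show "depends_on (f i) (K i)" using insert.prems(3) i by simp
      have "K i \<inter> K j = {}"
        using insert.hyps(2) i by (intro disjoint_family_onD[OF insert.prems(4)]) auto
      then show "K i \<subseteq> - K j" by blast
    qed
    show "depends_on (\<lambda>u. \<Prod>i\<in>L. f i u) (- K j)"
      unfolding depends_on_def
    proof (intro ballI impI prod.cong refl)
      fix u v i assume "u \<in> space P" "v \<in> space P" "\<forall>i\<in>I \<inter> - K j. u i = v i" "i \<in> L"
      then show "f i u = f i v" using d[of i] unfolding depends_on_def by blast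
    qed
    show "(\<lambda>u. \<Prod>i\<in>L. f i u) \<in> borel_measurable P"
      using insert.prems(1) by (intro borel_measurable_prod) simp
    show "f j \<in> borel_measurable P" "depends_on (f j) (K j)"
      using insert.prems by simp_all
    show "\<bar>f j u\<bar> \<le> B" if "u \<in> space P" for u
      using insert.prems(2) that by simp
  qed
  also have "(\<integral>u. (\<Prod>i\<in>L. f i u) \<partial>P) = (\<Prod>i\<in>L. \<integral>u. f i u \<partial>P)"
  proof (rule insert.IH)
    show "disjoint_family_on K L"
      using insert.prems(4) by (rule disjoint_family_on_mono[rotated]) auto
  qed (use insert.prems in simp_all)
  finally show ?case using insert.hyps by simp
qed

lemma integral_reindex:
  fixes f :: "_ \<Rightarrow> real"
  assumes \<pi>: "bij_betw \<pi> I I" and [measurable]: "f \<in> borel_measurable P"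
  shows "(\<integral>u. f (\<lambda>i\<in>I. u (\<pi> i)) \<partial>P) = (\<integral>u. f u \<partial>P)"
proof -
  have \<pi>I: "\<pi> i \<in> I" if "i \<in> I" for i using \<pi> that by (auto simp: bij_betw_def)
  have m: "(\<lambda>u. \<lambda>i\<in>I. u (\<pi> i)) \<in> measurable P P"
    using \<pi>I by (intro measurable_restrict measurable_component_singleton) auto
  have "distr P P (\<lambda>u. \<lambda>i\<in>I. u (\<pi> i)) = P"
    using distr_PiM_reindex[of I "\<lambda>_. M" \<pi> I] \<pi> prob_space_axioms by (auto simp: bij_betw_def)
  then have "(\<integral>u. f u \<partial>P) = (\<integral>u. f u \<partial>(distr P P (\<lambda>u. \<lambda>i\<in>I. u (\<pi> i))))" by simp
  also have "\<dots> = (\<integral>u. f (\<lambda>i\<in>I. u (\<pi> i)) \<partial>P)"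
    using m by (subst integral_distr) auto
  finally show ?thesis ..
qed

text \<open>Hoeffding's lemma on an interval of length 2, whence \<open>l\<^sup>2 * 4 / 8\<close>.
  It is phrased with a bound \<open>V\<close> for the mean because the means of blocks are only
  bounded by an energy, not equal to it.\<close>

lemma integral_exp_le:
  fixes f :: "_ \<Rightarrow> real"
  assumes [measurable]: "f \<in> borel_measurable P"
    and B: "\<And>u. u \<in> space P \<Longrightarrow> \<bar>f u\<bar> \<le> 1" and V: "(\<integral>u. f u \<partial>P) \<le> V" and l: "l > 0"
  shows "(\<integral>u. exp (l * f u) \<partial>P) \<le> exp (l * V + l\<^sup>2 / 2)"
proof -
  interpret X: interval_bounded_random_variable P f "-1" 1
    using B by unfold_locales (auto simp: abs_le_iff)
  let ?\<mu> = "\<integral>u. f u \<partial>P"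
  have le: "exp (l * x) \<le> exp l" if "\<bar>x\<bar> \<le> 1" for x
    using that l by (simp add: abs_le_iff)
  have int: "integrable P (\<lambda>u. exp (l * f u))"
    using B le by (intro integrable_bounded[of _ "exp l"]) auto
  have eq: "exp (l * (f u - ?\<mu>)) = exp (- (l * ?\<mu>)) * exp (l * f u)" for u
    by (simp add: algebra_simps flip: exp_add)
  have "ennreal (\<integral>u. exp (l * (f u - ?\<mu>)) \<partial>P) = (\<integral>\<^sup>+u. exp (l * (f u - ?\<mu>)) \<partial>P)"
    using int by (intro nn_integral_eq_integral[symmetric]) (auto simp: eq)
  also have "\<dots> \<le> ennreal (exp (l\<^sup>2 * (1 - (- 1))\<^sup>2 / 8))"
    by (rule X.Hoeffdings_lemma_nn_integral[OF l])
  finally have "exp (- (l * ?\<mu>)) * (\<integral>u. exp (l * f u) \<partial>P) \<le> exp (l\<^sup>2 / 2)"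
    by (simp add: eq)
  then have "exp (l * ?\<mu>) * (exp (- (l * ?\<mu>)) * (\<integral>u. exp (l * f u) \<partial>P)) \<le> exp (l * ?\<mu>) * exp (l\<^sup>2 / 2)"
    by (intro mult_left_mono) auto
  then have "(\<integral>u. exp (l * f u) \<partial>P) \<le> exp (l * ?\<mu> + l\<^sup>2 / 2)"
    by (simp add: mult.assoc[symmetric] flip: exp_add)
  also have "\<dots> \<le> exp (l * V + l\<^sup>2 / 2)" using V l by simp
  finally show ?thesis .
qed

end

section \<open>Symmetries of the sample and the multilinear extension of the weights\<close>

lemma finite_subsets_upto [simp]: "finite (subsets_upto n m)"
  by (rule finite_subset[of _ "Pow {1..n}"]) (auto simp: subsets_upto_def)

lemma finite_tuples [simp]: "finite (tuples n m)"
  by (simp add: tuples_def finite_PiE)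

lemma tuples_mem: "a \<in> tuples n m \<Longrightarrow> j \<in> {1..m} \<Longrightarrow> a j \<in> {1..n}"
  by (auto simp: tuples_def)

definition prob_vec :: "nat \<Rightarrow> (nat \<Rightarrow> real) \<Rightarrow> bool" where
  "prob_vec q c \<longleftrightarrow> (\<forall>m\<in>{1..q}. 0 \<le> c m) \<and> (\<Sum>m\<in>{1..q}. c m) = 1"

text \<open>The vertices of the probability simplex: a label viewed as the distribution concentrated
  on it, so that labels and predictions are objects of the same kind.\<close>

definition vertex :: "nat \<Rightarrow> nat \<Rightarrow> real" where
  "vertex m = (\<lambda>m'. if m' = m then 1 else 0)"

lemma prob_vec_vertex: "m \<in> {1..q} \<Longrightarrow> prob_vec q (vertex m)"
  by (simp add: prob_vec_def vertex_def)

lemma prob_vec_le_1: "prob_vec q c \<Longrightarrow> m \<in> {1..q} \<Longrightarrow> c m \<le> 1"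
  using member_le_sum[of m "{1..q}" c] by (auto simp: prob_vec_def)

lemma prod_vertex:
  assumes y: "y \<in> tuples q r" and z: "z \<in> tuples q r"
  shows "(\<Prod>j\<in>{1..r}. vertex (z j) (y j)) = (if y = z then 1 else 0)"
proof (cases "y = z")
  case False
  have "\<exists>j\<in>{1..r}. y j \<noteq> z j"
  proof (rule ccontr)
    assume "\<not> (\<exists>j\<in>{1..r}. y j \<noteq> z j)"
    then have "y = z"
      using y z unfolding tuples_def by (intro PiE_ext[of y "{1..r}" _ z]) auto
    with False show False ..
  qed
  then obtain j where j: "j \<in> {1..r}" "y j \<noteq> z j" ..
  then have "vertex (z j) (y j) = 0" by (simp add: vertex_def)
  with j(1) have "(\<Prod>j\<in>{1..r}. vertex (z j) (y j)) = 0"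
    by (intro prod_zero) auto
  then show ?thesis using False by simp
qed (simp add: vertex_def)

text \<open>In the application \<open>w z x\<close> is the sum over the layers of
  \<open>J e z (W e x)\<close>, divided by the number of layers times the norm of \<open>J\<close>.
  All layers share their variables, so they merge into one weight bounded by 1.\<close>

locale sampling =
  fixes k r q :: nat and w :: "(nat \<Rightarrow> nat) \<Rightarrow> (nat set \<Rightarrow> real) \<Rightarrow> real"
  assumes r_pos: "1 \<le> r" and q_pos: "1 \<le> q" and r_le_k: "r \<le> k"
    and w_measurable: "z \<in> tuples q r \<Longrightarrow> w z \<in> borel_measurable (unif r r)"
    and w_le: "z \<in> tuples q r \<Longrightarrow> x \<in> space (unif r r) \<Longrightarrow> \<bar>w z x\<bar> \<le> 1"
begin

abbreviation "I \<equiv> subsets_upto k r"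
abbreviation "D \<equiv> subsets_upto r r"
abbreviation "Lab \<equiv> tuples q k"
abbreviation "M01 \<equiv> restrict_space lborel {0..1::real}"

sublocale finite_power_space M01 I
  by (intro finite_power_space.intro finite_power_space_axioms.intro prob_spaceI)
    (auto simp: emeasure_restrict_space space_restrict_space)

lemma unif_eq: "unif k r = P"
  by (simp add: unif_def)

lemma P_mem: "u \<in> space P \<Longrightarrow> T \<in> I \<Longrightarrow> u T \<in> {0..1}"
  by (auto simp: space_PiM space_restrict_space)

section \<open>Vertex permutations acting on variables and labels\<close>

definition act :: "(nat \<Rightarrow> nat) \<Rightarrow> (nat set \<Rightarrow> real) \<Rightarrow> nat set \<Rightarrow> real" where
  "act \<sigma> u = (\<lambda>T\<in>I. u (\<sigma> ` T))"

definition relabel :: "(nat \<Rightarrow> nat) \<Rightarrow> (nat \<Rightarrow> nat) \<Rightarrow> nat \<Rightarrow> nat" where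
  "relabel \<sigma> a = (\<lambda>n\<in>{1..k}. a (\<sigma> n))"

text \<open>The variables carried by the first \<open>r\<close> vertices, as a point of the domain
  of a graphon.\<close>

definition low :: "(nat set \<Rightarrow> real) \<Rightarrow> nat set \<Rightarrow> real" where
  "low u = restrict u D"

text \<open>The expected weight when the label of vertex \<open>j\<close> is drawn from
  \<open>b j\<close>, independently for different \<open>j\<close>.\<close>

definition multilin :: "(nat \<Rightarrow> nat \<Rightarrow> real) \<Rightarrow> (nat set \<Rightarrow> real) \<Rightarrow> real" where
  "multilin b x = (\<Sum>z\<in>tuples q r. (\<Prod>j\<in>{1..r}. b j (z j)) * w z x)"

text \<open>The energy of the sample at the integer partition that gives vertex \<open>n\<close> the
  label \<open>a n\<close>, up to the constant by which the weights were normalised.\<close>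

definition label_energy :: "(nat \<Rightarrow> nat) \<Rightarrow> (nat set \<Rightarrow> real) \<Rightarrow> real" where
  "label_energy a u = (\<Sum>n\<in>tuples k r. w (\<lambda>j\<in>{1..r}. a (n j)) (\<lambda>A\<in>D. u (n ` A))) / real k ^ r"

lemma image_I: "\<sigma> permutes {1..k} \<Longrightarrow> T \<in> I \<Longrightarrow> \<sigma> ` T \<in> I"
  using permutes_image[of \<sigma> "{1..k}"] card_image_le[of T \<sigma>]
  by (auto simp: subsets_upto_def finite_subset dest: le_trans)

lemma bij_image_I: "\<sigma> permutes {1..k} \<Longrightarrow> bij_betw (image \<sigma>) I I"
proof -
  assume \<sigma>: "\<sigma> permutes {1..k}"
  show ?thesis
  proof (rule bij_betwI[where g = "image (inv \<sigma>)"])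
    show "image \<sigma> \<in> I \<rightarrow> I" using image_I[OF \<sigma>] by auto
    show "image (inv \<sigma>) \<in> I \<rightarrow> I" using image_I[OF permutes_inv[OF \<sigma>]] by auto
  qed (simp_all add: image_comp permutes_inv_o[OF \<sigma>])
qed

lemma act_space: "\<sigma> permutes {1..k} \<Longrightarrow> u \<in> space P \<Longrightarrow> act \<sigma> u \<in> space P"
  using image_I by (auto simp: act_def space_PiM)

lemma measurable_act: "\<sigma> permutes {1..k} \<Longrightarrow> act \<sigma> \<in> measurable P P"
  unfolding act_def[abs_def] using image_I
  by (intro measurable_restrict measurable_component_singleton) auto

lemma integral_act:
  fixes f :: "_ \<Rightarrow> real"
  assumes "\<sigma> permutes {1..k}" "f \<in> borel_measurable P"
  shows "(\<integral>u. f (act \<sigma> u) \<partial>P) = (\<integral>u. f u \<partial>P)"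
  unfolding act_def using bij_image_I assms by (intro integral_reindex) auto

lemma relabel_mem: "\<sigma> permutes {1..k} \<Longrightarrow> a \<in> Lab \<Longrightarrow> relabel \<sigma> a \<in> Lab"
  using permutes_in_image[of \<sigma> "{1..k}"] by (fastforce simp: relabel_def tuples_def)

lemma relabel_comp: "\<tau> permutes {1..k} \<Longrightarrow> relabel \<tau> (relabel \<sigma> a) = relabel (\<sigma> \<circ> \<tau>) a"
  using permutes_in_image[of \<tau> "{1..k}"] by (auto simp: relabel_def fun_eq_iff)

lemma relabel_id: "a \<in> Lab \<Longrightarrow> relabel id a = a"
  by (auto simp: relabel_def tuples_def fun_eq_iff)

lemma relabel_inv:
  assumes "\<sigma> permutes {1..k}" "a \<in> Lab"
  shows "relabel \<sigma> (relabel (inv \<sigma>) a) = a" "relabel (inv \<sigma>) (relabel \<sigma> a) = a"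
  using assms relabel_comp[of \<sigma> "inv \<sigma>" a] relabel_comp[of "inv \<sigma>" \<sigma> a]
  by (simp_all add: permutes_inv permutes_inv_o relabel_id)

lemma bij_relabel:
  assumes "\<sigma> permutes {1..k}"
  shows "bij_betw (relabel \<sigma>) Lab Lab"
  using relabel_mem[OF assms] relabel_mem[OF permutes_inv[OF assms]] relabel_inv[OF assms]
  by (intro bij_betwI[where g = "relabel (inv \<sigma>)"]) auto

lemma D_subset_I: "D \<subseteq> I"
  using r_le_k by (auto simp: subsets_upto_def)

lemma D_eq: "T \<in> D \<longleftrightarrow> T \<subseteq> {1..r} \<and> T \<noteq> {}"
  using card_mono[of "{1..r}" T] by (auto simp: subsets_upto_def)

lemma tuple_image: "n \<in> tuples k r \<Longrightarrow> A \<in> D \<Longrightarrow> n ` A \<in> I"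
  using card_image_le[of A n] by (force simp: subsets_upto_def tuples_def finite_subset)

lemma measurable_tuple [measurable]:
  "n \<in> tuples k r \<Longrightarrow> (\<lambda>u. \<lambda>A\<in>D. u (n ` A)) \<in> measurable P (unif r r)"
  unfolding unif_def using tuple_image
  by (intro measurable_restrict measurable_component_singleton) auto

lemma measurable_low [measurable]: "low \<in> measurable P (unif r r)"
  unfolding unif_def low_def[abs_def] restrict_def[abs_def] using D_subset_I
  by (intro measurable_restrict[unfolded restrict_def[abs_def]] measurable_component_singleton) auto

lemma low_space: "u \<in> space P \<Longrightarrow> low u \<in> space (unif r r)"
  using measurable_space[OF measurable_low] by auto

lemma integral_low:
  fixes f :: "_ \<Rightarrow> real"
  assumes f: "f \<in> borel_measurable (unif r r)"
  shows "(\<integral>u. f (low u) \<partial>P) = (\<integral>x. f x \<partial>unif r r)"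
proof -
  have "distr P (PiM D (\<lambda>_. M01)) (\<lambda>u. \<lambda>T\<in>D. u T) = PiM D (\<lambda>_. M01)"
    using D_subset_I prob_space_axioms
    by (intro distr_PiM_reindex[where f = "\<lambda>T. T", simplified]) auto
  then have eq: "distr P (unif r r) low = unif r r"
    by (simp add: unif_def low_def[abs_def])
  have "(\<integral>x. f x \<partial>unif r r) = (\<integral>x. f x \<partial>(distr P (unif r r) low))"
    by (simp only: eq)
  also have "\<dots> = (\<integral>u. f (low u) \<partial>P)"
    using f by (intro integral_distr) measurable
  finally show ?thesis ..
qed

lemma relabel_tuple: "a \<in> Lab \<Longrightarrow> n \<in> tuples k r \<Longrightarrow> (\<lambda>j\<in>{1..r}. a (n j)) \<in> tuples q r"
  by (force simp: tuples_def)

lemma measurable_label_energy: "a \<in> Lab \<Longrightarrow> label_energy a \<in> borel_measurable P"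
  unfolding label_energy_def[abs_def]
  by (intro borel_measurable_divide borel_measurable_sum borel_measurable_const
      measurable_compose[OF measurable_tuple w_measurable] relabel_tuple)

lemma multilin_cong:
  "(\<And>j m. j \<in> {1..r} \<Longrightarrow> m \<in> {1..q} \<Longrightarrow> b j m = b' j m) \<Longrightarrow> multilin b x = multilin b' x"
  unfolding multilin_def
  by (intro sum.cong refl arg_cong2[where f = "(*)"] prod.cong) (auto dest: tuples_mem)

lemma multilin_le:
  assumes b: "\<And>j. j \<in> {1..r} \<Longrightarrow> prob_vec q (b j)" and x: "x \<in> space (unif r r)"
  shows "\<bar>multilin b x\<bar> \<le> 1"
proof -
  have "\<bar>multilin b x\<bar> \<le> (\<Sum>z\<in>tuples q r. \<bar>(\<Prod>j\<in>{1..r}. b j (z j)) * w z x\<bar>)"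
    unfolding multilin_def by (rule sum_abs)
  also have "\<dots> \<le> (\<Sum>z\<in>tuples q r. \<Prod>j\<in>{1..r}. b j (z j))"
  proof (rule sum_mono)
    fix z assume z: "z \<in> tuples q r"
    have "0 \<le> (\<Prod>j\<in>{1..r}. b j (z j))"
      using b tuples_mem[OF z] by (intro prod_nonneg) (auto simp: prob_vec_def)
    then show "\<bar>(\<Prod>j\<in>{1..r}. b j (z j)) * w z x\<bar> \<le> (\<Prod>j\<in>{1..r}. b j (z j))"
      using w_le[OF z x] by (simp add: abs_mult mult_left_le)
  qed
  also have "\<dots> = (\<Prod>j\<in>{1..r}. \<Sum>m\<in>{1..q}. b j m)"
    unfolding tuples_def by (rule prod_sum_PiE[symmetric]) auto
  also have "\<dots> = 1" using b by (intro prod.neutral) (auto simp: prob_vec_def)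
  finally show ?thesis .
qed

text \<open>This is what permits exchanging labels one vertex at a time: a distribution in slot
  \<open>j\<close> is an average over the labels tried in that slot.\<close>

lemma multilin_linear:
  assumes j: "j \<in> {1..r}"
  shows "multilin (b(j := c)) x = (\<Sum>m\<in>{1..q}. c m * multilin (b(j := vertex m)) x)"
proof -
  have split: "(\<Prod>i\<in>{1..r}. (b(j := d)) i (z i)) = d (z j) * (\<Prod>i\<in>{1..r}-{j}. b i (z i))" for d z
    using j by (subst prod.remove[of _ j]) auto
  have "(\<Sum>m\<in>{1..q}. c m * multilin (b(j := vertex m)) x)
      = (\<Sum>z\<in>tuples q r. \<Sum>m\<in>{1..q}. c m * (vertex m (z j) * (\<Prod>i\<in>{1..r}-{j}. b i (z i)) * w z x))"
    unfolding multilin_def split sum_distrib_left by (rule sum.swap)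
  also have "\<dots> = (\<Sum>z\<in>tuples q r. c (z j) * (\<Prod>i\<in>{1..r}-{j}. b i (z i)) * w z x)"
  proof (rule sum.cong[OF refl])
    fix z assume "z \<in> tuples q r"
    then have zj: "z j \<in> {1..q}" using j by (rule tuples_mem)
    have "(\<Sum>m\<in>{1..q}. c m * (vertex m (z j) * (\<Prod>i\<in>{1..r}-{j}. b i (z i)) * w z x))
        = (\<Sum>m\<in>{1..q}. if m = z j then c (z j) * (\<Prod>i\<in>{1..r}-{j}. b i (z i)) * w z x else 0)"
      by (intro sum.cong) (auto simp: vertex_def)
    also have "\<dots> = c (z j) * (\<Prod>i\<in>{1..r}-{j}. b i (z i)) * w z x"
      using zj by simp
    finally show "(\<Sum>m\<in>{1..q}. c m * (vertex m (z j) * (\<Prod>i\<in>{1..r}-{j}. b i (z i)) * w z x)) = \<dots>" .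
  qed
  also have "\<dots> = multilin (b(j := c)) x"
    unfolding multilin_def split ..
  finally show ?thesis ..
qed

lemma multilin_vertex:
  assumes z: "z \<in> tuples q r"
  shows "multilin (\<lambda>j. vertex (z j)) x = w z x"
proof -
  have "multilin (\<lambda>j. vertex (z j)) x = (\<Sum>y\<in>tuples q r. if y = z then w z x else 0)"
    unfolding multilin_def by (intro sum.cong refl) (subst prod_vertex[OF _ z], assumption, simp)
  then show ?thesis using z by simp
qed

end

section \<open>Exchangeable laws and predictors\<close>

text \<open>The quadratic error term here is the reason why replacing a label costs the square root
  of \<open>d\<close>.\<close>

lemma ln_1_plus_ge:
  fixes y :: real
  assumes "\<bar>y\<bar> \<le> 1 / 2"
  shows "y - 2 * y\<^sup>2 \<le> ln (1 + y)"
  using abs_ln_one_plus_x_minus_x_bound[OF assms] by linarith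

text \<open>\<open>p\<close> is the joint density of labels and variables with respect to counting
  measure times \<open>P\<close>. Conditioning on an event of probability \<theta> gives the
  variables a marginal density of at most \<open>1 / \<theta>\<close>; \<open>p_act\<close> is
  exchangeability.\<close>

locale symmetric_law = sampling +
  fixes p :: "(nat \<Rightarrow> nat) \<Rightarrow> (nat set \<Rightarrow> real) \<Rightarrow> real" and \<theta> :: real
  assumes p_measurable: "a \<in> Lab \<Longrightarrow> p a \<in> borel_measurable P"
    and p_nonneg: "a \<in> Lab \<Longrightarrow> u \<in> space P \<Longrightarrow> 0 \<le> p a u"
    and \<theta>_pos: "0 < \<theta>"
    and p_sum_le: "u \<in> space P \<Longrightarrow> (\<Sum>a\<in>Lab. p a u) \<le> 1 / \<theta>"
    and p_total: "(\<integral>u. (\<Sum>a\<in>Lab. p a u) \<partial>P) = 1"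
    and p_act: "\<sigma> permutes {1..k} \<Longrightarrow> a \<in> Lab \<Longrightarrow> u \<in> space P \<Longrightarrow> p (relabel \<sigma> a) (act \<sigma> u) = p a u"
begin

section \<open>Bounded observables and their expectation under the law\<close>

definition mean :: "((nat set \<Rightarrow> real) \<Rightarrow> (nat \<Rightarrow> nat) \<Rightarrow> real) \<Rightarrow> real" where
  "mean F = (\<integral>u. (\<Sum>a\<in>Lab. p a u * F u a) \<partial>P)"

definition admissible :: "((nat set \<Rightarrow> real) \<Rightarrow> (nat \<Rightarrow> nat) \<Rightarrow> real) \<Rightarrow> bool" where
  "admissible F \<longleftrightarrow> (\<forall>a\<in>Lab. (\<lambda>u. F u a) \<in> borel_measurable P) \<and>
     (\<exists>B. \<forall>a\<in>Lab. \<forall>u\<in>space P. \<bar>F u a\<bar> \<le> B)"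

lemma admissibleI:
  "(\<And>a. a \<in> Lab \<Longrightarrow> (\<lambda>u. F u a) \<in> borel_measurable P) \<Longrightarrow>
   (\<And>a u. a \<in> Lab \<Longrightarrow> u \<in> space P \<Longrightarrow> \<bar>F u a\<bar> \<le> B) \<Longrightarrow> admissible F"
  unfolding admissible_def by blast

lemma admissible_measurable: "admissible F \<Longrightarrow> a \<in> Lab \<Longrightarrow> (\<lambda>u. F u a) \<in> borel_measurable P"
  unfolding admissible_def by blast

lemma admissible_bound:
  assumes "admissible F"
  obtains B where "B \<ge> 0" "\<And>a u. a \<in> Lab \<Longrightarrow> u \<in> space P \<Longrightarrow> \<bar>F u a\<bar> \<le> B"
proof -
  from assms obtain B where B: "\<forall>a\<in>Lab. \<forall>u\<in>space P. \<bar>F u a\<bar> \<le> B"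
    unfolding admissible_def by blast
  show thesis
  proof (rule that[of "\<bar>B\<bar>"])
    show "\<bar>F u a\<bar> \<le> \<bar>B\<bar>" if "a \<in> Lab" "u \<in> space P" for a u
      using bspec[OF bspec[OF B that(1)] that(2)] by linarith
  qed simp
qed

lemma admissible_add:
  assumes "admissible F" "admissible G"
  shows "admissible (\<lambda>u a. F u a + G u a)"
proof -
  obtain B where B: "B \<ge> 0" "\<And>a u. a \<in> Lab \<Longrightarrow> u \<in> space P \<Longrightarrow> \<bar>F u a\<bar> \<le> B"
    using assms(1) by (rule admissible_bound) (rule that)
  obtain C where C: "C \<ge> 0" "\<And>a u. a \<in> Lab \<Longrightarrow> u \<in> space P \<Longrightarrow> \<bar>G u a\<bar> \<le> C"
    using assms(2) by (rule admissible_bound) (rule that)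
  show ?thesis
  proof (rule admissibleI[where B = "B + C"])
    show "\<bar>F u a + G u a\<bar> \<le> B + C" if "a \<in> Lab" "u \<in> space P" for a u
      using B(2)[OF that] C(2)[OF that] by linarith
  qed (intro borel_measurable_add admissible_measurable[OF assms(1)] admissible_measurable[OF assms(2)])
qed

lemma admissible_mult:
  assumes "admissible F" "admissible G"
  shows "admissible (\<lambda>u a. F u a * G u a)"
proof -
  obtain B where B: "B \<ge> 0" "\<And>a u. a \<in> Lab \<Longrightarrow> u \<in> space P \<Longrightarrow> \<bar>F u a\<bar> \<le> B"
    using assms(1) by (rule admissible_bound) (rule that)
  obtain C where C: "C \<ge> 0" "\<And>a u. a \<in> Lab \<Longrightarrow> u \<in> space P \<Longrightarrow> \<bar>G u a\<bar> \<le> C"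
    using assms(2) by (rule admissible_bound) (rule that)
  show ?thesis
  proof (rule admissibleI[where B = "B * C"])
    show "\<bar>F u a * G u a\<bar> \<le> B * C" if "a \<in> Lab" "u \<in> space P" for a u
      unfolding abs_mult using B(1) B(2)[OF that] C(2)[OF that] by (intro mult_mono) auto
  qed (intro borel_measurable_times admissible_measurable[OF assms(1)] admissible_measurable[OF assms(2)])
qed

lemma admissible_const: "admissible (\<lambda>u a. c)"
  by (rule admissibleI[of _ "\<bar>c\<bar>"]) auto

lemma admissible_cmult: "admissible F \<Longrightarrow> admissible (\<lambda>u a. c * F u a)"
  by (intro admissible_mult admissible_const)

lemma admissible_sum:
  "(\<And>i. i \<in> X \<Longrightarrow> admissible (F i)) \<Longrightarrow> admissible (\<lambda>u a. \<Sum>i\<in>X. F i u a)"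
  by (induction X rule: infinite_finite_induct) (simp_all add: admissible_const admissible_add)

lemma integrable_mean:
  assumes "admissible F" "a \<in> Lab"
  shows "integrable P (\<lambda>u. p a u * F u a)"
proof -
  obtain B where B: "B \<ge> 0" "\<And>a u. a \<in> Lab \<Longrightarrow> u \<in> space P \<Longrightarrow> \<bar>F u a\<bar> \<le> B"
    using assms(1) by (rule admissible_bound) (rule that)
  have "\<bar>p a u * F u a\<bar> \<le> (1 / \<theta>) * B" if u: "u \<in> space P" for u
  proof -
    have "p a u \<le> (\<Sum>a\<in>Lab. p a u)"
      using assms(2) u p_nonneg by (intro member_le_sum) auto
    then show ?thesis
      unfolding abs_mult using p_sum_le[OF u] p_nonneg[OF assms(2) u] B(2)[OF assms(2) u] \<theta>_pos
      by (intro mult_mono) auto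
  qed
  then show ?thesis
    using assms(2)
    by (intro integrable_bounded borel_measurable_times p_measurable admissible_measurable[OF assms(1)])
qed

lemma mean_eq_sum: "admissible F \<Longrightarrow> mean F = (\<Sum>a\<in>Lab. \<integral>u. p a u * F u a \<partial>P)"
  unfolding mean_def by (intro Bochner_Integration.integral_sum integrable_mean)

lemma mean_add: "admissible F \<Longrightarrow> admissible G \<Longrightarrow> mean (\<lambda>u a. F u a + G u a) = mean F + mean G"
  by (simp add: mean_eq_sum admissible_add distrib_left integrable_mean sum.distrib)

lemma mean_cmult: "admissible F \<Longrightarrow> mean (\<lambda>u a. c * F u a) = c * mean F"
  by (simp add: mean_eq_sum admissible_cmult mult.left_commute sum_distrib_left)

lemma mean_const: "mean (\<lambda>u a. c) = c"
proof -
  have "mean (\<lambda>u a. c) = (\<integral>u. (\<Sum>a\<in>Lab. p a u) * c \<partial>P)"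
    unfolding mean_def by (simp add: sum_distrib_right)
  then show ?thesis by (simp add: p_total)
qed

lemma mean_sum:
  "(\<And>i. i \<in> X \<Longrightarrow> admissible (F i)) \<Longrightarrow> mean (\<lambda>u a. \<Sum>i\<in>X. F i u a) = (\<Sum>i\<in>X. mean (F i))"
  by (induction X rule: infinite_finite_induct) (simp_all add: mean_const mean_add admissible_sum)

lemma mean_mono:
  assumes "admissible F" "admissible G"
    and "\<And>u a. u \<in> space P \<Longrightarrow> a \<in> Lab \<Longrightarrow> F u a \<le> G u a"
  shows "mean F \<le> mean G"
  unfolding mean_eq_sum[OF assms(1)] mean_eq_sum[OF assms(2)]
  using assms p_nonneg by (intro sum_mono integral_mono integrable_mean mult_left_mono) auto

lemma mean_cong:
  assumes "\<And>u a. u \<in> space P \<Longrightarrow> a \<in> Lab \<Longrightarrow> F u a = G u a"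
  shows "mean F = mean G"
  unfolding mean_def using assms by (intro Bochner_Integration.integral_cong sum.cong) auto

lemma admissible_act:
  assumes \<sigma>: "\<sigma> permutes {1..k}" and F: "admissible F"
  shows "admissible (\<lambda>u a. F (act \<sigma> u) (relabel \<sigma> a))"
proof -
  obtain B where B: "B \<ge> 0" "\<And>a u. a \<in> Lab \<Longrightarrow> u \<in> space P \<Longrightarrow> \<bar>F u a\<bar> \<le> B"
    using F by (rule admissible_bound) (rule that)
  show ?thesis
    using \<sigma> B(2) act_space relabel_mem
    by (intro admissibleI[where B = B] measurable_compose[OF measurable_act admissible_measurable[OF F]]) auto
qed

lemma mean_act:
  assumes \<sigma>: "\<sigma> permutes {1..k}" and F: "admissible F"
  shows "mean (\<lambda>u a. F (act \<sigma> u) (relabel \<sigma> a)) = mean F"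
proof -
  have "mean (\<lambda>u a. F (act \<sigma> u) (relabel \<sigma> a))
      = (\<integral>u. (\<Sum>a\<in>Lab. p (relabel \<sigma> a) (act \<sigma> u) * F (act \<sigma> u) (relabel \<sigma> a)) \<partial>P)"
    unfolding mean_def using p_act[OF \<sigma>] by (intro Bochner_Integration.integral_cong sum.cong) auto
  also have "\<dots> = (\<integral>u. (\<Sum>a\<in>Lab. p a (act \<sigma> u) * F (act \<sigma> u) a) \<partial>P)"
    by (subst sum.reindex_bij_betw[OF bij_relabel[OF \<sigma>]]) (rule refl)
  also have "\<dots> = mean F"
    unfolding mean_def
    by (intro integral_act[OF \<sigma>] borel_measurable_sum borel_measurable_times p_measurable
        admissible_measurable[OF F])
  finally show ?thesis .
qed

text \<open>Variables and labels get separate sets because a prediction at a vertex may read the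
  variables that involve this vertex but not its label.\<close>

definition local_to :: "nat set \<Rightarrow> nat set \<Rightarrow> ((nat set \<Rightarrow> real) \<Rightarrow> (nat \<Rightarrow> nat) \<Rightarrow> real) \<Rightarrow> bool" where
  "local_to R S F \<longleftrightarrow> (\<forall>u\<in>space P. \<forall>u'\<in>space P. \<forall>a\<in>Lab. \<forall>a'\<in>Lab.
     (\<forall>T\<in>I. T \<subseteq> R \<longrightarrow> u T = u' T) \<longrightarrow> (\<forall>n\<in>S. a n = a' n) \<longrightarrow> F u a = F u' a')"

lemma local_toI:
  assumes "\<And>u u' a a'. u \<in> space P \<Longrightarrow> u' \<in> space P \<Longrightarrow> a \<in> Lab \<Longrightarrow> a' \<in> Lab \<Longrightarrow>
     (\<And>T. T \<in> I \<Longrightarrow> T \<subseteq> R \<Longrightarrow> u T = u' T) \<Longrightarrow> (\<And>n. n \<in> S \<Longrightarrow> a n = a' n) \<Longrightarrow> F u a = F u' a'"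
  shows "local_to R S F"
  unfolding local_to_def by (intro ballI impI assms) simp_all

lemma local_toD:
  assumes F: "local_to R S F"
    and mem: "u \<in> space P" "u' \<in> space P" "a \<in> Lab" "a' \<in> Lab"
    and eq: "\<And>T. T \<in> I \<Longrightarrow> T \<subseteq> R \<Longrightarrow> u T = u' T" "\<And>n. n \<in> S \<Longrightarrow> a n = a' n"
  shows "F u a = F u' a'"
proof -
  have "\<forall>T\<in>I. T \<subseteq> R \<longrightarrow> u T = u' T" "\<forall>n\<in>S. a n = a' n"
    using eq by simp_all
  then show ?thesis
    using bspec[OF bspec[OF bspec[OF bspec[OF F[unfolded local_to_def] mem(1)] mem(2)] mem(3)] mem(4)]
    by (elim impE)
qed

lemma local_to_mono:
  assumes "local_to R S F" "R \<subseteq> R'" "S \<subseteq> S'"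
  shows "local_to R' S' F"
proof (rule local_toI)
  fix u u' a a' assume *: "u \<in> space P" "u' \<in> space P" "a \<in> Lab" "a' \<in> Lab"
    "\<And>T. T \<in> I \<Longrightarrow> T \<subseteq> R' \<Longrightarrow> u T = u' T" "\<And>n. n \<in> S' \<Longrightarrow> a n = a' n"
  show "F u a = F u' a'"
    using assms(2,3) by (intro local_toD[OF assms(1) *(1-4)] *(5,6)) auto
qed

lemma local_to_act:
  assumes F: "local_to R S F" and \<sigma>: "\<sigma> permutes {1..k}" and R: "R \<subseteq> {1..k}" and S: "S \<subseteq> {1..k}"
  shows "local_to (\<sigma> ` R) (\<sigma> ` S) (\<lambda>u a. F (act \<sigma> u) (relabel \<sigma> a))"
proof (rule local_toI)
  fix u u' a a' assume *: "u \<in> space P" "u' \<in> space P" "a \<in> Lab" "a' \<in> Lab"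
    "\<And>T. T \<in> I \<Longrightarrow> T \<subseteq> \<sigma> ` R \<Longrightarrow> u T = u' T" "\<And>n. n \<in> \<sigma> ` S \<Longrightarrow> a n = a' n"
  show "F (act \<sigma> u) (relabel \<sigma> a) = F (act \<sigma> u') (relabel \<sigma> a')"
  proof (rule local_toD[OF F])
    show "act \<sigma> u T = act \<sigma> u' T" if "T \<in> I" "T \<subseteq> R" for T
      using *(5)[of "\<sigma> ` T"] image_I[OF \<sigma> that(1)] that by (auto simp: act_def)
    show "relabel \<sigma> a n = relabel \<sigma> a' n" if "n \<in> S" for n
      using *(6)[of "\<sigma> n"] that S by (auto simp: relabel_def)
  qed (use * act_space[OF \<sigma>] relabel_mem[OF \<sigma>] in auto)
qed

section \<open>Predictors and their logarithmic loss\<close>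

text \<open>The lower bound \<open>\<kappa>\<close> keeps the logarithmic loss below bounded.\<close>

definition predictor :: "nat \<Rightarrow> nat set \<Rightarrow> (nat \<Rightarrow> (nat set \<Rightarrow> real) \<Rightarrow> (nat \<Rightarrow> nat) \<Rightarrow> real) \<Rightarrow> bool" where
  "predictor v S g \<longleftrightarrow>
     (\<forall>m\<in>{1..q}. (\<forall>a\<in>Lab. (\<lambda>u. g m u a) \<in> borel_measurable P) \<and> local_to (insert v S) S (g m)) \<and>
     (\<exists>\<kappa>>0. \<forall>m\<in>{1..q}. \<forall>u\<in>space P. \<forall>a\<in>Lab. \<kappa> \<le> g m u a) \<and>
     (\<forall>u\<in>space P. \<forall>a\<in>Lab. (\<Sum>m\<in>{1..q}. g m u a) = 1)"

text \<open>A cross-entropy. Its infimum over the predictors from \<open>S\<close> is the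
  conditional entropy of the label of \<open>v\<close> given the labels on \<open>S\<close> and the
  variables inside \<open>insert v S\<close>; working with near-minimisers avoids constructing
  conditional probabilities.\<close>

definition loss :: "nat \<Rightarrow> (nat \<Rightarrow> (nat set \<Rightarrow> real) \<Rightarrow> (nat \<Rightarrow> nat) \<Rightarrow> real) \<Rightarrow> real" where
  "loss v g = mean (\<lambda>u a. - ln (g (a v) u a))"

text \<open>In use \<open>g\<close> predicts from a smaller set than \<open>S'\<close>; the
  condition then says that the additional information in \<open>S'\<close> is worth at most
  \<open>d\<close>.\<close>

definition nearly_optimal ::
  "nat \<Rightarrow> nat set \<Rightarrow> real \<Rightarrow> (nat \<Rightarrow> (nat set \<Rightarrow> real) \<Rightarrow> (nat \<Rightarrow> nat) \<Rightarrow> real) \<Rightarrow> bool" where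
  "nearly_optimal v S d g \<longleftrightarrow> (\<forall>h. predictor v S h \<longrightarrow> loss v g \<le> loss v h + d)"

lemma predictorD:
  assumes "predictor v S g"
  shows "m \<in> {1..q} \<Longrightarrow> a \<in> Lab \<Longrightarrow> (\<lambda>u. g m u a) \<in> borel_measurable P"
    and "m \<in> {1..q} \<Longrightarrow> local_to (insert v S) S (g m)"
    and "u \<in> space P \<Longrightarrow> a \<in> Lab \<Longrightarrow> (\<Sum>m\<in>{1..q}. g m u a) = 1"
  using assms unfolding predictor_def by blast+

lemma predictor_pos:
  assumes "predictor v S g"
  obtains \<kappa> where "\<kappa> > 0" "\<And>m u a. m \<in> {1..q} \<Longrightarrow> u \<in> space P \<Longrightarrow> a \<in> Lab \<Longrightarrow> \<kappa> \<le> g m u a"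
  using assms unfolding predictor_def by blast

lemma predictor_prob_vec:
  assumes g: "predictor v S g" and "u \<in> space P" "a \<in> Lab"
  shows "prob_vec q (\<lambda>m. g m u a)"
proof -
  obtain \<kappa> where \<kappa>: "\<kappa> > 0" "\<And>m u a. m \<in> {1..q} \<Longrightarrow> u \<in> space P \<Longrightarrow> a \<in> Lab \<Longrightarrow> \<kappa> \<le> g m u a"
    using g by (rule predictor_pos) (rule that)
  have "0 \<le> g m u a" if "m \<in> {1..q}" for m
    using \<kappa>(1) \<kappa>(2)[OF that assms(2,3)] by linarith
  then show ?thesis
    using predictorD(3)[OF assms] by (simp add: prob_vec_def)
qed

lemma predictor_gt_0:
  assumes g: "predictor v S g" and "m \<in> {1..q}" "u \<in> space P" "a \<in> Lab"
  shows "0 < g m u a"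
proof -
  obtain \<kappa> where \<kappa>: "\<kappa> > 0" "\<And>m u a. m \<in> {1..q} \<Longrightarrow> u \<in> space P \<Longrightarrow> a \<in> Lab \<Longrightarrow> \<kappa> \<le> g m u a"
    using g by (rule predictor_pos) (rule that)
  show ?thesis by (rule less_le_trans[OF \<kappa>(1) \<kappa>(2)[OF assms(2-4)]])
qed

lemma predictor_le_1:
  assumes g: "predictor v S g" and "m \<in> {1..q}" "u \<in> space P" "a \<in> Lab"
  shows "g m u a \<le> 1"
  using prob_vec_le_1[OF predictor_prob_vec[OF g assms(3,4)] assms(2)] .

lemma predictor_admissible:
  assumes g: "predictor v S g" and "m \<in> {1..q}"
  shows "admissible (g m)"
proof (rule admissibleI[where B = 1])
  show "\<bar>g m u a\<bar> \<le> 1" if "a \<in> Lab" "u \<in> space P" for a u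
    using predictor_gt_0[OF assms that(2,1)] predictor_le_1[OF assms that(2,1)] by simp
qed (rule predictorD(1)[OF g assms(2)])

lemma admissible_loss:
  assumes g: "predictor v S g" and v: "v \<in> {1..k}"
  shows "admissible (\<lambda>u a. - ln (g (a v) u a))"
proof -
  obtain \<kappa> where \<kappa>: "\<kappa> > 0" "\<And>m u a. m \<in> {1..q} \<Longrightarrow> u \<in> space P \<Longrightarrow> a \<in> Lab \<Longrightarrow> \<kappa> \<le> g m u a"
    using g by (rule predictor_pos) (rule that)
  show ?thesis
  proof (rule admissibleI)
    fix a assume a: "a \<in> Lab"
    then have av: "a v \<in> {1..q}" using v by (rule tuples_mem)
    show "(\<lambda>u. - ln (g (a v) u a)) \<in> borel_measurable P"
      using predictorD(1)[OF g av a] by measurable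
    fix u assume u: "u \<in> space P"
    from \<kappa>(2)[OF av u a] predictor_le_1[OF g av u a] show "\<bar>- ln (g (a v) u a)\<bar> \<le> - ln \<kappa>"
      using \<kappa>(1) by (simp add: ln_le_zero_iff)
  qed
qed

lemma loss_nonneg:
  assumes g: "predictor v S g" and v: "v \<in> {1..k}"
  shows "0 \<le> loss v g"
proof -
  have "mean (\<lambda>u a. 0) \<le> mean (\<lambda>u a. - ln (g (a v) u a))"
  proof (rule mean_mono[OF admissible_const admissible_loss[OF g v]])
    fix u a assume u: "u \<in> space P" and a: "a \<in> Lab"
    have av: "a v \<in> {1..q}" using a v by (rule tuples_mem)
    show "0 \<le> - ln (g (a v) u a)"
      using predictor_gt_0[OF g av u a] predictor_le_1[OF g av u a] by simp
  qed
  then show ?thesis by (simp add: mean_const loss_def)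
qed

lemma predictor_uniform: "predictor v S (\<lambda>m u a. 1 / real q)"
  using q_pos unfolding predictor_def local_to_def by (auto intro!: exI[of _ "1 / real q"])

lemma loss_uniform: "loss v (\<lambda>m u a. 1 / real q) = ln (real q)"
  using q_pos by (simp add: loss_def mean_const ln_div)

lemma predictor_act:
  assumes g: "predictor v S g" and \<sigma>: "\<sigma> permutes {1..k}" and v: "v \<in> {1..k}" and S: "S \<subseteq> {1..k}"
  shows "predictor (\<sigma> v) (\<sigma> ` S) (\<lambda>m u a. g m (act \<sigma> u) (relabel \<sigma> a))"
proof -
  obtain \<kappa> where \<kappa>: "\<kappa> > 0" "\<And>m u a. m \<in> {1..q} \<Longrightarrow> u \<in> space P \<Longrightarrow> a \<in> Lab \<Longrightarrow> \<kappa> \<le> g m u a"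
    using g by (rule predictor_pos) (rule that)
  show ?thesis
    unfolding predictor_def
  proof (intro conjI ballI exI[of _ \<kappa>])
    fix m assume m: "m \<in> {1..q}"
    show "(\<lambda>u. g m (act \<sigma> u) (relabel \<sigma> a)) \<in> borel_measurable P" if "a \<in> Lab" for a
      by (rule measurable_compose[OF measurable_act[OF \<sigma>] predictorD(1)[OF g m relabel_mem[OF \<sigma> that]]])
    show "local_to (insert (\<sigma> v) (\<sigma> ` S)) (\<sigma> ` S) (\<lambda>u a. g m (act \<sigma> u) (relabel \<sigma> a))"
      using local_to_act[OF predictorD(2)[OF g m] \<sigma>] v S by simp
    show "\<kappa> \<le> g m (act \<sigma> u) (relabel \<sigma> a)" if "u \<in> space P" "a \<in> Lab" for u a
      using that by (intro \<kappa>(2) m act_space relabel_mem \<sigma>)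
  next
    show "(\<Sum>m\<in>{1..q}. g m (act \<sigma> u) (relabel \<sigma> a)) = 1" if "u \<in> space P" "a \<in> Lab" for u a
      using that by (intro predictorD(3)[OF g] act_space relabel_mem \<sigma>)
  qed (rule \<kappa>(1))
qed

lemma loss_act:
  assumes g: "predictor v S g" and \<sigma>: "\<sigma> permutes {1..k}" and v: "v \<in> {1..k}"
  shows "loss (\<sigma> v) (\<lambda>m u a. g m (act \<sigma> u) (relabel \<sigma> a)) = loss v g"
proof -
  have "loss (\<sigma> v) (\<lambda>m u a. g m (act \<sigma> u) (relabel \<sigma> a))
      = mean (\<lambda>u a. - ln (g ((relabel \<sigma> a) v) (act \<sigma> u) (relabel \<sigma> a)))"
    unfolding loss_def using v by (simp add: relabel_def)
  also have "\<dots> = loss v g"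
    unfolding loss_def by (rule mean_act[OF \<sigma> admissible_loss[OF g v]])
  finally show ?thesis .
qed

text \<open>A competitor for the moved configuration is pulled back along the inverse permutation,
  and by exchangeability its loss does not change.\<close>

lemma nearly_optimal_act:
  assumes g: "predictor v S g" and opt: "nearly_optimal v S' d g"
    and \<sigma>: "\<sigma> permutes {1..k}" and v: "v \<in> {1..k}" and S': "S' \<subseteq> {1..k}"
  shows "nearly_optimal (\<sigma> v) (\<sigma> ` S') d (\<lambda>m u a. g m (act \<sigma> u) (relabel \<sigma> a))"
  unfolding nearly_optimal_def
proof (intro allI impI)
  fix h assume h: "predictor (\<sigma> v) (\<sigma> ` S') h"
  let ?h = "\<lambda>m u a. h m (act (inv \<sigma>) u) (relabel (inv \<sigma>) a)"
  have \<sigma>v: "\<sigma> v \<in> {1..k}" "\<sigma> ` S' \<subseteq> {1..k}"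
    using \<sigma> v S' permutes_in_image[OF \<sigma>] by auto
  have inv: "inv \<sigma> (\<sigma> v) = v" "inv \<sigma> ` \<sigma> ` S' = S'"
    using \<sigma> by (simp_all add: permutes_inverses image_comp permutes_inv_o)
  have "predictor v S' ?h"
    using predictor_act[OF h permutes_inv[OF \<sigma>] \<sigma>v] by (simp add: inv)
  then have "loss v g \<le> loss v ?h + d"
    using opt by (simp add: nearly_optimal_def)
  also have "loss v ?h = loss (\<sigma> v) h"
    using loss_act[OF h permutes_inv[OF \<sigma>] \<sigma>v(1)] by (simp add: inv)
  finally show "loss (\<sigma> v) (\<lambda>m u a. g m (act \<sigma> u) (relabel \<sigma> a)) \<le> loss (\<sigma> v) h + d"
    using loss_act[OF g \<sigma> v] by simp
qed

text \<open>Multiplying a predictor by \<open>1 + t\<psi>\<close> and renormalising gives a competitor whose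
  loss is smaller by about \<open>t\<close> times the error made by replacing the label \<open>a v\<close> by its prediction.\<close>

lemma replace_label:
  assumes g: "predictor v S g" and SS': "S \<subseteq> S'" and v: "v \<in> {1..k}"
    and opt: "nearly_optimal v S' d g" and d: "0 < d" "d \<le> 1 / 4"
    and \<psi>m: "\<And>m a. m \<in> {1..q} \<Longrightarrow> a \<in> Lab \<Longrightarrow> (\<lambda>u. \<psi> m u a) \<in> borel_measurable P"
    and \<psi>1: "\<And>m u a. m \<in> {1..q} \<Longrightarrow> u \<in> space P \<Longrightarrow> a \<in> Lab \<Longrightarrow> \<bar>\<psi> m u a\<bar> \<le> 1"
    and \<psi>l: "\<And>m. m \<in> {1..q} \<Longrightarrow> local_to (insert v S') S' (\<psi> m)"
  shows "mean (\<lambda>u a. \<psi> (a v) u a) \<le> mean (\<lambda>u a. \<Sum>m\<in>{1..q}. g m u a * \<psi> m u a) + 3 * sqrt d"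
proof -
  \<comment> \<open>The replacement error appears with the factor \<open>t\<close>, against a loss
    of \<open>2 * t\<^sup>2\<close> from the logarithm and \<open>d\<close> from near-optimality.
    Taking \<open>t = sqrt d\<close> balances these and yields the constant 3. The bound
    \<open>d \<le> 1 / 4\<close> keeps \<open>1 + t * \<psi>\<close> above 1/2 and the normaliser
    between 1/2 and 3/2.\<close>
  define t where "t = sqrt d"
  have t: "0 < t" "t \<le> 1 / 2" "t * t = d"
    using d real_sqrt_le_mono[of d "1/4"] by (auto simp: t_def real_sqrt_divide)
  define G where "G = (\<lambda>u a. \<Sum>m\<in>{1..q}. g m u a * \<psi> m u a)"
  define h where "h = (\<lambda>m u a. g m u a * (1 + t * \<psi> m u a) / (1 + t * G u a))"
  obtain \<kappa> where \<kappa>: "\<kappa> > 0" "\<And>m u a. m \<in> {1..q} \<Longrightarrow> u \<in> space P \<Longrightarrow> a \<in> Lab \<Longrightarrow> \<kappa> \<le> g m u a"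
    using g by (rule predictor_pos) (rule that)
  have \<psi>adm: "admissible (\<psi> m)" if "m \<in> {1..q}" for m
    using \<psi>m[OF that] \<psi>1[OF that] by (intro admissibleI[where B = 1])
  have Gadm: "admissible G"
    unfolding G_def by (intro admissible_sum admissible_mult \<psi>adm predictor_admissible[OF g])
  have half: "\<bar>t * x\<bar> \<le> 1 / 2" if "\<bar>x\<bar> \<le> 1" for x
    using mult_mono[of t "1/2" "\<bar>x\<bar>" 1] t that by (simp add: abs_mult)
  have G1: "\<bar>G u a\<bar> \<le> 1" if u: "u \<in> space P" and a: "a \<in> Lab" for u a
  proof -
    have pv: "prob_vec q (\<lambda>m. g m u a)" by (rule predictor_prob_vec[OF g u a])
    have "\<bar>G u a\<bar> \<le> (\<Sum>m\<in>{1..q}. \<bar>g m u a * \<psi> m u a\<bar>)"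
      unfolding G_def by (rule sum_abs)
    also have "\<dots> \<le> (\<Sum>m\<in>{1..q}. g m u a)"
      using pv \<psi>1[OF _ u a] by (intro sum_mono) (auto simp: prob_vec_def abs_mult intro!: mult_left_le)
    finally show ?thesis using pv by (simp add: prob_vec_def)
  qed
  have Z: "1 / 2 \<le> 1 + t * G u a" "1 + t * G u a \<le> 3 / 2" if "u \<in> space P" "a \<in> Lab" for u a
    using half[OF G1[OF that]] by (auto simp: abs_le_iff)
  have Y: "1 / 2 \<le> 1 + t * \<psi> m u a" if "m \<in> {1..q}" "u \<in> space P" "a \<in> Lab" for m u a
    using half[OF \<psi>1[OF that]] by (auto simp: abs_le_iff)
  have h: "predictor v S' h"
    unfolding predictor_def
  proof (intro conjI ballI exI[of _ "\<kappa> / 3"])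
    fix m assume m: "m \<in> {1..q}"
    show "(\<lambda>u. h m u a) \<in> borel_measurable P" if a: "a \<in> Lab" for a
      unfolding h_def using predictorD(1)[OF g m a] \<psi>m[OF m a] admissible_measurable[OF Gadm a]
      by measurable
    have gl: "local_to (insert v S') S' (g i)" if "i \<in> {1..q}" for i
      using SS' by (intro local_to_mono[OF predictorD(2)[OF g that]]) auto
    show "local_to (insert v S') S' (h m)"
    proof (rule local_toI)
      fix u u' a a' assume *: "u \<in> space P" "u' \<in> space P" "a \<in> Lab" "a' \<in> Lab"
        "\<And>T. T \<in> I \<Longrightarrow> T \<subseteq> insert v S' \<Longrightarrow> u T = u' T" "\<And>n. n \<in> S' \<Longrightarrow> a n = a' n"
      have "g i u a = g i u' a'" "\<psi> i u a = \<psi> i u' a'" if "i \<in> {1..q}" for i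
        using local_toD[OF gl[OF that] *] local_toD[OF \<psi>l[OF that] *] by auto
      then show "h m u a = h m u' a'"
        using m unfolding h_def G_def by simp
    qed
    fix u a assume ua: "u \<in> space P" "a \<in> Lab"
    have "\<kappa> / 3 = \<kappa> * (1 / 2) / (3 / 2)" by simp
    also have "\<dots> \<le> g m u a * (1 + t * \<psi> m u a) / (1 + t * G u a)"
      using \<kappa> Y[OF m ua] Z[OF ua] m ua
      by (intro frac_le mult_mono mult_nonneg_nonneg) (auto intro: order.trans[OF less_imp_le])
    finally show "\<kappa> / 3 \<le> h m u a" by (simp add: h_def)
  next
    fix u a assume ua: "u \<in> space P" "a \<in> Lab"
    have "(\<Sum>m\<in>{1..q}. h m u a) = (\<Sum>m\<in>{1..q}. g m u a + t * (g m u a * \<psi> m u a)) / (1 + t * G u a)"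
      unfolding h_def sum_divide_distrib by (simp add: algebra_simps)
    also have "\<dots> = ((\<Sum>m\<in>{1..q}. g m u a) + t * G u a) / (1 + t * G u a)"
      by (simp add: sum.distrib sum_distrib_left G_def)
    also have "\<dots> = 1"
      using predictorD(3)[OF g ua] Z(1)[OF ua] by simp
    finally show "(\<Sum>m\<in>{1..q}. h m u a) = 1" .
  qed (use \<kappa>(1) in simp)
  have \<psi>v: "admissible (\<lambda>u a. \<psi> (a v) u a)"
    using v by (intro admissibleI[where B = 1] \<psi>m \<psi>1) (auto dest: tuples_mem)
  \<comment> \<open>Pointwise, passing from \<open>g\<close> to \<open>h\<close> subtracts
    \<open>ln (1 + t * \<psi>)\<close> from the loss and adds \<open>ln (1 + t * G)\<close>. The
    former is bounded below to second order, the latter above to first order.\<close>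
  have "mean (\<lambda>u a. (- ln (h (a v) u a) + t * \<psi> (a v) u a) + (- 2 * t\<^sup>2))
      \<le> mean (\<lambda>u a. - ln (g (a v) u a) + t * G u a)"
  proof (rule mean_mono)
    fix u a assume ua: "u \<in> space P" "a \<in> Lab"
    have av: "a v \<in> {1..q}" using ua(2) v by (rule tuples_mem)
    from predictor_gt_0[OF g av ua] have "ln (h (a v) u a) = ln (g (a v) u a) + ln (1 + t * \<psi> (a v) u a) - ln (1 + t * G u a)"
      unfolding h_def using Y[OF av ua] Z(1)[OF ua] by (simp add: ln_div ln_mult)
    moreover have "ln (1 + t * G u a) \<le> t * G u a"
      using Z(1)[OF ua] ln_le_minus_one[of "1 + t * G u a"] by simp
    moreover have "t * \<psi> (a v) u a - 2 * (t * \<psi> (a v) u a)\<^sup>2 \<le> ln (1 + t * \<psi> (a v) u a)"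
      by (rule ln_1_plus_ge[OF half[OF \<psi>1[OF av ua]]])
    moreover have "(t * \<psi> (a v) u a)\<^sup>2 \<le> t\<^sup>2"
      using \<psi>1[OF av ua] by (simp add: power_mult_distrib mult_left_le abs_square_le_1)
    ultimately show "(- ln (h (a v) u a) + t * \<psi> (a v) u a) + (- 2 * t\<^sup>2) \<le> - ln (g (a v) u a) + t * G u a"
      by linarith
  qed (intro admissible_add admissible_const admissible_cmult admissible_loss[OF g v] admissible_loss[OF h v] \<psi>v Gadm)+
  then have "loss v h + t * mean (\<lambda>u a. \<psi> (a v) u a) + (- 2 * t\<^sup>2) \<le> loss v g + t * mean G"
    unfolding loss_def
    by (simp only: mean_add mean_cmult mean_const admissible_add admissible_const admissible_cmult
        admissible_loss[OF g v] admissible_loss[OF h v] \<psi>v Gadm)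
  moreover have "loss v g \<le> loss v h + d" using opt h by (simp add: nearly_optimal_def)
  ultimately have "t * mean (\<lambda>u a. \<psi> (a v) u a) \<le> t * (mean G + 3 * t)"
    using t(3) by (simp add: algebra_simps power2_eq_square)
  then show ?thesis using t(1) by (simp add: G_def t_def)
qed

text \<open>If each of \<open>L\<close> enlargements by \<open>r - 1\<close> vertices could lower
  the loss by more than \<open>d\<close>, the loss would drop from \<open>ln q\<close> below
  \<open>ln q - L * d\<close>, hence below 0. The vertex and the set may change completely from step
  to step, only the cardinality is prescribed; so the descent needs no symmetry, and the result
  applies to every position of the larger set.\<close>

lemma exists_nearly_optimal:
  assumes L: "1 \<le> L" "L * (r - 1) + 1 \<le> k" and d: "ln (real q) \<le> d * real L"
  shows "\<exists>v S g i. i < L \<and> v \<in> {1..k} \<and> S \<subseteq> {1..k} - {v} \<and> card S = i * (r - 1) \<and> predictor v S g \<and>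
           (\<forall>v' S'. v' \<in> {1..k} \<longrightarrow> S' \<subseteq> {1..k} - {v'} \<longrightarrow> card S' = Suc i * (r - 1) \<longrightarrow>
              (\<forall>h. predictor v' S' h \<longrightarrow> loss v g \<le> loss v' h + d))"
proof (rule ccontr)
  assume neg: "\<not> ?thesis"
  \<comment> \<open>Strictness is recorded from the first step on, since \<open>L * d\<close> may
    equal \<open>ln q\<close> and the final contradiction is with a nonnegative loss.\<close>
  have "\<exists>v S g. v \<in> {1..k} \<and> S \<subseteq> {1..k} - {v} \<and> card S = i * (r - 1) \<and> predictor v S g \<and>
          loss v g \<le> ln (real q) - real i * d \<and> (0 < i \<longrightarrow> loss v g < ln (real q) - real i * d)"
    if "i \<le> L" for i
    using that
  proof (induction i)
    case 0
    then show ?case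
      using r_pos r_le_k predictor_uniform[of 1 "{}"]
      by (intro exI[of _ 1] exI[of _ "{}"] exI[of _ "\<lambda>m u a. 1 / real q"]) (auto simp: loss_uniform)
  next
    case (Suc i)
    then obtain v S g where g: "v \<in> {1..k}" "S \<subseteq> {1..k} - {v}" "card S = i * (r - 1)" "predictor v S g"
      "loss v g \<le> ln (real q) - real i * d"
      by auto
    with neg Suc.prems obtain v' S' h where h: "v' \<in> {1..k}" "S' \<subseteq> {1..k} - {v'}"
      "card S' = Suc i * (r - 1)" "predictor v' S' h" "\<not> loss v g \<le> loss v' h + d"
      by (metis Suc_le_lessD)
    show ?case
      using h g(5) by (intro exI[of _ v'] exI[of _ S'] exI[of _ h]) (auto simp: algebra_simps)
  qed
  from this[of L] L obtain v S g where "v \<in> {1..k}" "predictor v S g" "loss v g < ln (real q) - real L * d"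
    by auto
  with loss_nonneg[of v S g] d show False by (simp add: mult.commute)
qed

end

section \<open>From all vertices to the first block\<close>

text \<open>Exchanges the first block of \<open>r\<close> vertices with block number
  \<open>i\<close>, counted from 0; for \<open>i = 0\<close> both branches move nothing.\<close>

definition swap_block :: "nat \<Rightarrow> nat \<Rightarrow> nat \<Rightarrow> nat" where
  "swap_block r i n = (if n \<in> {1..r} then n + i * r else if n \<in> {i*r+1..i*r+r} then n - i * r else n)"

lemma swap_block_swap_block [simp]: "swap_block r i (swap_block r i n) = n"
proof (cases "i = 0")
  case True
  then show ?thesis by (auto simp: swap_block_def)
next
  case False
  define s where "s t n = (if n \<in> {1..r} then n + t else if n \<in> {t+1..t+r} then n - t else n)" for t n
  have "s t (s t n) = n" if "r \<le> t" for t
    using that by (auto simp: s_def)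
  moreover have "r \<le> i * r" using False by simp
  ultimately have "s (i * r) (s (i * r) n) = n" by blast
  then show ?thesis by (simp only: swap_block_def s_def)
qed

lemma involution_permutes:
  assumes "\<And>x. \<sigma> (\<sigma> x) = x" "\<And>x. x \<notin> X \<Longrightarrow> \<sigma> x = x"
  shows "\<sigma> permutes X"
  unfolding permutes_def using assms by metis

lemma swap_block_permutes:
  assumes "i < M" "r * M \<le> k"
  shows "swap_block r i permutes {1..k}"
proof (rule involution_permutes)
  have "Suc i * r \<le> M * r" using assms(1) by (intro mult_le_mono1) simp
  with assms(2) have "i * r + r \<le> k" by (simp add: mult.commute)
  then show "swap_block r i n = n" if "n \<notin> {1..k}" for n
    using that by (auto simp: swap_block_def)
qed simp

text \<open>Exchangeability speaks of permutations of all vertices, whereas in use only the images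
  of a few vertices are prescribed.\<close>

lemma extend_to_permutation:
  assumes X: "finite X" "A \<subseteq> X" "f ` A \<subseteq> X" "inj_on f A"
  obtains \<sigma> where "\<sigma> permutes X" "\<And>x. x \<in> A \<Longrightarrow> \<sigma> x = f x"
proof -
  have "card (X - A) = card (X - f ` A)"
    using X by (simp add: card_Diff_subset finite_subset card_image)
  then obtain h where h: "bij_betw h (X - A) (X - f ` A)"
    using X(1) finite_same_card_bij[of "X - A" "X - f ` A"] by auto
  let ?\<sigma> = "\<lambda>x. if x \<in> A then f x else if x \<in> X then h x else x"
  have "bij_betw ?\<sigma> A (f ` A)"
    using X(4) by (subst bij_betw_cong[where g = f]) (auto simp: bij_betw_def)
  moreover have "bij_betw ?\<sigma> (X - A) (X - f ` A)"
    using h by (subst bij_betw_cong[where g = h]) auto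
  ultimately have "bij_betw ?\<sigma> (A \<union> (X - A)) (f ` A \<union> (X - f ` A))"
    by (rule bij_betw_combine) auto
  then have "bij_betw ?\<sigma> X X"
    using X by (simp add: Un_absorb1)
  then have "?\<sigma> permutes X"
    using X by (intro bij_imp_permutes) auto
  then show thesis by (rule that) auto
qed

text \<open>Such a tuple agrees at some pair of different positions, and forgetting one of the two
  loses no information.\<close>

lemma card_noninjective_tuples:
  "card {n \<in> tuples k r. \<not> inj_on n {1..r}} \<le> r * r * k ^ (r - 1)"
proof -
  have sub: "{n \<in> tuples k r. \<not> inj_on n {1..r}} \<subseteq>
      (\<Union>(i, j) \<in> {1..r} \<times> {1..r}. {n \<in> tuples k r. i \<noteq> j \<and> n i = n j})"
    by (auto simp: inj_on_def)
  have c: "card {n \<in> tuples k r. i \<noteq> j \<and> n i = n j} \<le> k ^ (r - 1)"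
    if ij: "i \<in> {1..r}" "j \<in> {1..r}" for i j
  proof (cases "i = j")
    case False
    have "card {n \<in> tuples k r. i \<noteq> j \<and> n i = n j} \<le> card (({1..r} - {i}) \<rightarrow>\<^sub>E {1..k})"
    proof (rule card_inj_on_le[where f = "\<lambda>n. restrict n ({1..r} - {i})"])
      show "inj_on (\<lambda>n. restrict n ({1..r} - {i})) {n \<in> tuples k r. i \<noteq> j \<and> n i = n j}"
      proof (rule inj_onI)
        fix n n' assume n: "n \<in> {n \<in> tuples k r. i \<noteq> j \<and> n i = n j}"
          and n': "n' \<in> {n \<in> tuples k r. i \<noteq> j \<and> n i = n j}"
          and eq: "restrict n ({1..r} - {i}) = restrict n' ({1..r} - {i})"
        have e: "n x = n' x" if "x \<in> {1..r}" "x \<noteq> i" for x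
          using fun_cong[OF eq, of x] that by simp
        have "n x = n' x" if "x \<in> {1..r}" for x
        proof (cases "x = i")
          case True
          with e[of j] n n' ij False show ?thesis by simp
        qed (use e that in blast)
        then show "n = n'"
          using n n' unfolding tuples_def by (intro PiE_ext[of n "{1..r}" _ n']) auto
      qed
      show "(\<lambda>n. restrict n ({1..r} - {i})) ` {n \<in> tuples k r. i \<noteq> j \<and> n i = n j}
          \<subseteq> ({1..r} - {i}) \<rightarrow>\<^sub>E {1..k}"
      proof (rule image_subsetI)
        fix n assume "n \<in> {n \<in> tuples k r. i \<noteq> j \<and> n i = n j}"
        then show "restrict n ({1..r} - {i}) \<in> ({1..r} - {i}) \<rightarrow>\<^sub>E {1..k}"
          unfolding restrict_PiE_iff by (auto dest: tuples_mem)
      qed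
    qed (simp add: finite_PiE)
    also have "\<dots> = k ^ (r - 1)" using ij by (simp add: card_PiE)
    finally show ?thesis .
  qed simp
  have "card {n \<in> tuples k r. \<not> inj_on n {1..r}}
      \<le> card (\<Union>(i, j) \<in> {1..r} \<times> {1..r}. {n \<in> tuples k r. i \<noteq> j \<and> n i = n j})"
    using sub by (rule card_mono[rotated]) (auto simp: case_prod_beta)
  also have "\<dots> \<le> (\<Sum>(i, j) \<in> {1..r} \<times> {1..r}. card {n \<in> tuples k r. i \<noteq> j \<and> n i = n j})"
    unfolding case_prod_beta by (rule card_UN_le) simp
  also have "\<dots> \<le> (\<Sum>(i, j) \<in> {1..r} \<times> {1..r}. k ^ (r - 1))"
    by (rule sum_mono) (use c in auto)
  also have "\<dots> = r * r * k ^ (r - 1)" by (simp add: case_prod_beta)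
  finally show ?thesis .
qed

section \<open>The contribution of the first block\<close>

context symmetric_law
begin

definition first_block :: "(nat set \<Rightarrow> real) \<Rightarrow> (nat \<Rightarrow> nat) \<Rightarrow> real" where
  "first_block u a = multilin (\<lambda>j. vertex (a j)) (low u)"

lemma first_block_eq: "a \<in> Lab \<Longrightarrow> first_block u a = w (restrict a {1..r}) (low u)"
proof -
  assume a: "a \<in> Lab"
  have t: "restrict a {1..r} \<in> tuples q r"
    using a r_le_k by (auto simp: tuples_def)
  show ?thesis
    unfolding first_block_def multilin_vertex[OF t, symmetric] by (rule multilin_cong) simp
qed

lemma restrict_Lab: "a \<in> Lab \<Longrightarrow> restrict a {1..r} \<in> tuples q r"
  using r_le_k by (auto simp: tuples_def)

lemma first_block_le: "a \<in> Lab \<Longrightarrow> u \<in> space P \<Longrightarrow> \<bar>first_block u a\<bar> \<le> 1"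
  unfolding first_block_eq by (rule w_le[OF restrict_Lab low_space])

lemma admissible_first_block: "admissible first_block"
proof (rule admissibleI[where B = 1])
  fix a assume a: "a \<in> Lab"
  show "(\<lambda>u. first_block u a) \<in> borel_measurable P"
    unfolding first_block_eq[OF a]
    by (rule measurable_compose[OF measurable_low w_measurable[OF restrict_Lab[OF a]]])
qed (rule first_block_le)

lemma admissible_tuple:
  assumes n: "n \<in> tuples k r"
  shows "admissible (\<lambda>u a. w (\<lambda>j\<in>{1..r}. a (n j)) (\<lambda>A\<in>D. u (n ` A)))"
proof (rule admissibleI[where B = 1])
  fix a assume a: "a \<in> Lab"
  show "(\<lambda>u. w (\<lambda>j\<in>{1..r}. a (n j)) (\<lambda>A\<in>D. u (n ` A))) \<in> borel_measurable P"
    by (rule measurable_compose[OF measurable_tuple[OF n] w_measurable[OF relabel_tuple[OF a n]]])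
  show "\<bar>w (\<lambda>j\<in>{1..r}. a (n j)) (\<lambda>A\<in>D. u (n ` A))\<bar> \<le> 1" if "u \<in> space P" for u
    by (rule w_le[OF relabel_tuple[OF a n] measurable_space[OF measurable_tuple[OF n] that]])
qed

lemma admissible_label_energy: "admissible (\<lambda>u a. label_energy a u)"
  unfolding label_energy_def divide_inverse
  by (intro admissible_mult[OF admissible_sum admissible_const] admissible_tuple)

text \<open>An injective tuple extends to a permutation that carries the first block onto it, and
  the law is exchangeable.\<close>

lemma mean_tuple:
  assumes n: "n \<in> tuples k r" and inj: "inj_on n {1..r}"
  shows "mean (\<lambda>u a. w (\<lambda>j\<in>{1..r}. a (n j)) (\<lambda>A\<in>D. u (n ` A))) = mean first_block"
proof -
  obtain \<sigma> where \<sigma>: "\<sigma> permutes {1..k}" and eq: "\<And>j. j \<in> {1..r} \<Longrightarrow> \<sigma> j = n j"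
    using extend_to_permutation[of "{1..k}" "{1..r}" n] inj n r_le_k
    by (auto simp: tuples_def Pi_iff PiE_iff image_subset_iff)
  have "mean (\<lambda>u a. w (\<lambda>j\<in>{1..r}. a (n j)) (\<lambda>A\<in>D. u (n ` A)))
      = mean (\<lambda>u a. first_block (act \<sigma> u) (relabel \<sigma> a))"
  proof (rule mean_cong)
    fix u a assume u: "u \<in> space P" and a: "a \<in> Lab"
    have "(\<lambda>j\<in>{1..r}. a (n j)) = restrict (relabel \<sigma> a) {1..r}"
      using r_le_k eq by (auto simp: relabel_def fun_eq_iff)
    moreover have "(\<lambda>A\<in>D. u (n ` A)) = low (act \<sigma> u)"
    proof (rule ext)
      fix A
      show "(\<lambda>A\<in>D. u (n ` A)) A = low (act \<sigma> u) A"
      proof (cases "A \<in> D")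
        case True
        then have "\<sigma> ` A = n ` A" using eq by (intro image_cong) (auto simp: D_eq)
        then show ?thesis using True D_subset_I by (auto simp: low_def act_def)
      qed (simp add: low_def)
    qed
    ultimately show "w (\<lambda>j\<in>{1..r}. a (n j)) (\<lambda>A\<in>D. u (n ` A)) = first_block (act \<sigma> u) (relabel \<sigma> a)"
      by (simp add: first_block_eq[OF relabel_mem[OF \<sigma> a]])
  qed
  also have "\<dots> = mean first_block" by (rule mean_act[OF \<sigma> admissible_first_block])
  finally show ?thesis .
qed

text \<open>Only tuples with a repeated entry can deviate from the first block. Each deviates by at
  most 2, and their share among all tuples is at most \<open>r * r / k\<close>.\<close>

lemma mean_label_energy_first_block: "\<bar>mean (\<lambda>u a. label_energy a u) - mean first_block\<bar> \<le> 2 * real (r * r) / real k"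
proof -
  let ?F = "\<lambda>n u a. w (\<lambda>j\<in>{1..r}. a (n j)) (\<lambda>A\<in>D. u (n ` A))"
  have k: "0 < k" using r_pos r_le_k by simp
  have le1: "\<bar>mean F\<bar> \<le> 1" if F: "admissible F" "\<And>u a. u \<in> space P \<Longrightarrow> a \<in> Lab \<Longrightarrow> \<bar>F u a\<bar> \<le> 1" for F
  proof -
    have "mean F \<le> mean (\<lambda>u a. 1)" "mean (\<lambda>u a. - 1) \<le> mean F"
      using F by (auto intro!: mean_mono admissible_const simp: abs_le_iff)
    then show ?thesis by (simp add: mean_const abs_le_iff)
  qed
  have b: "\<bar>mean (?F n) - mean first_block\<bar> \<le> (if inj_on n {1..r} then 0 else 2)"
    if n: "n \<in> tuples k r" for n
  proof (cases "inj_on n {1..r}")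
    case False
    have "\<bar>mean (?F n)\<bar> \<le> 1"
      using n by (intro le1 admissible_tuple w_le relabel_tuple measurable_space[OF measurable_tuple])
    moreover have "\<bar>mean first_block\<bar> \<le> 1"
      by (intro le1 admissible_first_block first_block_le)
    ultimately show ?thesis using False by auto
  next
    case True
    then show ?thesis by (simp only: mean_tuple[OF n True]) simp
  qed
  have "mean (\<lambda>u a. label_energy a u) = mean (\<lambda>u a. (1 / real k ^ r) * (\<Sum>n\<in>tuples k r. ?F n u a))"
    by (simp add: label_energy_def)
  also have "\<dots> = (1 / real k ^ r) * (\<Sum>n\<in>tuples k r. mean (?F n))"
    by (simp only: mean_cmult[OF admissible_sum[OF admissible_tuple]] mean_sum[OF admissible_tuple])
  finally have 1: "mean (\<lambda>u a. label_energy a u) = (1 / real k ^ r) * (\<Sum>n\<in>tuples k r. mean (?F n))" .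
  have 2: "mean first_block = (1 / real k ^ r) * (\<Sum>n\<in>tuples k r. mean first_block)"
    using k by (simp add: tuples_def card_PiE)
  have "\<bar>mean (\<lambda>u a. label_energy a u) - mean first_block\<bar>
      = \<bar>(1 / real k ^ r) * (\<Sum>n\<in>tuples k r. mean (?F n) - mean first_block)\<bar>"
    by (subst 1, subst 2) (simp only: right_diff_distrib sum_subtractf)
  also have "\<dots> = \<bar>\<Sum>n\<in>tuples k r. mean (?F n) - mean first_block\<bar> * (1 / real k ^ r)"
    by (simp only: abs_mult) (simp add: mult.commute)
  also have "\<dots> \<le> (\<Sum>n\<in>tuples k r. if inj_on n {1..r} then 0 else 2) * (1 / real k ^ r)"
    using b by (intro mult_right_mono order.trans[OF sum_abs] sum_mono) auto
  also have "(\<Sum>n\<in>tuples k r. if inj_on n {1..r} then 0 else 2)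
      = 2 * real (card {n \<in> tuples k r. \<not> inj_on n {1..r}})"
  proof -
    have "(\<Sum>n\<in>tuples k r. if inj_on n {1..r} then 0 else (2::real))
        = (\<Sum>n\<in>{n \<in> tuples k r. \<not> inj_on n {1..r}}. 2)"
      by (intro sum.mono_neutral_cong_right) auto
    then show ?thesis by simp
  qed
  also have "2 * real (card {n \<in> tuples k r. \<not> inj_on n {1..r}}) * (1 / real k ^ r)
      \<le> 2 * real (r * r * k ^ (r - 1)) * (1 / real k ^ r)"
    using card_noninjective_tuples[of k r] by (intro mult_right_mono) (simp_all add: of_nat_le_iff del: of_nat_mult of_nat_power)
  also have "\<dots> = 2 * real (r * r) / real k"
    using k r_pos by (cases r) (auto simp: field_simps)
  finally show ?thesis .
qed

text \<open>One rule, made for vertex 1, serves the whole block: it is carried to vertex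
  \<open>j\<close> by exchanging 1 and \<open>j\<close>. The set \<open>S\<close> lies beyond the
  block and is not moved, so all predictions read the same labels.\<close>

definition shifted :: "(nat \<Rightarrow> (nat set \<Rightarrow> real) \<Rightarrow> (nat \<Rightarrow> nat) \<Rightarrow> real)
    \<Rightarrow> nat \<Rightarrow> nat \<Rightarrow> (nat set \<Rightarrow> real) \<Rightarrow> (nat \<Rightarrow> nat) \<Rightarrow> real" where
  "shifted g j m u a = g m (act (Transposition.transpose 1 j) u) (relabel (Transposition.transpose 1 j) a)"

lemma transpose_permutes: "j \<in> {1..r} \<Longrightarrow> Transposition.transpose 1 j permutes {1..k}"
  using r_pos r_le_k by (intro permutes_swap_id) auto

lemma transpose_image_fixed: "S \<subseteq> {r<..k} \<Longrightarrow> j \<in> {1..r} \<Longrightarrow> Transposition.transpose 1 j ` S = S"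
proof -
  assume S: "S \<subseteq> {r<..k}" and j: "j \<in> {1..r}"
  have "Transposition.transpose 1 j n = n" if "n \<in> S" for n
    using S j that r_pos by (intro transpose_apply_other) auto
  then show ?thesis by simp
qed

lemma transpose_image_block:
  assumes "j \<in> {1..r}"
  shows "Transposition.transpose 1 j ` {2..r} = {1..r} - {j}"
proof -
  have "{2..r} = {1..r} - {1}" by auto
  moreover have "Transposition.transpose 1 j ` {1..r} = {1..r}"
    using assms r_pos by (intro permutes_image permutes_swap_id) auto
  ultimately show ?thesis by (simp add: image_set_diff)
qed

lemma predictor_shifted:
  assumes g: "predictor 1 S g" and S: "S \<subseteq> {r<..k}" and j: "j \<in> {1..r}"
  shows "predictor j S (shifted g j)"
proof -
  have "S \<subseteq> {1..k}" using S by auto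
  then show ?thesis
    using predictor_act[OF g transpose_permutes[OF j]] transpose_image_fixed[OF S j] r_pos r_le_k
    unfolding shifted_def[abs_def] by auto
qed

text \<open>Exchanging 1 and \<open>j\<close> turns \<open>{2..r}\<close> into the block without
  \<open>j\<close>, so the \<open>r - 1\<close> additional vertices are always the rest of the
  block.\<close>

lemma nearly_optimal_shifted:
  assumes g: "predictor 1 S g" and S: "S \<subseteq> {r<..k}" and j: "j \<in> {1..r}"
    and opt: "nearly_optimal 1 (S \<union> {2..r}) d g"
  shows "nearly_optimal j (S \<union> ({1..r} - {j})) d (shifted g j)"
proof -
  have "S \<union> {2..r} \<subseteq> {1..k}" using S r_le_k by auto
  then show ?thesis
    using nearly_optimal_act[OF g opt transpose_permutes[OF j]] transpose_image_fixed[OF S j]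
      transpose_image_block[OF j] r_pos r_le_k
    unfolding shifted_def[abs_def] by (auto simp: image_Un)
qed

lemma low_cong:
  "(\<And>T. T \<in> I \<Longrightarrow> T \<subseteq> {1..r} \<Longrightarrow> u T = u' T) \<Longrightarrow> low u = low u'"
  unfolding low_def using D_subset_I D_eq by (intro restrict_ext) blast

lemma measurable_multilin:
  assumes "\<And>j m. j \<in> {1..r} \<Longrightarrow> m \<in> {1..q} \<Longrightarrow> (\<lambda>u. b u j m) \<in> borel_measurable P"
  shows "(\<lambda>u. multilin (b u) (low u)) \<in> borel_measurable P"
  unfolding multilin_def
proof (intro borel_measurable_sum borel_measurable_times borel_measurable_prod)
  fix z j assume zj: "z \<in> tuples q r" "j \<in> {1..r}"
  show "(\<lambda>u. b u j (z j)) \<in> borel_measurable P"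
    by (rule assms[OF zj(2) tuples_mem[OF zj]])
qed (rule measurable_compose[OF measurable_low w_measurable])

text \<open>A hybrid argument over the vertices of the block. While one vertex is treated, the rest
  of the weight depends on variables of the whole block and on labels of its other vertices; hence
  near-optimality is needed against \<open>S\<close> enlarged by the rest of the block. Each vertex
  costs \<open>3 * sqrt d\<close>.\<close>

lemma replace_block:
  assumes g: "predictor 1 S g" and S: "S \<subseteq> {r<..k}"
    and opt: "nearly_optimal 1 (S \<union> {2..r}) d g" and d: "0 < d" "d \<le> 1 / 4"
  shows "mean first_block \<le> mean (\<lambda>u a. multilin (\<lambda>j m. shifted g j m u a) (low u)) + 3 * real r * sqrt d"
proof -
  \<comment> \<open>Stage \<open>i\<close> of the hybrid: vertices up to \<open>i\<close> carry
    their predictions, the later ones their true labels.\<close>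
  define b where "b = (\<lambda>i u a j. if j \<le> i then (\<lambda>m. shifted g j m u a) else vertex (a j))"
  have pv: "prob_vec q (b i u a j)" if "j \<in> {1..r}" "u \<in> space P" "a \<in> Lab" for i u a j
  proof -
    have "a j \<in> {1..q}" using that(1) r_le_k by (intro tuples_mem[OF that(3)]) auto
    then show ?thesis
      using predictor_prob_vec[OF predictor_shifted[OF g S that(1)] that(2,3)]
      by (simp add: b_def prob_vec_vertex)
  qed
  have "mean (\<lambda>u a. multilin (b 0 u a) (low u)) \<le> mean (\<lambda>u a. multilin (b i u a) (low u)) + 3 * real i * sqrt d"
    if "i \<le> r" for i
    using that
  proof (induction i)
    case (Suc i)
    let ?v = "Suc i" and ?S' = "S \<union> ({1..r} - {Suc i})"
    have v: "?v \<in> {1..r}" "?v \<in> {1..k}" using Suc.prems r_le_k by auto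
    \<comment> \<open>The current weight as a function of the label \<open>m\<close> tried at the
      current vertex. Its true label no longer enters, as the locality condition demands.\<close>
    define \<psi> where "\<psi> = (\<lambda>m u a. multilin ((b i u a)(?v := vertex m)) (low u))"
    have "mean (\<lambda>u a. multilin (b i u a) (low u)) = mean (\<lambda>u a. \<psi> (a ?v) u a)"
      unfolding \<psi>_def by (intro mean_cong multilin_cong) (auto simp: b_def)
    also have "\<dots> \<le> mean (\<lambda>u a. \<Sum>m\<in>{1..q}. shifted g ?v m u a * \<psi> m u a) + 3 * sqrt d"
    proof (rule replace_label[OF predictor_shifted[OF g S v(1)] _ v(2) nearly_optimal_shifted[OF g S v(1) opt] d])
      fix m a assume m: "m \<in> {1..q}" and a: "a \<in> Lab"
      show "(\<lambda>u. \<psi> m u a) \<in> borel_measurable P"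
        unfolding \<psi>_def
      proof (rule measurable_multilin)
        fix j m' assume "j \<in> {1..r}" "m' \<in> {1..q}"
        then show "(\<lambda>u. ((b i u a)(?v := vertex m)) j m') \<in> borel_measurable P"
          using predictorD(1)[OF predictor_shifted[OF g S], of j m' a] a
          by (cases "j = ?v"; cases "j \<le> i") (auto simp: b_def)
      qed
      fix u assume u: "u \<in> space P"
      show "\<bar>\<psi> m u a\<bar> \<le> 1"
        unfolding \<psi>_def using pv[OF _ u a] prob_vec_vertex[OF m]
        by (intro multilin_le low_space u) auto
    next
      fix m assume m: "m \<in> {1..q}"
      show "local_to (insert ?v ?S') ?S' (\<psi> m)"
      proof (rule local_toI)
        fix u u' a a' assume *: "u \<in> space P" "u' \<in> space P" "a \<in> Lab" "a' \<in> Lab"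
          "\<And>T. T \<in> I \<Longrightarrow> T \<subseteq> insert ?v ?S' \<Longrightarrow> u T = u' T" "\<And>n. n \<in> ?S' \<Longrightarrow> a n = a' n"
        have low: "low u = low u'" by (rule low_cong, rule *(5)) auto
        show "\<psi> m u a = \<psi> m u' a'"
          unfolding \<psi>_def low
        proof (rule multilin_cong)
          fix j m' assume j: "j \<in> {1..r}" and m': "m' \<in> {1..q}"
          have "shifted g j m' u a = shifted g j m' u' a'"
            using j by (intro local_toD[OF predictorD(2)[OF predictor_shifted[OF g S j] m'] *(1-4)] *(5,6)) auto
          moreover have "a j = a' j" if "j \<noteq> ?v" using *(6)[of j] that j by simp
          ultimately show "((b i u a)(?v := vertex m)) j m' = ((b i u' a')(?v := vertex m)) j m'"
            by (auto simp: b_def)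
        qed
      qed
    qed auto
    also have "mean (\<lambda>u a. \<Sum>m\<in>{1..q}. shifted g ?v m u a * \<psi> m u a) = mean (\<lambda>u a. multilin (b ?v u a) (low u))"
    proof (rule mean_cong)
      fix u a
      have "(\<Sum>m\<in>{1..q}. shifted g ?v m u a * \<psi> m u a)
          = multilin ((b i u a)(?v := (\<lambda>m. shifted g ?v m u a))) (low u)"
        unfolding \<psi>_def by (rule multilin_linear[OF v(1), symmetric])
      also have "\<dots> = multilin (b ?v u a) (low u)"
        by (rule multilin_cong) (auto simp: b_def)
      finally show "(\<Sum>m\<in>{1..q}. shifted g ?v m u a * \<psi> m u a) = multilin (b ?v u a) (low u)" .
    qed
    finally show ?case using Suc by (simp add: algebra_simps)
  qed simp
  from this[of r] have "mean (\<lambda>u a. multilin (b 0 u a) (low u))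
      \<le> mean (\<lambda>u a. multilin (b r u a) (low u)) + 3 * real r * sqrt d" by simp
  also have "mean (\<lambda>u a. multilin (b 0 u a) (low u)) = mean first_block"
    unfolding first_block_def by (intro mean_cong multilin_cong) (auto simp: b_def)
  also have "mean (\<lambda>u a. multilin (b r u a) (low u)) = mean (\<lambda>u a. multilin (\<lambda>j m. shifted g j m u a) (low u))"
    by (intro mean_cong multilin_cong) (auto simp: b_def)
  finally show ?thesis .
qed

end

section \<open>Disjoint blocks\<close>

lemma swap_block_fixes: "i < M \<Longrightarrow> S \<subseteq> {r * M<..k} \<Longrightarrow> n \<in> S \<Longrightarrow> swap_block r i n = n"
proof -
  assume i: "i < M" and S: "S \<subseteq> {r * M<..k}" and n: "n \<in> S"
  have "Suc i * r \<le> M * r" using i by (intro mult_le_mono1) simp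
  moreover have "M * r < n" using S n by (auto simp: mult.commute)
  ultimately have "r < n" "i * r + r < n" by simp_all
  then show ?thesis by (simp add: swap_block_def)
qed

lemma swap_block_image_first: "swap_block r i ` {1..r} = {i*r+1..i*r+r}"
proof -
  have "swap_block r i ` {1..r} = (\<lambda>n. n + i * r) ` {1..r}"
    by (intro image_cong) (auto simp: swap_block_def)
  then show ?thesis by (simp add: add.commute)
qed

context sampling
begin

text \<open>Once the variables inside \<open>S\<close> are frozen, the \<open>M\<close> copies of
  \<open>f\<close> are independent: copy \<open>i\<close> otherwise reads only variables whose index
  set meets block \<open>i\<close> and stays within that block and \<open>S\<close>. Each factor is
  then covered by Hoeffding's lemma. Since \<open>S\<close> lies beyond all blocks, exchanging
  blocks does not disturb it.\<close>

lemma integral_exp_blocks: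
  fixes f :: "_ \<Rightarrow> real"
  assumes f [measurable]: "f \<in> borel_measurable P" and f1: "\<And>u. u \<in> space P \<Longrightarrow> \<bar>f u\<bar> \<le> 1"
    and dep: "depends_on f {T. T \<subseteq> S \<union> {1..r}}"
    and S: "S \<subseteq> {r * M<..k}" and M: "r * M \<le> k" and \<gamma>: "0 < \<gamma>"
    and V: "\<And>w. w \<in> space P \<Longrightarrow> (\<integral>v. f (splice (Pow S) w v) \<partial>P) \<le> V"
  shows "(\<integral>u. exp (\<gamma> * (\<Sum>i<M. f (act (swap_block r i) u))) \<partial>P) \<le> exp (real M * (\<gamma> * V + \<gamma>\<^sup>2 / 2))"
proof -
  let ?\<sigma> = "swap_block r"
  have \<sigma>: "?\<sigma> i permutes {1..k}" if "i < M" for i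
    using that M by (rule swap_block_permutes)
  note [measurable] = measurable_act[OF \<sigma>]
  have fact: "\<bar>f (act (?\<sigma> i) u)\<bar> \<le> 1" if "i < M" "u \<in> space P" for i u
    using that by (intro f1 act_space \<sigma>)
  have e: "exp (\<gamma> * (\<Sum>i<M. f (act (?\<sigma> i) u))) = (\<Prod>i<M. exp (\<gamma> * f (act (?\<sigma> i) u)))" for u
    by (simp add: sum_distrib_left exp_sum)
  have exp1: "exp (\<gamma> * x) \<le> exp \<gamma>" if "\<bar>x\<bar> \<le> 1" for x
    using that \<gamma> by (simp add: abs_le_iff)
  have bound: "\<bar>\<Prod>i<M. exp (\<gamma> * f (act (?\<sigma> i) u))\<bar> \<le> exp \<gamma> ^ M" if u: "u \<in> space P" for u
  proof -
    have "(\<Prod>i<M. exp (\<gamma> * f (act (?\<sigma> i) u))) \<le> (\<Prod>i<M. exp \<gamma>)"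
      using fact u by (intro prod_mono conjI exp1) auto
    then show ?thesis by (simp add: abs_prod)
  qed
  have meas: "(\<lambda>u. \<Prod>i<M. exp (\<gamma> * f (act (?\<sigma> i) u))) \<in> borel_measurable P"
    by (intro borel_measurable_prod) measurable
  \<comment> \<open>The exchange fixes \<open>S\<close> pointwise, so it maps index sets inside
    \<open>S\<close> to themselves and all others to sets not inside \<open>S\<close>; freezing
    therefore commutes with it.\<close>
  have comm: "act (?\<sigma> i) (splice (Pow S) w v) = splice (Pow S) w (act (?\<sigma> i) v)" if i: "i < M" for i w v
  proof (rule ext)
    fix T
    have fixS: "?\<sigma> i n = n" if "n \<in> S" for n using i S that by (rule swap_block_fixes)
    have sub: "?\<sigma> i ` T \<subseteq> S \<longleftrightarrow> T \<subseteq> S"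
    proof
      assume T: "?\<sigma> i ` T \<subseteq> S"
      show "T \<subseteq> S"
      proof
        fix n assume "n \<in> T"
        then have "?\<sigma> i n \<in> S" using T by auto
        with fixS[OF this] show "n \<in> S" by simp
      qed
    qed (use fixS in auto)
    show "act (?\<sigma> i) (splice (Pow S) w v) T = splice (Pow S) w (act (?\<sigma> i) v) T"
    proof (cases "T \<in> I")
      case True
      have "?\<sigma> i ` T = T" if "T \<subseteq> S" using fixS that by (auto simp: subset_iff image_iff)
      then show ?thesis
        using True image_I[OF \<sigma>[OF i] True] sub by (auto simp: act_def splice_def)
    qed (simp add: act_def splice_def)
  qed
  have inner: "(\<integral>v. (\<Prod>i<M. exp (\<gamma> * f (act (?\<sigma> i) (splice (Pow S) w v)))) \<partial>P)
      \<le> exp (real M * (\<gamma> * V + \<gamma>\<^sup>2 / 2))" if w: "w \<in> space P" for w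
  proof -
    define X where "X = (\<lambda>v. f (splice (Pow S) w v))"
    have X [measurable]: "X \<in> borel_measurable P"
      unfolding X_def using w by measurable
    have X1: "\<bar>X v\<bar> \<le> 1" if "v \<in> space P" for v
      unfolding X_def using w that by (intro f1 splice_space)
    \<comment> \<open>Index sets inside \<open>S\<close> are left out because they are frozen. Every
      remaining one contains a vertex of block \<open>i\<close>, and the blocks are
      disjoint.\<close>
    define K where "K = (\<lambda>i. {T. T \<subseteq> S \<union> {i*r+1..i*r+r} \<and> \<not> T \<subseteq> S})"
    have "(\<integral>v. (\<Prod>i<M. exp (\<gamma> * X (act (?\<sigma> i) v))) \<partial>P)
        = (\<Prod>i<M. \<integral>v. exp (\<gamma> * X (act (?\<sigma> i) v)) \<partial>P)"
    proof (rule integral_prod_disjoint[where K = K and B = "exp \<gamma>"])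
      show "disjoint_family_on K {..<M}"
        unfolding disjoint_family_on_def
      proof (intro ballI impI)
        fix i j :: nat assume ij: "i \<noteq> j"
        have "{i*r+1..i*r+r} \<inter> {j*r+1..j*r+r} = {}"
        proof (cases "i < j")
          case True
          then have "Suc i * r \<le> j * r" by (intro mult_le_mono1) simp
          then show ?thesis by auto
        next
          case False
          then have "Suc j * r \<le> i * r" using ij by (intro mult_le_mono1) simp
          then show ?thesis by auto
        qed
        then show "K i \<inter> K j = {}" unfolding K_def by blast
      qed
      fix i assume "i \<in> {..<M}"
      then have i: "i < M" by simp
      show "(\<lambda>v. exp (\<gamma> * X (act (?\<sigma> i) v))) \<in> borel_measurable P"
        using i by measurable
      show "\<bar>exp (\<gamma> * X (act (?\<sigma> i) u))\<bar> \<le> exp \<gamma>" if "u \<in> space P" for u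
        using exp1[OF X1[OF act_space[OF \<sigma>[OF i] that]]] by simp
      have image: "?\<sigma> i ` (S \<union> {1..r}) = S \<union> {i*r+1..i*r+r}"
      proof -
        have "?\<sigma> i ` S = S" using swap_block_fixes[OF i S] by (auto simp: image_iff)
        then show ?thesis by (simp only: image_Un swap_block_image_first)
      qed
      show "depends_on (\<lambda>v. exp (\<gamma> * X (act (?\<sigma> i) v))) (K i)"
        unfolding depends_on_def
      proof (intro ballI impI)
        fix u v assume u: "u \<in> space P" and v: "v \<in> space P" and eq: "\<forall>T\<in>I \<inter> K i. u T = v T"
        have "X (act (?\<sigma> i) u) = X (act (?\<sigma> i) v)"
          unfolding X_def
        proof (rule depends_onD[OF dep])
          fix T assume T: "T \<in> I" "T \<in> {T. T \<subseteq> S \<union> {1..r}}"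
          show "splice (Pow S) w (act (?\<sigma> i) u) T = splice (Pow S) w (act (?\<sigma> i) v) T"
          proof (cases "T \<subseteq> S")
            case False
            then obtain n where n: "n \<in> T" "n \<notin> S" by auto
            have "?\<sigma> i n \<notin> S"
            proof
              assume "?\<sigma> i n \<in> S"
              from swap_block_fixes[OF i S this] have "?\<sigma> i n = n" by simp
              with \<open>?\<sigma> i n \<in> S\<close> n(2) show False by simp
            qed
            then have "\<not> ?\<sigma> i ` T \<subseteq> S" using n(1) by auto
            moreover have "?\<sigma> i ` T \<subseteq> S \<union> {i*r+1..i*r+r}"
              using image_mono[of T "S \<union> {1..r}" "?\<sigma> i"] T(2) image by auto
            ultimately have "?\<sigma> i ` T \<in> I \<inter> K i"
              using image_I[OF \<sigma>[OF i] T(1)] by (simp add: K_def)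
            then show ?thesis using eq T(1) by (simp add: splice_def act_def)
          qed (simp add: splice_def)
        qed (intro splice_space act_space \<sigma> i w u v)+
        then show "exp (\<gamma> * X (act (?\<sigma> i) u)) = exp (\<gamma> * X (act (?\<sigma> i) v))" by simp
      qed
    qed simp
    also have "\<dots> \<le> (\<Prod>i<M. exp (\<gamma> * V + \<gamma>\<^sup>2 / 2))"
    proof (rule prod_mono)
      fix i assume "i \<in> {..<M}"
      then have i: "i < M" by simp
      have "(\<integral>v. exp (\<gamma> * X (act (?\<sigma> i) v)) \<partial>P) = (\<integral>v. exp (\<gamma> * X v) \<partial>P)"
        by (rule integral_act[OF \<sigma>[OF i], of "\<lambda>v. exp (\<gamma> * X v)"]) measurable
      also have "\<dots> \<le> exp (\<gamma> * V + \<gamma>\<^sup>2 / 2)"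
        using V[OF w] X1 \<gamma> by (intro integral_exp_le X) (auto simp: X_def)
      finally show "0 \<le> (\<integral>v. exp (\<gamma> * X (act (?\<sigma> i) v)) \<partial>P) \<and>
          (\<integral>v. exp (\<gamma> * X (act (?\<sigma> i) v)) \<partial>P) \<le> exp (\<gamma> * V + \<gamma>\<^sup>2 / 2)"
        by (auto intro: integral_nonneg_AE)
    qed
    also have "\<dots> = exp (real M * (\<gamma> * V + \<gamma>\<^sup>2 / 2))"
      by (simp add: exp_of_nat_mult)
    also have "(\<integral>v. (\<Prod>i<M. exp (\<gamma> * X (act (?\<sigma> i) v))) \<partial>P)
        = (\<integral>v. (\<Prod>i<M. exp (\<gamma> * f (act (?\<sigma> i) (splice (Pow S) w v)))) \<partial>P)"
      by (intro Bochner_Integration.integral_cong prod.cong refl) (simp add: X_def comm)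
    finally show ?thesis .
  qed
  have "(\<integral>u. (\<Prod>i<M. exp (\<gamma> * f (act (?\<sigma> i) u))) \<partial>P)
      = (\<integral>w. (\<integral>v. (\<Prod>i<M. exp (\<gamma> * f (act (?\<sigma> i) (splice (Pow S) w v)))) \<partial>P) \<partial>P)"
    by (rule integral_splice(1)[OF meas bound])
  also have "\<dots> \<le> (\<integral>w. exp (real M * (\<gamma> * V + \<gamma>\<^sup>2 / 2)) \<partial>P)"
  proof (rule integral_mono)
    show "integrable P (\<lambda>w. \<integral>v. (\<Prod>i<M. exp (\<gamma> * f (act (?\<sigma> i) (splice (Pow S) w v)))) \<partial>P)"
    proof (rule integrable_bounded)
      fix w assume w: "w \<in> space P"
      have "0 \<le> (\<integral>v. (\<Prod>i<M. exp (\<gamma> * f (act (?\<sigma> i) (splice (Pow S) w v)))) \<partial>P)"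
        by (intro integral_nonneg_AE AE_I2 prod_nonneg) simp
      with inner[OF w] show "\<bar>\<integral>v. (\<Prod>i<M. exp (\<gamma> * f (act (?\<sigma> i) (splice (Pow S) w v)))) \<partial>P\<bar>
          \<le> exp (real M * (\<gamma> * V + \<gamma>\<^sup>2 / 2))" by simp
    qed (rule integral_splice(2)[OF meas bound])
  qed (use inner in auto)
  also have "\<dots> = exp (real M * (\<gamma> * V + \<gamma>\<^sup>2 / 2))" by (simp add: P.prob_space)
  finally show ?thesis by (simp only: e)
qed

end

context symmetric_law
begin

text \<open>Change of measure: an observable that ignores the labels feels only the marginal density
  of the variables.\<close>

lemma mean_le_integral:
  assumes "Y \<in> borel_measurable P" "\<And>u. u \<in> space P \<Longrightarrow> 0 \<le> Y u" "\<And>u. u \<in> space P \<Longrightarrow> Y u \<le> B"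
  shows "mean (\<lambda>u a. Y u) \<le> (1 / \<theta>) * (\<integral>u. Y u \<partial>P)"
proof -
  have Yi: "integrable P Y" using assms by (intro integrable_bounded[where B = B]) auto
  have adm: "admissible (\<lambda>u a. Y u)" using assms by (intro admissibleI[where B = B]) auto
  have "mean (\<lambda>u a. Y u) \<le> (\<integral>u. (1 / \<theta>) * Y u \<partial>P)"
    unfolding mean_def
  proof (rule integral_mono)
    show "integrable P (\<lambda>u. \<Sum>a\<in>Lab. p a u * Y u)"
      by (intro Bochner_Integration.integrable_sum integrable_mean[OF adm])
    show "integrable P (\<lambda>u. (1 / \<theta>) * Y u)" using Yi by (intro integrable_mult_right)
    fix u assume u: "u \<in> space P"
    show "(\<Sum>a\<in>Lab. p a u * Y u) \<le> (1 / \<theta>) * Y u"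
      unfolding sum_distrib_right[symmetric]
      by (intro mult_right_mono p_sum_le u assms)
  qed
  also have "\<dots> = (1 / \<theta>) * (\<integral>u. Y u \<partial>P)" by simp
  finally show ?thesis .
qed

text \<open>By symmetry \<open>f\<close> may be averaged over \<open>M\<close> disjoint blocks; the labels on \<open>S\<close> are then
  absorbed by a maximum over the \<open>q ^ card S\<close> possibilities, bounded through exponential moments.\<close>

lemma mean_block_le:
  assumes f: "admissible f" and f1: "\<And>u a. u \<in> space P \<Longrightarrow> a \<in> Lab \<Longrightarrow> \<bar>f u a\<bar> \<le> 1"
    and loc: "local_to (S \<union> {1..r}) S f"
    and S: "S \<subseteq> {r * M<..k}" and M: "r * M \<le> k" "1 \<le> M" and \<gamma>: "0 < \<gamma>"
    and V: "\<And>w a. w \<in> space P \<Longrightarrow> a \<in> Lab \<Longrightarrow> (\<integral>v. f (splice (Pow S) w v) a \<partial>P) \<le> V"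
  shows "mean f \<le> V + (real (card S) * ln (real q) + ln (1 / \<theta>)) / (\<gamma> * real M) + \<gamma> / 2"
proof -
  let ?\<sigma> = "swap_block r"
  have \<sigma>: "?\<sigma> i permutes {1..k}" if "i < M" for i
    using that M(1) by (rule swap_block_permutes)
  define H where "H = (\<lambda>u a. \<Sum>i<M. f (act (?\<sigma> i) u) (relabel (?\<sigma> i) a))"
  have Hadm: "admissible H"
    unfolding H_def using \<sigma> by (intro admissible_sum admissible_act f) auto
  have mean_H: "mean H = real M * mean f"
  proof -
    have "mean H = (\<Sum>i<M. mean (\<lambda>u a. f (act (?\<sigma> i) u) (relabel (?\<sigma> i) a)))"
      unfolding H_def using \<sigma> by (intro mean_sum admissible_act f) auto
    also have "\<dots> = (\<Sum>i<M. mean f)"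
      using \<sigma> f by (intro sum.cong mean_act) auto
    finally show ?thesis by simp
  qed
  have finS: "finite S" using S by (rule finite_subset) simp
  \<comment> \<open>By locality the labels off \<open>S\<close> do not influence \<open>f\<close>;
    the default 1 is a legal label because \<open>1 \<le> q\<close>.\<close>
  define lab :: "(nat \<Rightarrow> nat) \<Rightarrow> nat \<Rightarrow> nat" where "lab = (\<lambda>b n. if n \<in> {1..k} then if n \<in> S then b n else 1 else undefined)"
  have lab: "lab b \<in> Lab" if "b \<in> S \<rightarrow>\<^sub>E {1..q}" for b
    using that q_pos by (auto simp: lab_def tuples_def PiE_iff extensional_def)
  define Y where "Y = (\<lambda>u. \<Sum>b\<in>S \<rightarrow>\<^sub>E {1..q}. exp (\<gamma> * (\<Sum>i<M. f (act (?\<sigma> i) u) (lab b))))"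
  have expm: "(\<lambda>u. exp (\<gamma> * (\<Sum>i<M. f (act (?\<sigma> i) u) (lab b)))) \<in> borel_measurable P"
    if b: "b \<in> S \<rightarrow>\<^sub>E {1..q}" for b
  proof -
    have "(\<lambda>u. f (act (?\<sigma> i) u) (lab b)) \<in> borel_measurable P" if "i \<in> {..<M}" for i
      using that by (intro measurable_compose[OF measurable_act[OF \<sigma>] admissible_measurable[OF f lab[OF b]]]) simp
    then have "(\<lambda>u. \<Sum>i<M. f (act (?\<sigma> i) u) (lab b)) \<in> borel_measurable P"
      by (rule borel_measurable_sum)
    then show ?thesis by measurable
  qed
  have Ym: "Y \<in> borel_measurable P"
    unfolding Y_def by (rule borel_measurable_sum[OF expm])
  have expM: "exp (\<gamma> * (\<Sum>i<M. f (act (?\<sigma> i) u) (lab b))) \<le> exp (\<gamma> * real M)"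
    if u: "u \<in> space P" and b: "b \<in> S \<rightarrow>\<^sub>E {1..q}" for u b
  proof -
    have "f (act (?\<sigma> i) u) (lab b) \<le> 1" if "i \<in> {..<M}" for i
      using f1[OF act_space[OF \<sigma> u] lab[OF b], of i] that by (simp add: abs_le_iff)
    then have "(\<Sum>i<M. f (act (?\<sigma> i) u) (lab b)) \<le> (\<Sum>i<M. 1)"
      by (rule sum_mono)
    then show ?thesis using \<gamma> by simp
  qed
  define N where "N = real q ^ card S"
  have card: "real (card (S \<rightarrow>\<^sub>E {1..q})) = N"
    using finS by (simp add: card_PiE N_def)
  have N: "N > 0" using q_pos by (simp add: N_def)
  have Y_le: "Y u \<le> N * exp (\<gamma> * real M)" if "u \<in> space P" for u
    unfolding Y_def card[symmetric] by (rule sum_bounded_above) (rule expM[OF that])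
  have Y0: "0 \<le> Y u" for u unfolding Y_def by (intro sum_nonneg) simp
  have int_exp: "(\<integral>u. exp (\<gamma> * (\<Sum>i<M. f (act (?\<sigma> i) u) a)) \<partial>P) \<le> exp (real M * (\<gamma> * V + \<gamma>\<^sup>2 / 2))"
    if a: "a \<in> Lab" for a
  proof (rule integral_exp_blocks[OF admissible_measurable[OF f a] f1[OF _ a] _ S M(1) \<gamma> V[OF _ a]])
    show "depends_on (\<lambda>u. f u a) {T. T \<subseteq> S \<union> {1..r}}"
      unfolding depends_on_def by (intro ballI impI local_toD[OF loc _ _ a a]) auto
  qed
  have "(\<integral>u. Y u \<partial>P) = (\<Sum>b\<in>S \<rightarrow>\<^sub>E {1..q}. \<integral>u. exp (\<gamma> * (\<Sum>i<M. f (act (?\<sigma> i) u) (lab b))) \<partial>P)"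
    unfolding Y_def
  proof (rule Bochner_Integration.integral_sum)
    fix b assume b: "b \<in> S \<rightarrow>\<^sub>E {1..q}"
    show "integrable P (\<lambda>u. exp (\<gamma> * (\<Sum>i<M. f (act (?\<sigma> i) u) (lab b))))"
    proof (rule integrable_bounded)
      show "\<bar>exp (\<gamma> * (\<Sum>i<M. f (act (?\<sigma> i) u) (lab b)))\<bar> \<le> exp (\<gamma> * real M)" if "u \<in> space P" for u
        using expM[OF that b] by simp
    qed (rule expm[OF b])
  qed
  also have "\<dots> \<le> (\<Sum>b\<in>S \<rightarrow>\<^sub>E {1..q}. exp (real M * (\<gamma> * V + \<gamma>\<^sup>2 / 2)))"
    by (intro sum_mono int_exp lab)
  also have "\<dots> = N * exp (real M * (\<gamma> * V + \<gamma>\<^sup>2 / 2))" unfolding card[symmetric] by simp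
  finally have intY: "(\<integral>u. Y u \<partial>P) \<le> N * exp (real M * (\<gamma> * V + \<gamma>\<^sup>2 / 2))" .
  \<comment> \<open>The number of label patterns on \<open>S\<close>, times the bound for the
    blocks, times the factor for the change of measure.\<close>
  define c where "c = N * exp (real M * (\<gamma> * V + \<gamma>\<^sup>2 / 2)) / \<theta>"
  have c: "0 < c" using N \<theta>_pos by (simp add: c_def)
  have mean_Y: "mean (\<lambda>u a. Y u) \<le> c"
  proof -
    have "mean (\<lambda>u a. Y u) \<le> (1 / \<theta>) * (\<integral>u. Y u \<partial>P)"
      by (rule mean_le_integral[OF Ym Y0 Y_le])
    also have "\<dots> \<le> (1 / \<theta>) * (N * exp (real M * (\<gamma> * V + \<gamma>\<^sup>2 / 2)))"
      using intY \<theta>_pos by (intro mult_left_mono) auto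
    finally show ?thesis by (simp add: c_def)
  qed
  have Yadm: "admissible (\<lambda>u a. Y u)"
    using Ym Y0 Y_le by (intro admissibleI[where B = "N * exp (\<gamma> * real M)"]) auto
  \<comment> \<open>Jensen's inequality in tangent form: \<open>exp\<close> is replaced by its
    tangent at \<open>ln c\<close>, so that linearity and monotonicity of \<open>mean\<close>
    suffice.\<close>
  have "mean (\<lambda>u a. \<gamma> * H u a) \<le> mean (\<lambda>u a. (1 / c) * Y u + (ln c - 1))"
  proof (rule mean_mono)
    fix u a assume u: "u \<in> space P" and a: "a \<in> Lab"
    let ?b = "restrict a S"
    have b: "?b \<in> S \<rightarrow>\<^sub>E {1..q}"
      unfolding restrict_PiE_iff
    proof
      fix n assume "n \<in> S"
      then have "n \<in> {1..k}" using S by auto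
      then show "a n \<in> {1..q}" by (rule tuples_mem[OF a])
    qed
    have "H u a = (\<Sum>i<M. f (act (?\<sigma> i) u) (lab ?b))"
      unfolding H_def
    proof (rule sum.cong[OF refl])
      fix i assume "i \<in> {..<M}"
      then have i: "i < M" by simp
      have Sk: "n \<in> {1..k}" if "n \<in> S" for n using that S by auto
      show "f (act (?\<sigma> i) u) (relabel (?\<sigma> i) a) = f (act (?\<sigma> i) u) (lab ?b)"
      proof (rule local_toD[OF loc])
        fix n assume n: "n \<in> S"
        show "relabel (?\<sigma> i) a n = lab ?b n"
          using swap_block_fixes[OF i S n] Sk[OF n] n by (simp add: relabel_def lab_def)
      qed (use act_space[OF \<sigma>[OF i] u] relabel_mem[OF \<sigma>[OF i] a] lab[OF b] in auto)
    qed
    then have "exp (\<gamma> * H u a) \<le> Y u"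
      unfolding Y_def using b finS by (auto intro!: member_le_sum finite_PiE)
    moreover have "\<gamma> * H u a - ln c + 1 \<le> exp (\<gamma> * H u a - ln c)"
      using exp_ge_add_one_self[of "\<gamma> * H u a - ln c"] by linarith
    moreover have "exp (\<gamma> * H u a - ln c) = exp (\<gamma> * H u a) / c"
      using c by (simp add: exp_diff)
    moreover have "exp (\<gamma> * H u a) / c \<le> Y u / c"
      using calculation(1) c by (intro divide_right_mono) auto
    ultimately show "\<gamma> * H u a \<le> (1 / c) * Y u + (ln c - 1)" by simp
  qed (intro admissible_cmult admissible_add admissible_const Hadm Yadm)+
  also have "\<dots> = (1 / c) * mean (\<lambda>u a. Y u) + (ln c - 1)"
    by (simp only: mean_add[OF admissible_cmult[OF Yadm] admissible_const] mean_cmult[OF Yadm] mean_const)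
  also have "\<dots> \<le> ln c"
    using mult_left_mono[OF mean_Y, of "1 / c"] c by simp
  finally have "\<gamma> * (real M * mean f) \<le> ln c"
    by (simp only: mean_cmult[OF Hadm] mean_H)
  also have "ln c = real (card S) * ln (real q) + real M * (\<gamma> * V + \<gamma>\<^sup>2 / 2) + ln (1 / \<theta>)"
    using N \<theta>_pos q_pos by (simp add: c_def ln_mult ln_div N_def ln_realpow)
  also have "\<dots> = (\<gamma> * real M) *
      (V + (real (card S) * ln (real q) + ln (1 / \<theta>)) / (\<gamma> * real M) + \<gamma> / 2)"
    using \<gamma> M(2) by (simp add: field_simps power2_eq_square)
  finally show ?thesis using \<gamma> M(2) by (simp add: mult.assoc)
qed

text \<open>Once the variables inside \<open>S\<close> are fixed, averaging a predictor over the variables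
  \<open>U\<^sub>T\<close> with \<open>T \<noteq> {1}\<close> leaves a fractional partition.\<close>

lemma integral_shifted_le:
  assumes g: "predictor 1 S g" and S: "S \<subseteq> {r<..k}" and x: "x \<in> space P" and a: "a \<in> Lab"
    and V: "\<And>\<phi>. fractional_partition q \<phi> \<Longrightarrow>
      (\<integral>y. multilin (\<lambda>j m. \<phi> m (y {j})) y \<partial>unif r r) \<le> V"
  shows "(\<integral>v. multilin (\<lambda>j m. shifted g j m (splice (Pow S) x v) a) (low (splice (Pow S) x v)) \<partial>P) \<le> V"
proof -
  \<comment> \<open>The variables inside \<open>S\<close> are frozen at \<open>x\<close>, that of
    vertex 1 is \<open>t\<close>, and all others are fresh.\<close>
  define \<psi> where "\<psi> = (\<lambda>t v. \<lambda>T\<in>I. if T \<subseteq> S then x T else if T = {1} then t else v T)"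
  define \<phi> where "\<phi> = (\<lambda>m t. \<integral>v. g m (\<psi> t v) a \<partial>P)"
  have \<psi>_space: "\<psi> t v \<in> space P" if "t \<in> {0..1}" "v \<in> space P" for t v
    using that P_mem[OF x] P_mem[OF that(2)]
    by (auto simp: \<psi>_def space_PiM space_restrict_space)
  have M01: "space M01 = {0..1}" by (simp add: space_restrict_space)
  have \<psi>_meas: "(\<lambda>z. \<psi> (fst z) (snd z)) \<in> measurable (M01 \<Otimes>\<^sub>M P) P"
    unfolding \<psi>_def
  proof (rule measurable_restrict)
    fix T assume T: "T \<in> I"
    have "x T \<in> space M01" using P_mem[OF x T] by (simp add: M01)
    moreover have "(\<lambda>z. snd z T) \<in> measurable (M01 \<Otimes>\<^sub>M P) M01"
      by (rule measurable_compose[OF measurable_snd measurable_component_singleton[OF T]])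
    ultimately show "(\<lambda>z. if T \<subseteq> S then x T else if T = {1} then fst z else snd z T)
        \<in> measurable (M01 \<Otimes>\<^sub>M P) M01"
      by (cases "T \<subseteq> S"; cases "T = {1}") auto
  qed
  have g\<psi>: "(\<lambda>v. g m (\<psi> t v) a) \<in> borel_measurable P" if "m \<in> {1..q}" "t \<in> {0..1}" for m t
  proof -
    have "(\<lambda>v. \<psi> t v) \<in> measurable P P"
      using measurable_compose[OF measurable_Pair1'[of t M01 P] \<psi>_meas] that(2) by (simp add: M01)
    then show ?thesis by (rule measurable_compose[OF _ predictorD(1)[OF g that(1) a]])
  qed
  have gi: "integrable P (\<lambda>v. g m (\<psi> t v) a)" if "m \<in> {1..q}" "t \<in> {0..1}" for m t
  proof (rule integrable_bounded[OF g\<psi>[OF that]])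
    show "\<bar>g m (\<psi> t v) a\<bar> \<le> 1" if "v \<in> space P" for v
      using predictor_gt_0[OF g \<open>m \<in> {1..q}\<close> \<psi>_space[OF \<open>t \<in> {0..1}\<close> that] a]
        predictor_le_1[OF g \<open>m \<in> {1..q}\<close> \<psi>_space[OF \<open>t \<in> {0..1}\<close> that] a] by simp
  qed
  have frac: "fractional_partition q \<phi>"
    unfolding fractional_partition_def
  proof (intro conjI ballI)
    fix m assume m: "m \<in> {1..q}"
    show "\<phi> m \<in> borel_measurable M01"
      unfolding \<phi>_def using measurable_compose[OF \<psi>_meas predictorD(1)[OF g m a]]
      by (intro P.borel_measurable_lebesgue_integral) (simp add: case_prod_beta)
    fix t :: real assume t: "t \<in> {0..1}"
    have "0 \<le> \<phi> m t"
      unfolding \<phi>_def using predictor_gt_0[OF g m \<psi>_space[OF t] a]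
      by (intro integral_nonneg_AE AE_I2) (auto intro: less_imp_le)
    moreover have "\<phi> m t \<le> 1"
      unfolding \<phi>_def using predictor_le_1[OF g m \<psi>_space[OF t] a]
      by (intro P.integral_le_const gi m t AE_I2)
    ultimately show "\<phi> m t \<in> {0..1}" by simp
  next
    fix t :: real assume t: "t \<in> {0..1}"
    have "(\<Sum>m\<in>{1..q}. \<phi> m t) = (\<integral>v. (\<Sum>m\<in>{1..q}. g m (\<psi> t v) a) \<partial>P)"
      unfolding \<phi>_def using gi t by (intro Bochner_Integration.integral_sum[symmetric])
    also have "\<dots> = (\<integral>v. 1 \<partial>P)"
      using t by (intro Bochner_Integration.integral_cong predictorD(3)[OF g \<psi>_space _] a refl) auto
    finally show "(\<Sum>m\<in>{1..q}. \<phi> m t) = 1" by (simp add: P.prob_space)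
  qed
  let ?X = "splice (Pow S) x"
  define F where "F = (\<lambda>v. multilin (\<lambda>j m. shifted g j m (?X v) a) (low (?X v)))"
  have sh: "(\<lambda>u. shifted g j m u a) \<in> borel_measurable P" if "j \<in> {1..r}" "m \<in> {1..q}" for j m
    using predictorD(1)[OF predictor_shifted[OF g S that(1)] that(2) a] .
  have Fm: "F \<in> borel_measurable P"
    unfolding F_def using measurable_compose[OF measurable_splice_right[OF x] measurable_multilin[OF sh]] by simp
  have F1: "\<bar>F v\<bar> \<le> 1" if "v \<in> space P" for v
    unfolding F_def using that x a S
    by (intro multilin_le low_space splice_space predictor_prob_vec[OF predictor_shifted[OF g]]) auto
  have notS: "\<not> T \<subseteq> S" if "T \<in> D" for T
  proof -
    obtain n where "n \<in> T" using \<open>T \<in> D\<close> by (auto simp: D_eq)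
    moreover have "n \<in> {1..r}" using calculation \<open>T \<in> D\<close> by (auto simp: D_eq)
    ultimately show ?thesis using S by auto
  qed
  have single: "{j} \<in> D" "{j} \<in> I" if "j \<in> {1..r}" for j
    using that D_subset_I by (auto simp: D_eq)
  \<comment> \<open>With the variables of the first block also fixed, the weight is constant and the
    predictions at different vertices are independent, so the integral of the multilinear form is
    the form of the integrals.\<close>
  have inner: "(\<integral>v. F (splice D y v) \<partial>P) = multilin (\<lambda>j m. \<phi> m (low y {j})) (low y)"
    if y: "y \<in> space P" for y
  proof -
    have Xs: "?X (splice D y v) \<in> space P" if "v \<in> space P" for v
      using x y that by (intro splice_space)
    have low: "low (?X (splice D y v)) = low y" for v
      using D_subset_I notS by (auto simp: low_def splice_def fun_eq_iff)
    define h where "h = (\<lambda>j m v. shifted g j m (?X (splice D y v)) a)"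
    have hm: "h j m \<in> borel_measurable P" if "j \<in> {1..r}" "m \<in> {1..q}" for j m
      unfolding h_def using x y
      by (intro measurable_compose[OF measurable_splice_right[OF y] measurable_compose[OF measurable_splice_right[OF x] sh[OF that]]])
    have h1: "\<bar>h j m v\<bar> \<le> 1" if "j \<in> {1..r}" "m \<in> {1..q}" "v \<in> space P" for j m v
      using predictor_gt_0[OF predictor_shifted[OF g S that(1)] that(2) Xs[OF that(3)] a]
        predictor_le_1[OF predictor_shifted[OF g S that(1)] that(2) Xs[OF that(3)] a]
      by (simp add: h_def)
    have h_int: "(\<integral>v. h j m v \<partial>P) = \<phi> m (low y {j})" if j: "j \<in> {1..r}" and m: "m \<in> {1..q}" for j m
    proof -
      let ?\<tau> = "Transposition.transpose 1 j"
      have \<tau>: "?\<tau> permutes {1..k}" by (rule transpose_permutes[OF j])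
      have t: "y {j} \<in> {0..1}" using P_mem[OF y single(2)[OF j]] .
      have "h j m v = g m (\<psi> (y {j}) (act ?\<tau> v)) a" if v: "v \<in> space P" for v
        unfolding h_def shifted_def
      proof (rule local_toD[OF predictorD(2)[OF g m]])
        fix n assume n: "n \<in> S"
        then have "?\<tau> n = n" using S j r_pos by (intro transpose_apply_other) auto
        then show "relabel ?\<tau> a n = a n" using n S by (auto simp: relabel_def)
      next
        fix T assume T: "T \<in> I" "T \<subseteq> insert 1 S"
        have img: "?\<tau> ` T \<in> I" by (rule image_I[OF \<tau> T(1)])
        \<comment> \<open>An index set read at vertex 1 lies inside \<open>S\<close>, or is
          \<open>{1}\<close>, or contains 1 and a point of \<open>S\<close>. Carried to vertex
          \<open>j\<close>, the first kind is frozen at \<open>x\<close>, the second is given by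
          \<open>y\<close>, and the third is fresh because it contains a vertex beyond
          \<open>r\<close>.\<close>
        show "act ?\<tau> (?X (splice D y v)) T = \<psi> (y {j}) (act ?\<tau> v) T"
        proof (cases "T \<subseteq> S")
          case True
          then have "?\<tau> ` T = T"
            using S by (intro transpose_image_fixed[OF _ j]) auto
          then show ?thesis using True T(1) by (simp add: act_def splice_def \<psi>_def)
        next
          case False
          then have 1: "1 \<in> T" using T(2) by auto
          then have "j \<in> ?\<tau> ` T" by (force simp: transpose_def)
          moreover have "j \<notin> S" using j S by auto
          ultimately have notS': "\<not> ?\<tau> ` T \<subseteq> S" by blast
          show ?thesis
          proof (cases "T = {1}")
            case True
            then have "?\<tau> ` T = {j}" by (simp add: transpose_def)
            then show ?thesis
              using True T(1) single[OF j] notS' notS[OF single(1)[OF j]] False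
              by (simp add: act_def splice_def \<psi>_def)
          next
            case False
            then obtain n where n: "n \<in> T" "n \<in> S" using 1 T(2) by auto
            then have "?\<tau> n = n" using S j r_pos by (intro transpose_apply_other) auto
            then have "n \<in> ?\<tau> ` T" using n(1) by (metis image_eqI)
            moreover have "n \<notin> {1..r}" using n(2) S by auto
            ultimately have "\<not> ?\<tau> ` T \<subseteq> {1..r}" by blast
            then have "?\<tau> ` T \<notin> D" by (simp only: D_eq) blast
            then show ?thesis
              using False \<open>\<not> T \<subseteq> S\<close> T(1) img notS' by (simp add: act_def splice_def \<psi>_def)
          qed
        qed
      qed (use Xs[OF v] act_space[OF \<tau>] relabel_mem[OF \<tau> a] \<psi>_space[OF t] v a in auto)
      then have "(\<integral>v. h j m v \<partial>P) = (\<integral>v. g m (\<psi> (y {j}) (act ?\<tau> v)) a \<partial>P)"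
        by (intro Bochner_Integration.integral_cong) auto
      also have "\<dots> = \<phi> m (y {j})"
        unfolding \<phi>_def by (rule integral_act[OF \<tau> g\<psi>[OF m t]])
      finally show ?thesis using single(1)[OF j] by (simp add: low_def)
    qed
    have "(\<integral>v. F (splice D y v) \<partial>P)
        = (\<integral>v. (\<Sum>z\<in>tuples q r. (\<Prod>j\<in>{1..r}. h j (z j) v) * w z (low y)) \<partial>P)"
      unfolding F_def low multilin_def h_def ..
    also have "\<dots> = (\<Sum>z\<in>tuples q r. \<integral>v. (\<Prod>j\<in>{1..r}. h j (z j) v) * w z (low y) \<partial>P)"
    proof (intro Bochner_Integration.integral_sum integrable_mult_left)
      fix z assume z: "z \<in> tuples q r"
      note zj = tuples_mem[OF z]
      show "integrable P (\<lambda>v. \<Prod>j\<in>{1..r}. h j (z j) v)"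
      proof (rule integrable_bounded)
        show "(\<lambda>v. \<Prod>j\<in>{1..r}. h j (z j) v) \<in> borel_measurable P"
          using hm zj by (intro borel_measurable_prod) auto
        show "\<bar>\<Prod>j\<in>{1..r}. h j (z j) v\<bar> \<le> 1" if "v \<in> space P" for v
          unfolding abs_prod using h1[OF _ zj that] by (intro prod_le_1) auto
      qed
    qed
    also have "\<dots> = (\<Sum>z\<in>tuples q r. (\<Prod>j\<in>{1..r}. \<phi> (z j) (low y {j})) * w z (low y))"
    proof (rule sum.cong[OF refl])
      fix z assume z: "z \<in> tuples q r"
      note zj = tuples_mem[OF z]
      \<comment> \<open>Apart from frozen variables, the prediction at \<open>j\<close> reads only
        index sets that contain \<open>j\<close> and otherwise points of \<open>S\<close>. As
        \<open>S\<close> avoids the first block, these families are disjoint for different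
        \<open>j\<close>.\<close>
      define K where "K = (\<lambda>j. {T. j \<in> T \<and> T \<subseteq> insert j S})"
      have "(\<integral>v. (\<Prod>j\<in>{1..r}. h j (z j) v) \<partial>P) = (\<Prod>j\<in>{1..r}. \<integral>v. h j (z j) v \<partial>P)"
      proof (rule integral_prod_disjoint[where K = K and B = 1])
        show "disjoint_family_on K {1..r}"
          unfolding disjoint_family_on_def
        proof (intro ballI impI)
          fix i j assume "i \<in> {1..r}" "j \<in> {1..r}" "i \<noteq> j"
          then show "K i \<inter> K j = {}" using S by (auto simp: K_def)
        qed
        fix j assume j: "j \<in> {1..r}"
        show "depends_on (h j (z j)) (K j)"
          unfolding depends_on_def h_def
        proof (intro ballI impI)
          fix v v' assume v: "v \<in> space P" "v' \<in> space P" and eq: "\<forall>T\<in>I \<inter> K j. v T = v' T"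
          show "shifted g j (z j) (?X (splice D y v)) a = shifted g j (z j) (?X (splice D y v')) a"
          proof (rule local_toD[OF predictorD(2)[OF predictor_shifted[OF g S j] zj[OF j]] Xs[OF v(1)] Xs[OF v(2)] a a])
            fix T assume T: "T \<in> I" "T \<subseteq> insert j S"
            show "?X (splice D y v) T = ?X (splice D y v') T"
            proof (cases "T \<subseteq> S")
              case False
              then have "T \<in> I \<inter> K j" using T by (auto simp: K_def)
              then show ?thesis using eq T(1) by (simp add: splice_def)
            qed (simp add: splice_def)
          qed simp
        qed
      qed (use hm h1 zj in auto)
      then show "(\<integral>v. (\<Prod>j\<in>{1..r}. h j (z j) v) * w z (low y) \<partial>P)
          = (\<Prod>j\<in>{1..r}. \<phi> (z j) (low y {j})) * w z (low y)"
        using h_int zj by simp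
    qed
    finally show ?thesis by (simp only: multilin_def)
  qed
  have "(\<integral>v. F v \<partial>P) = (\<integral>y. (\<integral>v. F (splice D y v) \<partial>P) \<partial>P)"
    by (rule integral_splice(1)[OF Fm F1])
  also have "\<dots> = (\<integral>y. multilin (\<lambda>j m. \<phi> m (low y {j})) (low y) \<partial>P)"
    by (intro Bochner_Integration.integral_cong inner) auto
  also have "\<dots> = (\<integral>y. multilin (\<lambda>j m. \<phi> m (y {j})) y \<partial>unif r r)"
  proof (rule integral_low)
    show "(\<lambda>y. multilin (\<lambda>j m. \<phi> m (y {j})) y) \<in> borel_measurable (unif r r)"
      unfolding multilin_def
    proof (intro borel_measurable_sum borel_measurable_times borel_measurable_prod w_measurable)
      fix z j assume zj: "z \<in> tuples q r" "j \<in> {1..r}"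
      have "\<phi> (z j) \<in> borel_measurable M01"
        using frac tuples_mem[OF zj] by (simp add: fractional_partition_def)
      moreover have "(\<lambda>y. y {j}) \<in> measurable (unif r r) M01"
        unfolding unif_def by (rule measurable_component_singleton[OF single(1)[OF zj(2)]])
      ultimately show "(\<lambda>y. \<phi> (z j) (y {j})) \<in> borel_measurable (unif r r)"
        by (rule measurable_compose[rotated])
    qed
  qed
  also have "\<dots> \<le> V" by (rule V[OF frac])
  finally show ?thesis by (simp only: F_def)
qed

end

section \<open>Tail bounds\<close>

context symmetric_law
begin

text \<open>The conditioning enters here: the bounds on the energy of the labels hold only where the
  density does not vanish.\<close>

lemma mean_mono_support:
  assumes "admissible F" "admissible G"
    and le: "\<And>u a. u \<in> space P \<Longrightarrow> a \<in> Lab \<Longrightarrow> p a u \<noteq> 0 \<Longrightarrow> F u a \<le> G u a"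
  shows "mean F \<le> mean G"
  unfolding mean_eq_sum[OF assms(1)] mean_eq_sum[OF assms(2)]
proof (intro sum_mono integral_mono integrable_mean assms(1,2))
  fix a u assume "a \<in> Lab" "u \<in> space P"
  then show "p a u * F u a \<le> p a u * G u a"
    using le[of u a] p_nonneg[of a u] by (cases "p a u = 0") (auto intro: mult_left_mono)
qed

text \<open>The nearly optimal predictor is found at an unspecified place. A permutation moves its
  vertex to 1 and its set behind the \<open>M\<close> blocks, where the replacement of labels and
  the bound over blocks both apply.\<close>

lemma mean_first_block_le:
  assumes L: "1 \<le> L" "r * M + L * (r - 1) \<le> k" and M: "1 \<le> M"
    and d: "0 < d" "d \<le> 1 / 4" "ln (real q) \<le> d * real L" and \<gamma>: "0 < \<gamma>"
    and V: "\<And>\<phi>. fractional_partition q \<phi> \<Longrightarrow>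
      (\<integral>y. multilin (\<lambda>j m. \<phi> m (y {j})) y \<partial>unif r r) \<le> V"
  shows "mean first_block \<le> V + 3 * real r * sqrt d
    + (real (L * (r - 1)) * ln (real q) + ln (1 / \<theta>)) / (\<gamma> * real M) + \<gamma> / 2"
proof -
  have rM: "r \<le> r * M" using M by simp
  have "L * (r - 1) + 1 \<le> k" using L(2) rM r_pos by linarith
  from exists_nearly_optimal[OF L(1) this d(3)] obtain v S g i where
    i: "i < L" and v: "v \<in> {1..k}" and S: "S \<subseteq> {1..k} - {v}" "card S = i * (r - 1)"
    and g: "predictor v S g"
    and opt: "\<forall>v' S'. v' \<in> {1..k} \<longrightarrow> S' \<subseteq> {1..k} - {v'} \<longrightarrow> card S' = Suc i * (r - 1) \<longrightarrow>
      (\<forall>h. predictor v' S' h \<longrightarrow> loss v g \<le> loss v' h + d)"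
    by (elim exE conjE) (rule that)
  have iL: "i * (r - 1) \<le> L * (r - 1)" using i by (intro mult_le_mono1) simp
  \<comment> \<open>Directly behind the blocks. Room for \<open>L * (r - 1)\<close> vertices is
    reserved since only \<open>i < L\<close> is known about the size.\<close>
  define S0 where "S0 = {r * M<..r * M + i * (r - 1)}"
  have S0: "S0 \<subseteq> {r * M<..k}" "card S0 = i * (r - 1)"
  proof -
    have "r * M + i * (r - 1) \<le> k" using L(2) iL by linarith
    then show "S0 \<subseteq> {r * M<..k}" unfolding S0_def by auto
  qed (simp add: S0_def)
  have S0r: "S0 \<subseteq> {r<..k}"
  proof
    fix n assume "n \<in> S0"
    then have "n \<in> {r * M<..k}" by (rule subsetD[OF S0(1)])
    with le_less_trans[OF rM] show "n \<in> {r<..k}" by simp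
  qed
  have finS: "finite S" using S(1) by (rule finite_subset) simp
  obtain h where h: "bij_betw h S S0"
    using finite_same_card_bij[OF finS, of S0] S(2) S0(2) by (auto simp: S0_def)
  have hS: "h n \<in> S0" if "n \<in> S" for n using h that by (auto simp: bij_betw_def)
  let ?f = "\<lambda>n. if n = v then 1 else h n"
  have inj: "inj_on ?f (insert v S)"
  proof (rule inj_onI)
    fix x y assume xy: "x \<in> insert v S" "y \<in> insert v S" "?f x = ?f y"
    have ne: "h n \<noteq> 1" if "n \<in> S" for n
      using subsetD[OF S0r hS[OF that]] r_pos by auto
    consider "x = v" "y = v" | "x = v" "y \<in> S" "y \<noteq> v" | "x \<in> S" "x \<noteq> v" "y = v"
      | "x \<in> S" "y \<in> S" "x \<noteq> v" "y \<noteq> v"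
      using xy(1,2) by auto
    then show "x = y"
    proof cases
      case 4
      then have "h x = h y" using xy(3) by simp
      then show ?thesis using 4 bij_betw_imp_inj_on[OF h] by (simp only: inj_on_eq_iff)
    qed (use xy(3) ne in auto)
  qed
  have img: "?f ` insert v S \<subseteq> {1..k}"
  proof
    fix y assume "y \<in> ?f ` insert v S"
    then obtain x where x: "x \<in> insert v S" "y = ?f x" by blast
    show "y \<in> {1..k}"
    proof (cases "x = v")
      case False
      then have "y \<in> {r<..k}" using x subsetD[OF S0r hS] by auto
      then show ?thesis by auto
    qed (use x r_pos r_le_k in auto)
  qed
  have "insert v S \<subseteq> {1..k}" using S(1) v by auto
  from extend_to_permutation[OF finite_atLeastAtMost this img inj]
  obtain \<sigma> where \<sigma>: "\<sigma> permutes {1..k}" and \<sigma>f: "\<And>n. n \<in> insert v S \<Longrightarrow> \<sigma> n = ?f n"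
    by metis
  have \<sigma>v: "\<sigma> v = 1" using \<sigma>f by simp
  have "\<sigma> ` S = h ` S" using S(1) \<sigma>f by (intro image_cong) auto
  then have \<sigma>S: "\<sigma> ` S = S0" using h by (simp add: bij_betw_def)
  define g' where "g' = (\<lambda>m u a. g m (act \<sigma> u) (relabel \<sigma> a))"
  have g': "predictor 1 S0 g'"
    using predictor_act[OF g \<sigma> v] S(1) unfolding \<sigma>v \<sigma>S g'_def by auto
  have loss: "loss 1 g' = loss v g"
    using loss_act[OF g \<sigma> v] unfolding \<sigma>v g'_def .
  \<comment> \<open>Adding \<open>{2..r}\<close> raises the cardinality from
    \<open>i * (r - 1)\<close> to \<open>Suc i * (r - 1)\<close>, exactly the size against which
    optimality was obtained.\<close>
  have "nearly_optimal 1 (S0 \<union> {2..r}) d g'"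
    unfolding nearly_optimal_def loss
  proof (intro allI impI)
    fix h assume h: "predictor 1 (S0 \<union> {2..r}) h"
    show "loss v g \<le> loss 1 h + d"
    proof (rule opt[rule_format, OF _ _ _ h])
      have "card (S0 \<union> {2..r}) = card S0 + card {2..r}"
        using S0r by (intro card_Un_disjoint) (auto simp: S0_def)
      then show "card (S0 \<union> {2..r}) = Suc i * (r - 1)" by (simp add: S0(2))
      show "S0 \<union> {2..r} \<subseteq> {1..k} - {1}" using S0r r_pos r_le_k by auto
      show "1 \<in> {1..k}" using r_pos r_le_k by auto
    qed
  qed
  note 1 = replace_block[OF g' S0r this d(1,2)]
  let ?F = "\<lambda>u a. multilin (\<lambda>j m. shifted g' j m u a) (low u)"
  note pred = predictor_shifted[OF g' S0r]
  have F1: "\<bar>?F u a\<bar> \<le> 1" if "u \<in> space P" "a \<in> Lab" for u a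
    by (rule multilin_le[OF predictor_prob_vec[OF pred that] low_space[OF that(1)]])
  have "mean ?F \<le> V + (real (card S0) * ln (real q) + ln (1 / \<theta>)) / (\<gamma> * real M) + \<gamma> / 2"
  proof (rule mean_block_le[OF _ F1 _ S0(1) _ M \<gamma>])
    show "admissible ?F"
      by (rule admissibleI[OF measurable_multilin[OF predictorD(1)[OF pred]] F1])
    show "r * M \<le> k" using L(2) by simp
    show "local_to (S0 \<union> {1..r}) S0 ?F"
    proof (rule local_toI)
      fix u u' a a' assume *: "u \<in> space P" "u' \<in> space P" "a \<in> Lab" "a' \<in> Lab"
        "\<And>T. T \<in> I \<Longrightarrow> T \<subseteq> S0 \<union> {1..r} \<Longrightarrow> u T = u' T" "\<And>n. n \<in> S0 \<Longrightarrow> a n = a' n"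
      have low: "low u = low u'" by (rule low_cong, rule *(5)) auto
      show "?F u a = ?F u' a'"
        unfolding low
      proof (rule multilin_cong)
        fix j m assume j: "j \<in> {1..r}" and m: "m \<in> {1..q}"
        show "shifted g' j m u a = shifted g' j m u' a'"
          using j by (intro local_toD[OF predictorD(2)[OF pred[OF j] m] *(1-4)] *(5,6)) auto
      qed
    qed
    show "(\<integral>v. ?F (splice (Pow S0) w v) a \<partial>P) \<le> V" if "w \<in> space P" "a \<in> Lab" for w a
      by (rule integral_shifted_le[OF g' S0r that V])
  qed
  also have "\<dots> \<le> V + (real (L * (r - 1)) * ln (real q) + ln (1 / \<theta>)) / (\<gamma> * real M) + \<gamma> / 2"
  proof -
    have "real (card S0) * ln (real q) \<le> real (L * (r - 1)) * ln (real q)"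
      unfolding S0(2) using iL q_pos by (intro mult_right_mono) (simp_all only: of_nat_le_iff, simp)
    then show ?thesis using \<gamma> by (intro add_mono divide_right_mono) auto
  qed
  finally show ?thesis using 1 by linarith
qed

end

section \<open>The two tails of the sampled energy\<close>

context sampling
begin

text \<open>Permuting variables and labels together merely reorders the tuples of the sum; hence the
  conditioning events and the densities built from it are exchangeable.\<close>

lemma label_energy_act:
  assumes \<sigma>: "\<sigma> permutes {1..k}"
  shows "label_energy (relabel \<sigma> a) (act \<sigma> u) = label_energy a u"
proof -
  define \<rho> :: "(nat \<Rightarrow> nat) \<Rightarrow> (nat \<Rightarrow> nat) \<Rightarrow> nat \<Rightarrow> nat"
    where "\<rho> = (\<lambda>\<sigma> n. \<lambda>j\<in>{1..r}. \<sigma> (n j))"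
  have mem: "\<rho> \<sigma> n \<in> tuples k r" if "\<sigma> permutes {1..k}" "n \<in> tuples k r" for \<sigma> n
    unfolding tuples_def \<rho>_def restrict_PiE_iff
    using permutes_in_image[OF that(1)] tuples_mem[OF that(2)] by blast
  have inv: "\<rho> \<sigma> (\<rho> \<tau> n) = n" if "\<And>x. \<sigma> (\<tau> x) = x" "n \<in> tuples k r" for \<sigma> \<tau> n
    using that by (auto simp: \<rho>_def tuples_def PiE_def extensional_def fun_eq_iff)
  have bij: "bij_betw (\<rho> \<sigma>) (tuples k r) (tuples k r)"
    using mem[OF \<sigma>] mem[OF permutes_inv[OF \<sigma>]] inv permutes_inverses[OF \<sigma>]
    by (intro bij_betwI[where g = "\<rho> (inv \<sigma>)"]) auto
  have "(\<Sum>n\<in>tuples k r. w (\<lambda>j\<in>{1..r}. a (n j)) (\<lambda>A\<in>D. u (n ` A)))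
      = (\<Sum>n\<in>tuples k r. w (\<lambda>j\<in>{1..r}. a (\<rho> \<sigma> n j)) (\<lambda>A\<in>D. u (\<rho> \<sigma> n ` A)))"
    by (rule sum.reindex_bij_betw[OF bij, symmetric])
  also have "\<dots> = (\<Sum>n\<in>tuples k r. w (\<lambda>j\<in>{1..r}. relabel \<sigma> a (n j)) (\<lambda>A\<in>D. act \<sigma> u (n ` A)))"
  proof (rule sum.cong[OF refl])
    fix n assume n: "n \<in> tuples k r"
    have "(\<lambda>j\<in>{1..r}. a (\<rho> \<sigma> n j)) = (\<lambda>j\<in>{1..r}. relabel \<sigma> a (n j))"
      using tuples_mem[OF n] by (intro restrict_ext) (simp add: \<rho>_def relabel_def)
    moreover have "(\<lambda>A\<in>D. u (\<rho> \<sigma> n ` A)) = (\<lambda>A\<in>D. act \<sigma> u (n ` A))"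
    proof (rule restrict_ext)
      fix A assume A: "A \<in> D"
      then have "\<rho> \<sigma> n ` A = \<sigma> ` n ` A" by (auto simp: \<rho>_def D_eq image_image intro!: image_cong)
      then show "u (\<rho> \<sigma> n ` A) = act \<sigma> u (n ` A)"
        using tuple_image[OF n A] by (simp add: act_def)
    qed
    ultimately show "w (\<lambda>j\<in>{1..r}. a (\<rho> \<sigma> n j)) (\<lambda>A\<in>D. u (\<rho> \<sigma> n ` A))
        = w (\<lambda>j\<in>{1..r}. relabel \<sigma> a (n j)) (\<lambda>A\<in>D. act \<sigma> u (n ` A))" by simp
  qed
  finally show ?thesis by (simp add: label_energy_def)
qed

lemma measurable_exceeds: "{u \<in> space P. \<exists>a\<in>Lab. t < label_energy a u} \<in> sets P"
proof -
  have "{u \<in> space P. \<exists>a\<in>Lab. t < label_energy a u} = (\<Union>a\<in>Lab. {u \<in> space P. t < label_energy a u})" by auto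
  also have "\<dots> \<in> sets P"
    using measurable_label_energy by (intro sets.finite_UN) (auto intro: borel_measurable_less borel_measurable_const)
  finally show ?thesis .
qed

text \<open>Under the conditioned law the mean energy is at least \<open>V + e\<close>, which
  contradicts the bound through the first block. Choosing uniformly among all labels of too large
  energy, instead of picking a maximiser, keeps the law symmetric without breaking ties.\<close>

lemma upper_tail:
  assumes L: "1 \<le> L" "r * M + L * (r - 1) \<le> k" and M: "1 \<le> M"
    and d: "0 < d" "d \<le> 1 / 4" "ln (real q) \<le> d * real L" and \<gamma>: "0 < \<gamma>" and \<theta>: "0 < \<theta>"
    and V: "\<And>\<phi>. fractional_partition q \<phi> \<Longrightarrow>
      (\<integral>y. multilin (\<lambda>j m. \<phi> m (y {j})) y \<partial>unif r r) \<le> V"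
    and e: "3 * real r * sqrt d + (real (L * (r - 1)) * ln (real q) + ln (1 / \<theta>)) / (\<gamma> * real M) + \<gamma> / 2
      + 2 * real (r * r) / real k < e"
  shows "measure P {u \<in> space P. \<exists>a\<in>Lab. V + e < label_energy a u} < \<theta>"
proof (rule ccontr)
  let ?Q = "{u \<in> space P. \<exists>a\<in>Lab. V + e < label_energy a u}"
  \<comment> \<open>The exact probability of the event normalises the density; \<theta> is a lower
    bound for it and returns only in the final estimate of the logarithm.\<close>
  define \<theta>' where "\<theta>' = measure P ?Q"
  assume "\<not> measure P ?Q < \<theta>"
  then have \<theta>': "\<theta> \<le> \<theta>'" "0 < \<theta>'" using \<theta> by (auto simp: \<theta>'_def)
  define N where "N = (\<lambda>u. \<Sum>a\<in>Lab. if V + e < label_energy a u then 1 else (0::real))"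
  \<comment> \<open>Off the event the count \<open>N u\<close> is 0, and division by zero makes the
    density vanish there, as it should.\<close>
  define p where "p = (\<lambda>a u. (if V + e < label_energy a u then 1 else 0) / (N u * \<theta>'))"
  note [measurable] = measurable_label_energy
  have Nm [measurable]: "N \<in> borel_measurable P" unfolding N_def by measurable
  have N_eq0: "N u = 0 \<longleftrightarrow> \<not> (\<exists>a\<in>Lab. V + e < label_energy a u)" for u
    unfolding N_def by (subst sum_nonneg_eq_0_iff) auto
  have N_nonneg: "0 \<le> N u" for u unfolding N_def by (intro sum_nonneg) simp
  have p_sum: "(\<Sum>a\<in>Lab. p a u) = indicator ?Q u / \<theta>'" if "u \<in> space P" for u
  proof -
    have "(\<Sum>a\<in>Lab. p a u) = N u / (N u * \<theta>')"
      unfolding p_def sum_divide_distrib[symmetric] by (simp add: N_def)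
    then show ?thesis using N_eq0[of u] that by (cases "N u = 0") (auto simp: indicator_def)
  qed
  interpret symmetric_law k r q w p \<theta>'
  proof unfold_locales
    show "p a \<in> borel_measurable P" if "a \<in> Lab" for a
      unfolding p_def using that by measurable
    show "0 \<le> p a u" for a u using N_nonneg[of u] \<theta>'(2) by (simp add: p_def)
    show "0 < \<theta>'" by fact
    show "(\<Sum>a\<in>Lab. p a u) \<le> 1 / \<theta>'" if "u \<in> space P" for u
      using \<theta>'(2) by (simp add: p_sum[OF that] indicator_def)
    have "(\<integral>u. (\<Sum>a\<in>Lab. p a u) \<partial>P) = (\<integral>u. indicator ?Q u / \<theta>' \<partial>P)"
      by (intro Bochner_Integration.integral_cong p_sum) auto
    also have "\<dots> = 1" using \<theta>'(2) measurable_exceeds by (simp add: \<theta>'_def)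
    finally show "(\<integral>u. (\<Sum>a\<in>Lab. p a u) \<partial>P) = 1" .
    fix \<sigma> a u assume \<sigma>: "\<sigma> permutes {1..k}"
    have "N (act \<sigma> u) = (\<Sum>a\<in>Lab. if V + e < label_energy (relabel \<sigma> a) (act \<sigma> u) then 1 else 0)"
      unfolding N_def by (rule sum.reindex_bij_betw[OF bij_relabel[OF \<sigma>], symmetric])
    then have "N (act \<sigma> u) = N u" by (simp add: label_energy_act[OF \<sigma>] N_def)
    then show "p (relabel \<sigma> a) (act \<sigma> u) = p a u"
      by (simp add: p_def label_energy_act[OF \<sigma>])
  qed
  have "mean (\<lambda>u a. V + e) \<le> mean (\<lambda>u a. label_energy a u)"
    by (rule mean_mono_support[OF admissible_const admissible_label_energy]) (auto simp: p_def split: if_splits)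
  then have "V + e \<le> mean (\<lambda>u a. label_energy a u)" by (simp add: mean_const)
  also have "\<dots> \<le> mean first_block + 2 * real (r * r) / real k"
    using mean_label_energy_first_block by (simp add: abs_le_iff)
  also have "mean first_block \<le> V + 3 * real r * sqrt d
      + (real (L * (r - 1)) * ln (real q) + ln (1 / \<theta>')) / (\<gamma> * real M) + \<gamma> / 2"
    by (rule mean_first_block_le[OF L M d \<gamma> V])
  also have "\<dots> \<le> V + 3 * real r * sqrt d
      + (real (L * (r - 1)) * ln (real q) + ln (1 / \<theta>)) / (\<gamma> * real M) + \<gamma> / 2"
    using \<theta> \<theta>' \<gamma> by (intro add_mono divide_right_mono) (auto simp: ln_div)
  finally show False using e by linarith
qed

text \<open>The event says that no labels at all reach the threshold, so random ones do not reach it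
  either. Drawing them independently from \<open>\<phi>\<close> treats all vertices alike, so the
  law is exchangeable. Integrating the labels out leaves a function of the variables of the first
  block, and the block bound for its negative bounds it from below.\<close>

lemma lower_tail:
  assumes M: "r * M \<le> k" "1 \<le> M" and \<gamma>: "0 < \<gamma>" and \<theta>: "0 < \<theta>" and \<phi>: "fractional_partition q \<phi>"
    and e: "ln (1 / \<theta>) / (\<gamma> * real M) + \<gamma> / 2 + 2 * real (r * r) / real k < e"
  shows "measure P {u \<in> space P. \<not> (\<exists>a\<in>Lab.
      (\<integral>y. multilin (\<lambda>j m. \<phi> m (y {j})) y \<partial>unif r r) - e < label_energy a u)} < \<theta>"
proof (rule ccontr)
  define V where "V = (\<integral>y. multilin (\<lambda>j m. \<phi> m (y {j})) y \<partial>unif r r)"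
  let ?Q = "{u \<in> space P. \<not> (\<exists>a\<in>Lab. V - e < label_energy a u)}"
  have Q: "?Q \<in> sets P"
  proof -
    have "?Q = space P - {u \<in> space P. \<exists>a\<in>Lab. V - e < label_energy a u}" by auto
    then show ?thesis using measurable_exceeds[of "V - e"] by auto
  qed
  define \<theta>' where "\<theta>' = measure P ?Q"
  assume "\<not> measure P {u \<in> space P. \<not> (\<exists>a\<in>Lab.
      (\<integral>y. multilin (\<lambda>j m. \<phi> m (y {j})) y \<partial>unif r r) - e < label_energy a u)} < \<theta>"
  then have \<theta>': "\<theta> \<le> \<theta>'" "0 < \<theta>'" using \<theta> by (auto simp: \<theta>'_def V_def)
  have single: "{n} \<in> I" if "n \<in> {1..k}" for n
    using that r_pos by (auto simp: subsets_upto_def)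
  have single_D: "{j} \<in> D" if "j \<in> {1..r}" for j
    using that by (auto simp: D_eq)
  have \<phi>m: "\<phi> m \<in> borel_measurable M01" if "m \<in> {1..q}" for m
    using \<phi> that by (simp add: fractional_partition_def)
  have \<phi>pv: "prob_vec q (\<lambda>m. \<phi> m t)" if "t \<in> {0..1}" for t
    using \<phi> that by (auto simp: fractional_partition_def prob_vec_def)
  have \<phi>u: "(\<lambda>u. \<phi> m (u {n})) \<in> borel_measurable P" if "m \<in> {1..q}" "n \<in> {1..k}" for m n
    by (rule measurable_compose[OF measurable_component_singleton[OF single[OF that(2)]] \<phi>m[OF that(1)]])
  \<comment> \<open>The probability of the label array \<open>a\<close> given the variables of the
    single vertices.\<close>
  define R where "R = (\<lambda>a u. \<Prod>n\<in>{1..k}. \<phi> (a n) (u {n}))"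
  define p where "p = (\<lambda>a u. indicator ?Q u * R a u / \<theta>')"
  have pvu: "prob_vec q (\<lambda>m. \<phi> m (u {n}))" if "u \<in> space P" "n \<in> {1..k}" for u n
    by (rule \<phi>pv[OF P_mem[OF that(1) single[OF that(2)]]])
  have R_marginal: "(\<Sum>a\<in>Lab. R a u * (\<Prod>n\<in>{1..k}. c n (a n))) = (\<Prod>n\<in>{1..k}. \<Sum>m\<in>{1..q}. \<phi> m (u {n}) * c n m)"
    for u and c :: "nat \<Rightarrow> nat \<Rightarrow> real"
    unfolding R_def prod.distrib[symmetric] tuples_def by (rule prod_sum_PiE[symmetric]) auto
  have R_sum: "(\<Sum>a\<in>Lab. R a u) = 1" if u: "u \<in> space P" for u
  proof -
    have "(\<Sum>a\<in>Lab. R a u) = (\<Prod>n\<in>{1..k}. \<Sum>m\<in>{1..q}. \<phi> m (u {n}))"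
      using R_marginal[of u "\<lambda>_ _. 1"] by simp
    also have "\<dots> = 1" using pvu[OF u] by (intro prod.neutral) (simp add: prob_vec_def)
    finally show ?thesis .
  qed
  have R_nonneg: "0 \<le> R a u" if "a \<in> Lab" "u \<in> space P" for a u
    unfolding R_def using pvu[OF that(2)] tuples_mem[OF that(1)]
    by (intro prod_nonneg) (auto simp: prob_vec_def)
  have R_act: "R (relabel \<sigma> a) (act \<sigma> u) = R a u" if \<sigma>: "\<sigma> permutes {1..k}" for \<sigma> a u
  proof -
    have "R (relabel \<sigma> a) (act \<sigma> u) = (\<Prod>n\<in>{1..k}. \<phi> (a (\<sigma> n)) (u {\<sigma> n}))"
      unfolding R_def by (intro prod.cong refl) (simp add: relabel_def act_def single)
    also have "\<dots> = R a u"
      unfolding R_def by (rule prod.reindex_bij_betw[OF permutes_imp_bij[OF \<sigma>]])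
    finally show ?thesis .
  qed
  interpret symmetric_law k r q w p \<theta>'
  proof unfold_locales
    show "p a \<in> borel_measurable P" if "a \<in> Lab" for a
      unfolding p_def R_def using Q \<phi>u tuples_mem[OF that]
      by (intro borel_measurable_divide borel_measurable_times borel_measurable_indicator
          borel_measurable_prod borel_measurable_const) auto
    show "0 \<le> p a u" if "a \<in> Lab" "u \<in> space P" for a u
      using R_nonneg[OF that] \<theta>'(2) by (simp add: p_def)
    show "0 < \<theta>'" by fact
    have p_sum: "(\<Sum>a\<in>Lab. p a u) = indicator ?Q u / \<theta>'" if "u \<in> space P" for u
      unfolding p_def sum_divide_distrib[symmetric] sum_distrib_left[symmetric] by (simp add: R_sum[OF that])
    show "(\<Sum>a\<in>Lab. p a u) \<le> 1 / \<theta>'" if "u \<in> space P" for u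
      unfolding p_sum[OF that] using \<theta>'(2) by (simp add: indicator_def)
    have "(\<integral>u. (\<Sum>a\<in>Lab. p a u) \<partial>P) = (\<integral>u. indicator ?Q u / \<theta>' \<partial>P)"
      by (intro Bochner_Integration.integral_cong p_sum) auto
    also have "\<dots> = 1" using \<theta>'(2) Q by (simp add: \<theta>'_def)
    finally show "(\<integral>u. (\<Sum>a\<in>Lab. p a u) \<partial>P) = 1" .
    fix \<sigma> a u assume \<sigma>: "\<sigma> permutes {1..k}" and u: "u \<in> space P"
    have "(\<exists>a\<in>Lab. V - e < label_energy a (act \<sigma> u)) \<longleftrightarrow> (\<exists>a\<in>Lab. V - e < label_energy (relabel \<sigma> a) (act \<sigma> u))"
      using relabel_mem[OF \<sigma>] relabel_mem[OF permutes_inv[OF \<sigma>]] relabel_inv(1)[OF \<sigma>] by metis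
    then have "act \<sigma> u \<in> ?Q \<longleftrightarrow> u \<in> ?Q"
      using u act_space[OF \<sigma> u] unfolding label_energy_act[OF \<sigma>] by blast
    then show "p (relabel \<sigma> a) (act \<sigma> u) = p a u"
      by (simp add: p_def R_act[OF \<sigma>] indicator_def)
  qed
  have "mean (\<lambda>u a. label_energy a u) \<le> mean (\<lambda>u a. V - e)"
    by (rule mean_mono_support[OF admissible_label_energy admissible_const])
      (auto simp: p_def indicator_def not_less split: if_splits)
  then have "mean (\<lambda>u a. label_energy a u) \<le> V - e" by (simp add: mean_const)
  then have 1: "mean first_block - 2 * real (r * r) / real k \<le> V - e"
    using mean_label_energy_first_block by (simp add: abs_le_iff)
  define f where "f = (\<lambda>u. multilin (\<lambda>j m. \<phi> m (low u {j})) (low u))"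
  have kr: "{1..r} \<subseteq> {1..k}" using r_le_k by auto
  have f_unif: "(\<lambda>y. multilin (\<lambda>j m. \<phi> m (y {j})) y) \<in> borel_measurable (unif r r)"
    unfolding multilin_def
  proof (intro borel_measurable_sum borel_measurable_times borel_measurable_prod w_measurable)
    fix z j assume zj: "z \<in> tuples q r" "j \<in> {1..r}"
    have "(\<lambda>y. y {j}) \<in> measurable (unif r r) M01"
      unfolding unif_def by (rule measurable_component_singleton[OF single_D[OF zj(2)]])
    then show "(\<lambda>y. \<phi> (z j) (y {j})) \<in> borel_measurable (unif r r)"
      by (rule measurable_compose[OF _ \<phi>m[OF tuples_mem[OF zj]]])
  qed
  have fm: "f \<in> borel_measurable P"
    unfolding f_def by (rule measurable_compose[OF measurable_low f_unif])
  have lowj: "low u {j} = u {j}" if "j \<in> {1..r}" for u j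
    using single_D[OF that] by (simp add: low_def)
  have f1: "\<bar>f u\<bar> \<le> 1" if u: "u \<in> space P" for u
    unfolding f_def using pvu[OF u] kr by (intro multilin_le low_space u) (auto simp: lowj)
  have 2: "mean first_block = mean (\<lambda>u a. f u)"
    unfolding mean_def
  proof (rule Bochner_Integration.integral_cong[OF refl])
    fix u assume u: "u \<in> space P"
    have z: "(\<Sum>a\<in>Lab. R a u * (\<Prod>j\<in>{1..r}. vertex (a j) (z j))) = (\<Prod>j\<in>{1..r}. \<phi> (z j) (u {j}))"
      if z: "z \<in> tuples q r" for z
    proof -
      \<comment> \<open>The factor 1 outside the first block makes the test function a product over
        all vertices, so that the sum over the labels factorises.\<close>
      let ?c = "\<lambda>n m. if n \<in> {1..r} then vertex m (z n) else 1"
      have split: "(\<Prod>n\<in>{1..k}. if n \<in> {1..r} then h n else 1) = (\<Prod>n\<in>{1..r}. h n)" for h :: "nat \<Rightarrow> real"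
        using kr by (intro prod.mono_neutral_cong_right) auto
      have "(\<Sum>a\<in>Lab. R a u * (\<Prod>j\<in>{1..r}. vertex (a j) (z j)))
          = (\<Sum>a\<in>Lab. R a u * (\<Prod>n\<in>{1..k}. ?c n (a n)))"
        by (simp only: split)
      also have "\<dots> = (\<Prod>n\<in>{1..k}. \<Sum>m\<in>{1..q}. \<phi> m (u {n}) * ?c n m)"
        by (rule R_marginal)
      also have "\<dots> = (\<Prod>n\<in>{1..k}. if n \<in> {1..r} then \<phi> (z n) (u {n}) else 1)"
      proof (rule prod.cong[OF refl])
        fix n assume n: "n \<in> {1..k}"
        show "(\<Sum>m\<in>{1..q}. \<phi> m (u {n}) * ?c n m) = (if n \<in> {1..r} then \<phi> (z n) (u {n}) else 1)"
        proof (cases "n \<in> {1..r}")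
          case True
          have "(\<Sum>m\<in>{1..q}. \<phi> m (u {n}) * vertex m (z n)) = (\<Sum>m\<in>{1..q}. if m = z n then \<phi> m (u {n}) else 0)"
            by (intro sum.cong) (auto simp: vertex_def)
          also have "\<dots> = \<phi> (z n) (u {n})" using tuples_mem[OF z True] by simp
          finally show ?thesis by (simp only: True if_True)
        next
          case False
          show ?thesis
            using pvu[OF u n] by (simp only: False if_False mult_1_right prob_vec_def)
        qed
      qed
      also have "\<dots> = (\<Prod>j\<in>{1..r}. \<phi> (z j) (u {j}))" by (rule split)
      finally show ?thesis .
    qed
    have "(\<Sum>a\<in>Lab. R a u * first_block u a)
        = (\<Sum>z\<in>tuples q r. (\<Sum>a\<in>Lab. R a u * (\<Prod>j\<in>{1..r}. vertex (a j) (z j))) * w z (low u))"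
      unfolding first_block_def multilin_def sum_distrib_left sum_distrib_right mult.assoc[symmetric]
      by (rule sum.swap)
    also have "\<dots> = f u"
      unfolding f_def multilin_def
    proof (rule sum.cong[OF refl])
      fix z' assume z': "z' \<in> tuples q r"
      have "(\<Prod>j\<in>{1..r}. \<phi> (z' j) (low u {j})) = (\<Prod>j\<in>{1..r}. \<phi> (z' j) (u {j}))"
        by (intro prod.cong refl) (simp only: lowj)
      then show "(\<Sum>a\<in>Lab. R a u * (\<Prod>j\<in>{1..r}. vertex (a j) (z' j))) * w z' (low u)
          = (\<Prod>j\<in>{1..r}. \<phi> (z' j) (low u {j})) * w z' (low u)"
        by (simp only: z[OF z'])
    qed
    finally have eq: "(\<Sum>a\<in>Lab. R a u * first_block u a) = f u" .
    have "(\<Sum>a\<in>Lab. p a u * first_block u a) = indicator ?Q u / \<theta>' * (\<Sum>a\<in>Lab. R a u * first_block u a)"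
      unfolding p_def sum_distrib_left by (intro sum.cong) auto
    also have "\<dots> = indicator ?Q u / \<theta>' * ((\<Sum>a\<in>Lab. R a u) * f u)"
      by (simp only: eq R_sum[OF u] mult_1)
    also have "\<dots> = (\<Sum>a\<in>Lab. p a u * f u)"
      unfolding p_def sum_distrib_left sum_distrib_right by (intro sum.cong) auto
    finally show "(\<Sum>a\<in>Lab. p a u * first_block u a) = (\<Sum>a\<in>Lab. p a u * f u)" .
  qed
  have fadm: "admissible (\<lambda>u a. f u)" using fm f1 by (intro admissibleI[where B = 1])
  \<comment> \<open>With empty \<open>S\<close> there is no union over labels, and since no index
    set is empty nothing is frozen.\<close>
  have "mean (\<lambda>u a. (- 1) * f u) \<le> - V + (real (card ({} :: nat set)) * ln (real q) + ln (1 / \<theta>')) / (\<gamma> * real M) + \<gamma> / 2"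
  proof (rule mean_block_le[OF admissible_cmult[OF fadm] _ _ _ M \<gamma>])
    show "local_to ({} \<union> {1..r}) {} (\<lambda>u a. (- 1) * f u)"
    proof (rule local_toI)
      fix u u' :: "nat set \<Rightarrow> real" assume "\<And>T. T \<in> I \<Longrightarrow> T \<subseteq> {} \<union> {1..r} \<Longrightarrow> u T = u' T"
      then have "low u = low u'" by (intro low_cong) auto
      then show "(- 1) * f u = (- 1) * f u'" by (simp add: f_def)
    qed
    fix x a assume x: "x \<in> space P"
    have "splice (Pow {}) x v = v" if v: "v \<in> space P" for v
    proof (rule ext)
      fix T
      have "T \<noteq> {}" if "T \<in> I" using that by (simp add: subsets_upto_def)
      moreover have "v T = undefined" if "T \<notin> I"
        using v that unfolding space_PiM by (rule PiE_arb)
      ultimately show "splice (Pow {}) x v T = v T" by (simp add: splice_def)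
    qed
    then have "(\<integral>v. (- 1) * f (splice (Pow {}) x v) \<partial>P) = (\<integral>v. (- 1) * f v \<partial>P)"
      by (intro Bochner_Integration.integral_cong) auto
    also have "\<dots> = - V"
      unfolding V_def f_def using integral_low[OF f_unif] by simp
    finally show "(\<integral>v. (- 1) * f (splice (Pow {}) x v) \<partial>P) \<le> - V" by simp
  qed (use f1 in auto)
  then have "- mean first_block \<le> - V + ln (1 / \<theta>') / (\<gamma> * real M) + \<gamma> / 2"
    unfolding 2 mean_cmult[OF fadm] by simp
  also have "\<dots> \<le> - V + ln (1 / \<theta>) / (\<gamma> * real M) + \<gamma> / 2"
    using \<theta> \<theta>' \<gamma> by (intro add_mono divide_right_mono) (auto simp: ln_div)
  finally show False using 1 e by linarith
qed

end

section \<open>Parameters and conclusion\<close>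

text \<open>A row of zeros and ones with sum 1 has exactly one entry 1; its position is the
  label.\<close>

lemma integer_partitions_eq:
  "integer_partitions k q = (\<lambda>a. \<lambda>n\<in>{1..k}. \<lambda>m\<in>{1..q}. vertex (a n) m) ` tuples q k"
proof (intro equalityI subsetI)
  fix x assume x: "x \<in> integer_partitions k q"
  then have mem: "x \<in> {1..k} \<rightarrow>\<^sub>E ({1..q} \<rightarrow>\<^sub>E {0, 1})"
    and "\<forall>n\<in>{1..k}. (\<Sum>m\<in>{1..q}. x n m) = 1"
    by (simp_all add: integer_partitions_def)
  then have sum: "(\<Sum>m\<in>{1..q}. x n m) = 1" if "n \<in> {1..k}" for n
    using that by blast
  have xm: "x n m = 0 \<or> x n m = 1" if "n \<in> {1..k}" "m \<in> {1..q}" for n m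
    using PiE_mem[OF PiE_mem[OF mem that(1)] that(2)] that by auto
  have "\<exists>m\<in>{1..q}. x n m = 1 \<and> (\<forall>m'\<in>{1..q}. x n m' = vertex m m')" if n: "n \<in> {1..k}" for n
  proof -
    have "\<exists>m\<in>{1..q}. x n m \<noteq> 0"
    proof (rule ccontr)
      assume "\<not> (\<exists>m\<in>{1..q}. x n m \<noteq> 0)"
      then have "(\<Sum>m\<in>{1..q}. x n m) = 0" by (intro sum.neutral) blast
      then show False using sum[OF n] by simp
    qed
    then obtain m where m: "m \<in> {1..q}" "x n m = 1" using xm[OF n] by blast
    have "(\<Sum>m'\<in>{1..q}-{m}. x n m') = 0"
      using sum[OF n] m sum.remove[of "{1..q}" m "x n"] by simp
    moreover have "\<forall>m'\<in>{1..q}-{m}. 0 \<le> x n m'" using xm[OF n] by fastforce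
    ultimately have "\<forall>m'\<in>{1..q}-{m}. x n m' = 0"
      by (subst (asm) sum_nonneg_eq_0_iff) auto
    then show ?thesis using m by (intro bexI[of _ m]) (auto simp: vertex_def)
  qed
  then obtain a0 where a0: "\<And>n. n \<in> {1..k} \<Longrightarrow> a0 n \<in> {1..q} \<and> (\<forall>m'\<in>{1..q}. x n m' = vertex (a0 n) m')"
    by metis
  have "x = (\<lambda>n\<in>{1..k}. \<lambda>m\<in>{1..q}. vertex (restrict a0 {1..k} n) m)"
  proof (rule PiE_ext[OF mem])
    show "(\<lambda>n\<in>{1..k}. \<lambda>m\<in>{1..q}. vertex (restrict a0 {1..k} n) m) \<in> {1..k} \<rightarrow>\<^sub>E ({1..q} \<rightarrow>\<^sub>E {0, 1})"
      by (auto simp: vertex_def)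
    fix n assume n: "n \<in> {1..k}"
    show "x n = (\<lambda>n\<in>{1..k}. \<lambda>m\<in>{1..q}. vertex (restrict a0 {1..k} n) m) n"
      using a0[OF n] n PiE_arb[OF PiE_mem[OF mem n]] by (auto simp: fun_eq_iff)
  qed
  moreover have "restrict a0 {1..k} \<in> tuples q k" using a0 by (auto simp: tuples_def)
  ultimately show "x \<in> (\<lambda>a. \<lambda>n\<in>{1..k}. \<lambda>m\<in>{1..q}. vertex (a n) m) ` tuples q k" by blast
next
  fix x assume "x \<in> (\<lambda>a. \<lambda>n\<in>{1..k}. \<lambda>m\<in>{1..q}. vertex (a n) m) ` tuples q k"
  then obtain a where a: "a \<in> tuples q k" and x: "x = (\<lambda>n\<in>{1..k}. \<lambda>m\<in>{1..q}. vertex (a n) m)" by blast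
  have "(\<Sum>m\<in>{1..q}. x n m) = 1" if n: "n \<in> {1..k}" for n
    using prob_vec_vertex[OF tuples_mem[OF a n]] n by (simp add: x prob_vec_def)
  moreover have "x \<in> {1..k} \<rightarrow>\<^sub>E ({1..q} \<rightarrow>\<^sub>E {0, 1})" by (auto simp: x vertex_def)
  ultimately show "x \<in> integer_partitions k q" by (simp add: integer_partitions_def)
qed

lemma array_energy_at_vertex:
  assumes a: "a \<in> tuples q k"
  shows "array_energy_at E q r k G J (\<lambda>n\<in>{1..k}. \<lambda>m\<in>{1..q}. vertex (a n) m)
    = (\<Sum>n\<in>tuples k r. \<Sum>e\<in>E. J e (\<lambda>j\<in>{1..r}. a (n j)) (G e n)) / real k ^ r"
proof -
  let ?x = "\<lambda>n\<in>{1..k}. \<lambda>m\<in>{1..q}. vertex (a n) m"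
  have inner: "(\<Sum>z\<in>tuples q r. J e z (G e n) * (\<Prod>j\<in>{1..r}. ?x (n j) (z j))) = J e (\<lambda>j\<in>{1..r}. a (n j)) (G e n)"
    if n: "n \<in> tuples k r" for e n
  proof -
    have an: "(\<lambda>j\<in>{1..r}. a (n j)) \<in> tuples q r"
      unfolding tuples_def restrict_PiE_iff using tuples_mem[OF a tuples_mem[OF n]] by blast
    have "(\<Sum>z\<in>tuples q r. J e z (G e n) * (\<Prod>j\<in>{1..r}. ?x (n j) (z j)))
        = (\<Sum>z\<in>tuples q r. if z = (\<lambda>j\<in>{1..r}. a (n j)) then J e (\<lambda>j\<in>{1..r}. a (n j)) (G e n) else 0)"
    proof (rule sum.cong[OF refl])
      fix z assume z: "z \<in> tuples q r"
      have "(\<Prod>j\<in>{1..r}. ?x (n j) (z j)) = (\<Prod>j\<in>{1..r}. vertex ((\<lambda>j\<in>{1..r}. a (n j)) j) (z j))"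
        using tuples_mem[OF n] tuples_mem[OF z] by (intro prod.cong) auto
      then show "J e z (G e n) * (\<Prod>j\<in>{1..r}. ?x (n j) (z j))
          = (if z = (\<lambda>j\<in>{1..r}. a (n j)) then J e (\<lambda>j\<in>{1..r}. a (n j)) (G e n) else 0)"
        by (simp only: prod_vertex[OF z an]) auto
    qed
    also have "\<dots> = J e (\<lambda>j\<in>{1..r}. a (n j)) (G e n)" using an by simp
    finally show ?thesis .
  qed
  have "array_energy_at E q r k G J ?x
      = (\<Sum>e\<in>E. 1 / real k ^ r * (\<Sum>n\<in>tuples k r. \<Sum>z\<in>tuples q r. J e z (G e n) * (\<Prod>j\<in>{1..r}. ?x (n j) (z j))))"
    unfolding array_energy_at_def by (subst sum.swap) (rule refl)
  also have "\<dots> = (\<Sum>e\<in>E. 1 / real k ^ r * (\<Sum>n\<in>tuples k r. J e (\<lambda>j\<in>{1..r}. a (n j)) (G e n)))"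
    by (simp only: inner cong: sum.cong)
  also have "\<dots> = 1 / real k ^ r * (\<Sum>e\<in>E. \<Sum>n\<in>tuples k r. J e (\<lambda>j\<in>{1..r}. a (n j)) (G e n))"
    by (rule sum_distrib_left[symmetric])
  also have "\<dots> = (\<Sum>n\<in>tuples k r. \<Sum>e\<in>E. J e (\<lambda>j\<in>{1..r}. a (n j)) (G e n)) / real k ^ r"
    by (subst sum.swap) simp
  finally show ?thesis .
qed

text \<open>Compactness makes each supremum that of a bounded set, so that it really dominates the
  values.\<close>

lemma coupling_norm_ge:
  assumes "finite E" "compact K" "\<forall>e\<in>E. \<forall>z\<in>tuples q r. continuous_on K (J e z)"
    and e: "e \<in> E" and z: "z \<in> tuples q r" and c: "c \<in> K"
  shows "\<bar>J e z c\<bar> \<le> coupling_norm E K q r J"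
proof -
  have "compact ((\<lambda>c. \<bar>J e z c\<bar>) ` K)"
    using assms by (intro compact_continuous_image continuous_on_rabs) auto
  then have "bdd_above ((\<lambda>c. \<bar>J e z c\<bar>) ` K)"
    by (intro bounded_imp_bdd_above compact_imp_bounded)
  then have "\<bar>J e z c\<bar> \<le> (SUP c\<in>K. \<bar>J e z c\<bar>)"
    using c by (rule cSUP_upper[rotated])
  also have "\<dots> \<le> coupling_norm E K q r J"
    unfolding coupling_norm_def using assms(1) e z
    by (intro Max_ge) (auto intro!: image_eqI[of _ _ "(e, z)"])
  finally show ?thesis .
qed

lemma exists_fractional_partition:
  assumes "1 \<le> q"
  shows "fractional_partition q (\<lambda>m t. vertex 1 m)"
  using assms prob_vec_vertex[of 1 q] by (auto simp: fractional_partition_def prob_vec_def vertex_def)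

text \<open>Each of the four error terms is allotted a quarter of
  \<open>e = \<epsilon> * \<delta> / 2\<close>. This fixes \<open>d\<close> of order
  \<open>\<epsilon>\<^sup>2\<close> and \<open>\<gamma>\<close> of order \<epsilon>, and bounds
  \<open>L\<close> by a multiple of \<open>1 / \<epsilon>\<^sup>2\<close> and \<open>M\<close> by a
  multiple of \<open>ln (1 / \<epsilon>) / \<epsilon> ^ 4\<close>.\<close>

lemma sampling_parameters:
  fixes r q :: nat and \<delta> :: real
  assumes r: "1 \<le> r" and q: "1 \<le> q" and \<delta>: "0 < \<delta>"
  obtains c \<epsilon>0 where "0 < c" "0 < \<epsilon>0"
    "\<And>\<epsilon> k. 0 < \<epsilon> \<Longrightarrow> \<epsilon> < \<epsilon>0 \<Longrightarrow> c * (1 / \<epsilon>) ^ 4 * ln (1 / \<epsilon>) \<le> real k \<Longrightarrow>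
      \<exists>L M d \<gamma>. 1 \<le> L \<and> 1 \<le> M \<and> r * M + L * (r - 1) \<le> k \<and> 0 < d \<and> d \<le> 1 / 4 \<and>
        ln (real q) \<le> d * real L \<and> 0 < \<gamma> \<and>
        3 * real r * sqrt d + (real (L * (r - 1)) * ln (real q) + ln (1 / (\<epsilon> / 3))) / (\<gamma> * real M)
          + \<gamma> / 2 + 2 * real (r * r) / real k < \<epsilon> * \<delta> / 2"
proof -
  define R where "R = real r"
  define Q where "Q = ln (real q)"
  have R: "1 \<le> R" and Q: "0 \<le> Q" using r q by (auto simp: R_def Q_def)
  \<comment> \<open>\<open>c1\<close> bounds \<open>L\<close> and \<open>c2\<close> bounds
    \<open>A\<close>, both defined below. The 2 in \<open>c1\<close> pays for the rounding in
    \<open>L\<close>, the 3 in \<open>c2\<close> for \<open>ln 3 + l\<close>. In \<open>c\<close>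
    the first two summands pay for \<open>r * M\<close>, the third for \<open>L * (r - 1)\<close>
    and the last for the tuples with repeated entries.\<close>
  define c1 where "c1 = 576 * R\<^sup>2 * Q / \<delta>\<^sup>2 + 2"
  define c2 where "c2 = c1 * R * Q + 3"
  define c where "c = 32 * R * c2 / \<delta>\<^sup>2 + R + c1 * R + 16 * R\<^sup>2 / \<delta>"
  have c1: "0 < c1" using Q by (simp add: c1_def add_nonneg_pos)
  have c2: "0 < c2" using Q R c1 by (simp add: c2_def add_nonneg_pos)
  have c: "0 < c" using \<delta> R c1 c2 by (simp add: c_def add_pos_pos)
  \<comment> \<open>Below \<open>exp (- 1)\<close> the logarithm is at least 1 and can absorb
    constants; below \<open>1 / \<delta>\<close> the tolerance \<open>e\<close> is at most
    1.\<close>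
  define \<epsilon>0 where "\<epsilon>0 = min (exp (- 1)) (1 / \<delta>)"
  show thesis
  proof (rule that[of c \<epsilon>0])
    show "0 < c" by fact
    show "0 < \<epsilon>0" using \<delta> by (simp add: \<epsilon>0_def)
    fix \<epsilon> :: real and k :: nat
    assume \<epsilon>: "0 < \<epsilon>" "\<epsilon> < \<epsilon>0" and k: "c * (1 / \<epsilon>) ^ 4 * ln (1 / \<epsilon>) \<le> real k"
    define x where "x = 1 / \<epsilon>"
    define l where "l = ln x"
    have x0: "0 < x" using \<epsilon> by (simp add: x_def)
    have "exp 1 < x"
    proof -
      have "\<epsilon> < exp (- 1)" using \<epsilon>(2) by (simp add: \<epsilon>0_def)
      then have "exp 1 * \<epsilon> < 1" by (simp add: exp_minus field_simps)
      then show ?thesis using \<epsilon>(1) by (simp add: x_def field_simps)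
    qed
    then have l: "1 \<le> l" using x0 ln_less_cancel_iff[of "exp 1" x] by (simp add: l_def)
    have x1: "1 \<le> x" using \<open>exp 1 < x\<close> exp_ge_add_one_self[of 1] by linarith
    have xx: "x \<le> x ^ 4" "x\<^sup>2 \<le> x ^ 4" "1 \<le> x\<^sup>2" "1 \<le> x ^ 4"
      using x1 power_increasing[of 1 4 x] power_increasing[of 2 4 x] by auto
    have x4: "y \<le> x ^ 4 * l" if "y \<le> x ^ 4" for y
    proof -
      have "x ^ 4 * 1 \<le> x ^ 4 * l" using l x0 by (intro mult_left_mono) auto
      then show ?thesis using that by linarith
    qed
    define e where "e = \<epsilon> * \<delta> / 2"
    have e: "0 < e" "e \<le> 1"
      using \<epsilon> \<delta> by (auto simp: e_def \<epsilon>0_def field_simps)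
    have inv_e: "1 / e = 2 * x / \<delta>" using \<epsilon> \<delta> by (simp add: e_def x_def)
    have inv_e2: "1 / e\<^sup>2 = 4 * x\<^sup>2 / \<delta>\<^sup>2"
    proof -
      have "1 / e\<^sup>2 = (1 / e)\<^sup>2" by (simp add: power_divide)
      then show ?thesis by (simp add: inv_e power_divide power_mult_distrib)
    qed
    define d where "d = (e / (12 * R))\<^sup>2"
    define \<gamma> where "\<gamma> = e / 2"
    have sqrt_d: "3 * R * sqrt d = e / 4" using e R by (simp add: d_def)
    have d: "0 < d" "d \<le> 1 / 4"
    proof -
      show "0 < d" using e R by (simp add: d_def)
      have "e / (12 * R) \<le> 1 / 2" using e R by (simp add: field_simps)
      then have "d \<le> (1 / 2)\<^sup>2" unfolding d_def using e R by (intro power_mono) auto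
      then show "d \<le> 1 / 4" by (simp add: power2_eq_square)
    qed
    define L where "L = nat \<lceil>Q / d\<rceil> + 1"
    have Qd: "0 \<le> Q / d" using Q d by simp
    have L_ge: "Q \<le> d * real L"
    proof -
      have "Q / d \<le> real L" using Qd by (simp add: L_def) linarith
      then show ?thesis using d by (simp add: field_simps)
    qed
    have L_le: "real L \<le> c1 * x\<^sup>2"
    proof -
      have "real L \<le> Q / d + 2" using Qd by (simp add: L_def) linarith
      also have "Q / d = Q * (144 * R\<^sup>2) * (1 / e\<^sup>2)"
        using e R by (simp add: d_def power_divide power_mult_distrib)
      also have "\<dots> = 576 * R\<^sup>2 * Q / \<delta>\<^sup>2 * x\<^sup>2" by (simp add: inv_e2)
      finally show ?thesis using xx(3) by (simp add: c1_def algebra_simps)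
    qed
    have Lr: "real (L * (r - 1)) \<le> c1 * x\<^sup>2 * R"
      using L_le R by (simp only: of_nat_mult) (intro mult_mono, auto simp: R_def)
    define A where "A = real (L * (r - 1)) * Q + ln (1 / (\<epsilon> / 3))"
    have ln3: "ln (1 / (\<epsilon> / 3)) = ln 3 + l"
      using \<epsilon> by (simp add: l_def x_def ln_div)
    have ln3': "0 \<le> ln (3::real)" "ln (3::real) \<le> 2"
      using ln_le_minus_one[of "3::real"] by auto
    have A0: "0 < A"
      unfolding A_def ln3 using Q l ln3'(1) by (intro add_nonneg_pos mult_nonneg_nonneg) auto
    have A_le: "A \<le> c2 * (x\<^sup>2 * l)"
    proof -
      have "real (L * (r - 1)) * Q \<le> c1 * x\<^sup>2 * R * Q" using Lr Q by (rule mult_right_mono)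
      also have "\<dots> \<le> c1 * x\<^sup>2 * R * Q * l"
        using l c1 R Q x0 mult_left_mono[of 1 l "c1 * x\<^sup>2 * R * Q"] by simp
      finally have 1: "real (L * (r - 1)) * Q \<le> c1 * R * Q * (x\<^sup>2 * l)" by (simp add: mult_ac)
      have "l \<le> x\<^sup>2 * l" using xx(3) l mult_right_mono[of 1 "x\<^sup>2" l] by simp
      then have "ln 3 + l \<le> 3 * (x\<^sup>2 * l)" using ln3'(2) l by linarith
      with 1 show ?thesis unfolding A_def ln3 c2_def distrib_right by linarith
    qed
    \<comment> \<open>As \<open>\<gamma> = e / 2\<close>, the condition
      \<open>A / (\<gamma> * real M) < e / 4\<close> means that \<open>M\<close> exceeds
      \<open>8 * A / e\<^sup>2\<close>. Rounding down and adding one makes this strict, which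
      supplies the strictness of the total estimate.\<close>
    define M where "M = nat \<lfloor>8 * A / e\<^sup>2\<rfloor> + 1"
    have A8: "0 \<le> 8 * A / e\<^sup>2" using A0 by simp
    have M: "8 * A / e\<^sup>2 < real M" "real M \<le> 8 * A / e\<^sup>2 + 1"
      using A8 by (auto simp: M_def) linarith+
    have "8 * A / e\<^sup>2 = 32 * A * x\<^sup>2 / \<delta>\<^sup>2"
      using inv_e2 by (simp add: divide_inverse mult_ac)
    also have "\<dots> \<le> 32 * (c2 * (x\<^sup>2 * l)) * x\<^sup>2 / \<delta>\<^sup>2"
      using A_le by (intro divide_right_mono mult_right_mono mult_left_mono) auto
    also have "\<dots> = 32 * c2 / \<delta>\<^sup>2 * (x ^ 4 * l)"
      by (simp add: power2_eq_square power4_eq_xxxx mult_ac)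
    finally have "real M \<le> 32 * c2 / \<delta>\<^sup>2 * (x ^ 4 * l) + x ^ 4 * l"
      using M(2) x4[OF xx(4)] by linarith
    then have "R * real M \<le> R * (32 * c2 / \<delta>\<^sup>2 * (x ^ 4 * l) + x ^ 4 * l)"
      using R by (intro mult_left_mono) auto
    then have RM: "R * real M \<le> (32 * R * c2 / \<delta>\<^sup>2 + R) * (x ^ 4 * l)"
      by (simp add: algebra_simps)
    have "c1 * x\<^sup>2 * R \<le> c1 * (x ^ 4 * l) * R"
      using x4[OF xx(2)] c1 R by (intro mult_right_mono mult_left_mono) auto
    with Lr have LR: "real (L * (r - 1)) \<le> (c1 * R) * (x ^ 4 * l)" by (simp add: mult_ac)
    have "8 * R\<^sup>2 / e = 16 * R\<^sup>2 / \<delta> * x"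
      using inv_e by (simp add: divide_inverse mult_ac)
    also have "\<dots> \<le> 16 * R\<^sup>2 / \<delta> * (x ^ 4 * l)"
      using x4[OF xx(1)] \<delta> by (intro mult_left_mono) auto
    finally have ke: "8 * R\<^sup>2 / e \<le> 16 * R\<^sup>2 / \<delta> * (x ^ 4 * l)" .
    have k': "c * (x ^ 4 * l) \<le> real k" using k by (simp add: x_def l_def mult_ac)
    have pos: "0 \<le> x ^ 4 * l" using x0 l by simp
    have "R * real M + real (L * (r - 1)) \<le> c * (x ^ 4 * l)"
      using RM LR ke mult_nonneg_nonneg[OF _ pos, of "16 * R\<^sup>2 / \<delta>"] \<delta> by (simp add: c_def distrib_right)
    then have "real (r * M + L * (r - 1)) \<le> real k" using k' by (simp add: R_def)
    then have budget: "r * M + L * (r - 1) \<le> k" by (simp only: of_nat_le_iff)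
    have "8 * R\<^sup>2 / e \<le> c * (x ^ 4 * l)"
      using ke mult_nonneg_nonneg[OF _ pos, of "32 * R * c2 / \<delta>\<^sup>2 + R + c1 * R"] R c1 c2 \<delta>
      by (simp add: c_def distrib_right)
    then have ke': "8 * R\<^sup>2 / e \<le> real k" using k' by linarith
    have "0 < 8 * R\<^sup>2 / e" using e R by simp
    with ke' have kpos: "0 < real k" by linarith
    have "8 * R\<^sup>2 \<le> real k * e" using ke' e(1) by (simp add: field_simps)
    with kpos have T4: "2 * real (r * r) / real k \<le> e / 4"
      by (simp add: field_simps R_def power2_eq_square)
    have M0: "0 < real M" by (simp add: M_def)
    have "8 * A < real M * e\<^sup>2" using M(1) e by (simp add: field_simps)
    then have T2: "A / (\<gamma> * real M) < e / 4"
      using e M0 by (simp add: \<gamma>_def field_simps power2_eq_square)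
    show "\<exists>L M d \<gamma>. 1 \<le> L \<and> 1 \<le> M \<and> r * M + L * (r - 1) \<le> k \<and> 0 < d \<and> d \<le> 1 / 4 \<and>
        ln (real q) \<le> d * real L \<and> 0 < \<gamma> \<and>
        3 * real r * sqrt d + (real (L * (r - 1)) * ln (real q) + ln (1 / (\<epsilon> / 3))) / (\<gamma> * real M)
          + \<gamma> / 2 + 2 * real (r * r) / real k < \<epsilon> * \<delta> / 2"
    proof (intro exI conjI)
      show "r * M + L * (r - 1) \<le> k" "0 < d" "d \<le> 1 / 4" by fact+
      show "1 \<le> L" "1 \<le> M" by (simp_all add: L_def M_def)
      show "ln (real q) \<le> d * real L" using L_ge by (simp add: Q_def)
      show "0 < \<gamma>" using e by (simp add: \<gamma>_def)
      have "\<gamma> / 2 = e / 4" by (simp add: \<gamma>_def)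
      then show "3 * real r * sqrt d + (real (L * (r - 1)) * ln (real q) + ln (1 / (\<epsilon> / 3))) / (\<gamma> * real M)
          + \<gamma> / 2 + 2 * real (r * r) / real k < \<epsilon> * \<delta> / 2"
        using sqrt_d T2 T4 unfolding A_def Q_def R_def e_def[symmetric] by linarith
    qed
  qed
qed

text \<open>The energies do not scale with the values of \<open>W\<close>, but the tolerance does.
  The lower bound \<open>\<delta>\<close> on the norm of the graphon keeps the tolerance from
  degenerating, and \<open>c\<close> depends on it.\<close>

theorem theorem10:
  fixes E :: "'e set" and K :: "'a::real_normed_vector set" and q r :: nat
    and J :: "'e \<Rightarrow> (nat \<Rightarrow> nat) \<Rightarrow> 'a \<Rightarrow> real" and \<delta> :: real
  assumes "r \<ge> 1" and "q \<ge> 1" and "finite E" and "compact K"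
    and "\<forall>e\<in>E. \<forall>z\<in>tuples q r. continuous_on K (J e z)"
    and "\<delta> > 0"
  shows "\<exists>c>0. \<exists>\<epsilon>0>0. \<forall>\<epsilon>. 0 < \<epsilon> \<and> \<epsilon> < \<epsilon>0 \<longrightarrow>
    (\<forall>W. layered_graphon E K r W \<and> graphon_norm E r W \<ge> \<delta> \<longrightarrow>
      (\<forall>k::nat. real k \<ge> c * (1 / \<epsilon>) ^ 4 * ln (1 / \<epsilon>) \<longrightarrow>
        measure (unif k r)
          {u \<in> space (unif k r).
             \<bar>energy E q r W J - array_energy E q r k (sample r W u) J\<bar>
               > \<epsilon> * real (card E) * coupling_norm E K q r J * graphon_norm E r W} < \<epsilon>))"
proof (rule sampling_parameters[OF assms(1,2,6)])
  fix c \<epsilon>0 :: real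
  assume c: "0 < c" "0 < \<epsilon>0"
    and par: "\<And>\<epsilon> k. 0 < \<epsilon> \<Longrightarrow> \<epsilon> < \<epsilon>0 \<Longrightarrow> c * (1 / \<epsilon>) ^ 4 * ln (1 / \<epsilon>) \<le> real k \<Longrightarrow>
      \<exists>L M d \<gamma>. 1 \<le> L \<and> 1 \<le> M \<and> r * M + L * (r - 1) \<le> k \<and> 0 < d \<and> d \<le> 1 / 4 \<and>
        ln (real q) \<le> d * real L \<and> 0 < \<gamma> \<and>
        3 * real r * sqrt d + (real (L * (r - 1)) * ln (real q) + ln (1 / (\<epsilon> / 3))) / (\<gamma> * real M)
          + \<gamma> / 2 + 2 * real (r * r) / real k < \<epsilon> * \<delta> / 2"
  show ?thesis
  proof (rule exI[of _ c], intro conjI c(1), rule exI[of _ \<epsilon>0], intro conjI c(2) allI impI, elim conjE)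
    fix \<epsilon> W and k :: nat
    assume \<epsilon>: "0 < \<epsilon>" "\<epsilon> < \<epsilon>0" and W: "layered_graphon E K r W" and norm: "\<delta> \<le> graphon_norm E r W"
      and k: "c * (1 / \<epsilon>) ^ 4 * ln (1 / \<epsilon>) \<le> real k"
    from par[OF \<epsilon> k] obtain L M d \<gamma> where L: "1 \<le> L" and M: "1 \<le> M" and LM: "r * M + L * (r - 1) \<le> k"
      and d: "0 < d" "d \<le> 1 / 4" "ln (real q) \<le> d * real L" and \<gamma>: "0 < \<gamma>"
      and err: "3 * real r * sqrt d + (real (L * (r - 1)) * ln (real q) + ln (1 / (\<epsilon> / 3))) / (\<gamma> * real M)
          + \<gamma> / 2 + 2 * real (r * r) / real k < \<epsilon> * \<delta> / 2"
      by blast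
    define C where "C = real (card E) * coupling_norm E K q r J"
    \<comment> \<open>If \<open>C = 0\<close>, the quotient is 0 by convention and the numerator
      vanishes as well, so \<open>C * w z x\<close> recovers the sum over the layers in every
      case.\<close>
    define w where "w = (\<lambda>z x. (\<Sum>e\<in>E. J e z (W e x)) / C)"
    have WK: "W e x \<in> K" if "e \<in> E" "x \<in> space (unif r r)" for e x
      using W that measurable_space[of "W e" "unif r r" "restrict_space borel K" x]
      by (auto simp: layered_graphon_def space_restrict_space)
    have Jm: "(\<lambda>x. J e z (W e x)) \<in> borel_measurable (unif r r)" if "e \<in> E" "z \<in> tuples q r" for e z
    proof -
      have 1: "W e \<in> measurable (unif r r) (restrict_space borel K)"
        using W that(1) by (simp add: layered_graphon_def)
      have 2: "J e z \<in> borel_measurable (restrict_space borel K)"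
        using assms(5) that by (simp add: borel_measurable_continuous_on_restrict)
      show ?thesis by (rule measurable_compose[OF 1 2])
    qed
    have J_le: "\<bar>J e z (W e x)\<bar> \<le> coupling_norm E K q r J"
      if "e \<in> E" "z \<in> tuples q r" "x \<in> space (unif r r)" for e z x
      by (rule coupling_norm_ge[OF assms(3-5) that(1,2) WK[OF that(1,3)]])
    have sum_le: "\<bar>\<Sum>e\<in>E. J e z (W e x)\<bar> \<le> C" if "z \<in> tuples q r" "x \<in> space (unif r r)" for z x
    proof -
      have "\<bar>\<Sum>e\<in>E. J e z (W e x)\<bar> \<le> (\<Sum>e\<in>E. \<bar>J e z (W e x)\<bar>)" by (rule sum_abs)
      also have "\<dots> \<le> C"
        unfolding C_def by (rule sum_bounded_above) (rule J_le[OF _ that])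
      finally show ?thesis .
    qed
    have rk: "r \<le> k"
    proof -
      have "r \<le> r * M" using M by simp
      then show ?thesis using LM by linarith
    qed
    interpret sampling k r q w
    proof
      show "1 \<le> r" "1 \<le> q" "r \<le> k" by fact+
      show "w z \<in> borel_measurable (unif r r)" if "z \<in> tuples q r" for z
        unfolding w_def by (intro borel_measurable_divide borel_measurable_sum borel_measurable_const Jm that)
      show "\<bar>w z x\<bar> \<le> 1" if "z \<in> tuples q r" "x \<in> space (unif r r)" for z x
        using sum_le[OF that] by (cases "C = 0") (auto simp: w_def abs_divide divide_le_eq)
    qed
    interpret U: prob_space "unif r r"
      unfolding unif_def by (intro prob_space_PiM prob_space_axioms)
    have Cw: "(\<Sum>e\<in>E. J e z (W e x)) = C * w z x" if "z \<in> tuples q r" "x \<in> space (unif r r)" for z x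
      using sum_le[OF that] by (cases "C = 0") (auto simp: w_def)
    define F where "F = (\<lambda>\<phi>. \<integral>x. multilin (\<lambda>j m. \<phi> m (x {j})) x \<partial>unif r r)"
    have energy_F: "energy_at E q r W J \<phi> = C * F \<phi>" and F_le: "F \<phi> \<le> 1"
      if \<phi>: "fractional_partition q \<phi>" for \<phi>
    proof -
      let ?\<Pi> = "\<lambda>z x. \<Prod>j\<in>{1..r}. \<phi> (z j) (x {j})"
      have coord: "(\<lambda>x. x {j}) \<in> measurable (unif r r) M01" if "j \<in> {1..r}" for j
        unfolding unif_def using that by (intro measurable_component_singleton) (auto simp: D_eq)
      have m: "?\<Pi> z \<in> borel_measurable (unif r r)" if z: "z \<in> tuples q r" for z
      proof (rule borel_measurable_prod)
        fix j assume j: "j \<in> {1..r}"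
        have "\<phi> (z j) \<in> borel_measurable M01"
          using \<phi> tuples_mem[OF z j] by (simp add: fractional_partition_def)
        then show "(\<lambda>x. \<phi> (z j) (x {j})) \<in> borel_measurable (unif r r)"
          by (rule measurable_compose[OF coord[OF j]])
      qed
      have xj: "x {j} \<in> {0..1}" if "x \<in> space (unif r r)" "j \<in> {1..r}" for x j
        using measurable_space[OF coord[OF that(2)] that(1)] by (simp add: space_restrict_space)
      have pv: "prob_vec q (\<lambda>m. \<phi> m (x {j}))" if "x \<in> space (unif r r)" "j \<in> {1..r}" for x j
        using \<phi> xj[OF that] by (auto simp: fractional_partition_def prob_vec_def)
      have \<Pi>1: "\<bar>?\<Pi> z x\<bar> \<le> 1" if z: "z \<in> tuples q r" and x: "x \<in> space (unif r r)" for z x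
      proof -
        have "\<bar>\<phi> (z j) (x {j})\<bar> \<le> 1" if j: "j \<in> {1..r}" for j
          using prob_vec_le_1[OF pv[OF x j] tuples_mem[OF z j]] pv[OF x j] tuples_mem[OF z j]
          by (auto simp: prob_vec_def)
        then show ?thesis unfolding abs_prod by (intro prod_le_1) auto
      qed
      have Ji: "integrable (unif r r) (\<lambda>x. J e z (W e x) * ?\<Pi> z x)" if "e \<in> E" "z \<in> tuples q r" for e z
      proof (rule U.integrable_const_bound[of _ "coupling_norm E K q r J * 1"])
        show "AE x in unif r r. norm (J e z (W e x) * ?\<Pi> z x) \<le> coupling_norm E K q r J * 1"
        proof (rule AE_I2)
          fix x assume x: "x \<in> space (unif r r)"
          have "\<bar>J e z (W e x)\<bar> * \<bar>?\<Pi> z x\<bar> \<le> coupling_norm E K q r J * 1"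
            using J_le[OF that x] \<Pi>1[OF that(2) x] by (intro mult_mono) auto
          then show "norm (J e z (W e x) * ?\<Pi> z x) \<le> coupling_norm E K q r J * 1"
            by (simp only: real_norm_def abs_mult)
        qed
      qed (intro borel_measurable_times Jm m that)
      have wi: "integrable (unif r r) (\<lambda>x. ?\<Pi> z x * w z x)" if "z \<in> tuples q r" for z
      proof (rule U.integrable_const_bound[of _ "1 * 1"])
        show "AE x in unif r r. norm (?\<Pi> z x * w z x) \<le> 1 * 1"
        proof (rule AE_I2)
          fix x assume x: "x \<in> space (unif r r)"
          have "\<bar>?\<Pi> z x\<bar> * \<bar>w z x\<bar> \<le> 1 * 1"
            using w_le[OF that x] \<Pi>1[OF that x] by (intro mult_mono) auto
          then show "norm (?\<Pi> z x * w z x) \<le> 1 * 1" by (simp only: real_norm_def abs_mult)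
        qed
      qed (intro borel_measurable_times w_measurable m that)
      have "energy_at E q r W J \<phi> = (\<Sum>z\<in>tuples q r. \<Sum>e\<in>E. \<integral>x. J e z (W e x) * ?\<Pi> z x \<partial>unif r r)"
        unfolding energy_at_def by (rule sum.swap)
      also have "\<dots> = (\<Sum>z\<in>tuples q r. \<integral>x. (\<Sum>e\<in>E. J e z (W e x) * ?\<Pi> z x) \<partial>unif r r)"
        by (intro sum.cong refl Bochner_Integration.integral_sum[symmetric] Ji)
      also have "\<dots> = (\<Sum>z\<in>tuples q r. \<integral>x. C * (?\<Pi> z x * w z x) \<partial>unif r r)"
        by (intro sum.cong refl Bochner_Integration.integral_cong)
          (simp add: sum_distrib_right[symmetric] Cw)
      also have "\<dots> = C * (\<Sum>z\<in>tuples q r. \<integral>x. ?\<Pi> z x * w z x \<partial>unif r r)"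
        by (simp add: sum_distrib_left)
      also have "(\<Sum>z\<in>tuples q r. \<integral>x. ?\<Pi> z x * w z x \<partial>unif r r) = F \<phi>"
        unfolding F_def multilin_def by (intro Bochner_Integration.integral_sum[symmetric] wi)
      finally show "energy_at E q r W J \<phi> = C * F \<phi>" .
      have "multilin (\<lambda>j m. \<phi> m (x {j})) x \<le> 1" if "x \<in> space (unif r r)" for x
        using multilin_le[OF pv[OF that] that] by (simp add: abs_le_iff)
      moreover have "integrable (unif r r) (\<lambda>x. multilin (\<lambda>j m. \<phi> m (x {j})) x)"
        unfolding multilin_def by (intro Bochner_Integration.integrable_sum wi)
      ultimately show "F \<phi> \<le> 1"
        unfolding F_def by (intro U.integral_le_const AE_I2) auto
    qed
    have C0: "0 \<le> C"
    proof -
      obtain x where "x \<in> space (unif r r)" using U.not_empty by blast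
      moreover have "(\<lambda>j\<in>{1..r}. 1) \<in> tuples q r" using assms(2) by (auto simp: tuples_def)
      ultimately show ?thesis using sum_le[of "\<lambda>j\<in>{1..r}. 1" x] by linarith
    qed
    note ex = exists_fractional_partition[OF assms(2)]
    have energy_upper: "C * F \<phi> \<le> energy E q r W J" if \<phi>: "fractional_partition q \<phi>" for \<phi>
    proof -
      have "bdd_above (energy_at E q r W J ` {\<phi>. fractional_partition q \<phi>})"
        using energy_F F_le C0 by (intro bdd_aboveI2[where M = C]) (auto simp: mult_left_le)
      then have "energy_at E q r W J \<phi> \<le> energy E q r W J"
        unfolding energy_def using \<phi> by (intro cSUP_upper) auto
      then show ?thesis by (simp add: energy_F[OF \<phi>])
    qed
    have energy_approx: "\<exists>\<phi>. fractional_partition q \<phi> \<and> t < C * F \<phi>" if "t < energy E q r W J" for t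
    proof (rule ccontr)
      assume neg: "\<not> ?thesis"
      have "energy E q r W J \<le> t"
        unfolding energy_def
      proof (rule cSUP_least)
        show "{\<phi>. fractional_partition q \<phi>} \<noteq> {}" using ex by blast
        show "energy_at E q r W J \<phi> \<le> t" if "\<phi> \<in> {\<phi>. fractional_partition q \<phi>}" for \<phi>
          using neg that by (auto simp: energy_F not_less)
      qed
      with that show False by simp
    qed
    have array: "array_energy E q r k (sample r W u) J = Max ((\<lambda>a. C * label_energy a u) ` Lab)"
      if u: "u \<in> space P" for u
    proof -
      have "array_energy_at E q r k (sample r W u) J (\<lambda>n\<in>{1..k}. \<lambda>m\<in>{1..q}. vertex (a n) m) = C * label_energy a u"
        if a: "a \<in> Lab" for a
      proof -
        have "(\<Sum>e\<in>E. J e (\<lambda>j\<in>{1..r}. a (n j)) (sample r W u e n))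
            = C * w (\<lambda>j\<in>{1..r}. a (n j)) (\<lambda>A\<in>D. u (n ` A))" if n: "n \<in> tuples k r" for n
          unfolding sample_def
          by (rule Cw[OF relabel_tuple[OF a n] measurable_space[OF measurable_tuple[OF n] u]])
        then show ?thesis
          unfolding array_energy_at_vertex[OF a] label_energy_def by (simp add: sum_distrib_left)
      qed
      then show ?thesis
        unfolding array_energy_def integer_partitions_eq image_image by (simp cong: image_cong)
    qed
    have Lab_ne: "Lab \<noteq> {}"
    proof -
      have "(\<lambda>n\<in>{1..k}. 1) \<in> Lab" using assms(2) by (auto simp: tuples_def)
      then show ?thesis by blast
    qed
    let ?bad = "{u \<in> space P. \<epsilon> * real (card E) * coupling_norm E K q r J * graphon_norm E r W
        < \<bar>energy E q r W J - array_energy E q r k (sample r W u) J\<bar>}"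
    have "measure P ?bad < \<epsilon>"
    \<comment> \<open>For \<open>C = 0\<close> both energies and the tolerance are 0, and the strict
      inequality holds for no sample.\<close>
    proof (cases "C = 0")
      case True
      have "?bad = {}"
      proof -
        have "energy E q r W J = 0"
          using energy_upper[OF ex] energy_approx[of 0] True
          by (cases "energy E q r W J" "0::real" rule: linorder_cases) auto
        moreover have "array_energy E q r k (sample r W u) J = 0" if "u \<in> space P" for u
          using array[OF that] True Lab_ne by (simp add: image_constant_conv)
        moreover have "\<epsilon> * real (card E) * coupling_norm E K q r J * graphon_norm E r W = 0"
          using True by (auto simp: C_def)
        ultimately show ?thesis by auto
      qed
      then show ?thesis using \<epsilon> by (simp only: measure_empty)
    next
      case False
      with C0 have Cpos: "0 < C" by simp
      define V where "V = energy E q r W J / C"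
      define e where "e = \<epsilon> * \<delta> / 2"
      have e0: "0 < e" using \<epsilon> assms(6) by (simp add: e_def)
      have energy_V: "energy E q r W J = C * V" using Cpos by (simp add: V_def)
      \<comment> \<open>The supremum may not be attained. The lower tail spends one \<open>e\<close>
        on choosing \<open>\<phi>\<close> and another on sampling; this is why the tolerance is
        split as \<open>2 * e = \<epsilon> * \<delta>\<close>.\<close>
      obtain \<phi> where \<phi>: "fractional_partition q \<phi>" and "C * (V - e) < C * F \<phi>"
        using energy_approx[of "C * (V - e)"] Cpos e0 by (auto simp: energy_V)
      then have \<phi>V: "V - e < F \<phi>" using Cpos by simp
      let ?up = "{u \<in> space P. \<exists>a\<in>Lab. V + e < label_energy a u}"
      let ?down = "{u \<in> space P. \<not> (\<exists>a\<in>Lab. F \<phi> - e < label_energy a u)}"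
      have up: "measure P ?up < \<epsilon> / 3"
      proof (rule upper_tail[OF L LM M d \<gamma>])
        show "(\<integral>y. multilin (\<lambda>j m. \<phi> m (y {j})) y \<partial>unif r r) \<le> V" if "fractional_partition q \<phi>" for \<phi>
          using energy_upper[OF that] Cpos by (simp add: energy_V F_def)
      qed (use \<epsilon> err in \<open>simp_all add: e_def\<close>)
      have down: "measure P ?down < \<epsilon> / 3"
        unfolding F_def
      proof (rule lower_tail[OF _ M \<gamma> _ \<phi>])
        have "0 \<le> real (L * (r - 1)) * ln (real q)" using assms(2) by simp
        then have "ln (1 / (\<epsilon> / 3)) / (\<gamma> * real M)
            \<le> (real (L * (r - 1)) * ln (real q) + ln (1 / (\<epsilon> / 3))) / (\<gamma> * real M)"
          using \<gamma> by (intro divide_right_mono) auto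
        moreover have "0 \<le> 3 * real r * sqrt d" using d by simp
        ultimately show "ln (1 / (\<epsilon> / 3)) / (\<gamma> * real M) + \<gamma> / 2 + 2 * real (r * r) / real k < e"
          using err unfolding e_def by linarith
      qed (use \<epsilon> LM in simp_all)
      have sup: "?up \<in> sets P" by (rule measurable_exceeds)
      have sdown: "?down \<in> sets P"
      proof -
        have "?down = space P - {u \<in> space P. \<exists>a\<in>Lab. F \<phi> - e < label_energy a u}" by auto
        then show ?thesis using measurable_exceeds[of "F \<phi> - e"] by auto
      qed
      have "?bad \<subseteq> ?up \<union> ?down"
      proof
        fix u assume "u \<in> ?bad"
        then have u: "u \<in> space P" and bad: "\<epsilon> * real (card E) * coupling_norm E K q r J * graphon_norm E r W
            < \<bar>energy E q r W J - array_energy E q r k (sample r W u) J\<bar>" by auto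
        let ?A = "(\<lambda>a. C * label_energy a u) ` Lab"
        have "Max ?A \<in> ?A" using Lab_ne by (intro Max_in) auto
        then obtain a where a: "a \<in> Lab" "Max ?A = C * label_energy a u" by blast
        have le: "C * label_energy b u \<le> C * label_energy a u" if "b \<in> Lab" for b
          using that unfolding a(2)[symmetric] by (intro Max_ge) auto
        have "C * (2 * e) = \<epsilon> * C * \<delta>" by (simp add: e_def)
        also have "\<dots> \<le> \<epsilon> * C * graphon_norm E r W"
          using \<epsilon> Cpos norm by (intro mult_left_mono) auto
        also have "\<dots> < \<bar>C * V - C * label_energy a u\<bar>"
          using bad by (simp add: C_def[symmetric] mult.assoc array[OF u] a(2) energy_V)
        also have "\<dots> = C * \<bar>V - label_energy a u\<bar>"
          using Cpos by (simp add: right_diff_distrib[symmetric] abs_mult)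
        finally have "2 * e < \<bar>V - label_energy a u\<bar>" using Cpos by simp
        then consider "V + e < label_energy a u" | "label_energy a u < V - 2 * e" using e0 by linarith
        then show "u \<in> ?up \<union> ?down"
        proof cases
          case 1
          then show ?thesis using u a(1) by auto
        next
          case 2
          have "\<not> F \<phi> - e < label_energy b u" if "b \<in> Lab" for b
            using le[OF that] Cpos 2 \<phi>V by simp
          then show ?thesis using u by auto
        qed
      qed
      then have "measure P ?bad \<le> measure P (?up \<union> ?down)"
        using sup sdown by (intro P.finite_measure_mono) auto
      also have "\<dots> \<le> measure P ?up + measure P ?down"
        using sup sdown by (rule measure_Un_le)
      also have "\<dots> < \<epsilon>" using up down \<epsilon> by linarith
      finally show ?thesis .
    qed
    then show "measure (unif k r) {u \<in> space (unif k r). \<epsilon> * real (card E) * coupling_norm E K q r J * graphon_norm E r W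
        < \<bar>energy E q r W J - array_energy E q r k (sample r W u) J\<bar>} < \<epsilon>"
      by (simp only: unif_eq)
  qed
qed

end
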